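(* Let $M$ be an imaginary quadratic field, let $A$ be an abelian surface over $\mathbb{Q}$ such that $A_{\overline{\mathbb{Q}}}\sim E_{\overline{\mathbb{Q}}}^2$ with $E$ an elliptic curve with CM by $M$, and let $K$, $N$, $E^*$, $L$ be as in the context. Let $V=\mathrm{Hom}(E^*_L,A_L)$ be the $M$-vector space with its $c$-representation structure $\varrho_V$ of $\mathrm{Gal}(L/M)$, let $T=\mathrm{Hom}_M(V,V)\simeq V\otimes V^*$ with the induced $c$-representation structure $\varrho_T(\sigma)(g)=\varrho_V(\sigma)\circ g\circ\varrho_V(\sigma)^{-1}$ (which is an honest representation of $\mathrm{Gal}(L/M)$), and let $R=\mathrm{End}(A_K)$, regarded as an $M$-vector space with the natural Galois conjugation action of $\mathrm{Gal}(L/M)$ (which factors through $\mathrm{Gal}(K/M)$). Then the map $$\Phi:R\to T,\qquad \Phi(\psi)(f)=\psi\circ f\quad\text{for } f\in V,\ \psi\in\mathrm{End}(A_K),$$ is an isomorphism of $c$-representations, and thus of $M[\mathrm{Gal}(L/M)]$-modules.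
   Context: Abelian varieties are considered up to isogeny: $\mathrm{End}$ and $\mathrm{Hom}$ are homomorphisms over the base field tensored with $\mathbb{Q}$; isogenies are invertible; $\sim$ is isogeny over the base field; $A_F$ is base change to $F$. CM by $M$ means the geometric endomorphism algebra is $M$. Setting: $K/\mathbb{Q}$ is the minimal extension with $\mathrm{End}(A_{\overline{\mathbb{Q}}})=\mathrm{End}(A_K)$ (it is Galois over $\mathbb{Q}$ and contains the Hilbert class field of $M$); $E$ is taken to be defined over $K$ with $A_K\sim E^2$. $N/M$ is a Galois subextension of $K/M$ and $E^*$ is a Ribet $M$-curve completely defined over $N$ with $E^*_{\overline{\mathbb{Q}}}\sim E_{\overline{\mathbb{Q}}}$; this means $E^*$ is an elliptic curve over $N$ and for every $\sigma\in G_M$ there is an isogeny $\mu_\sigma:{}^\sigma E^*\to E^*$ defined over $N$ with $\mu_\sigma\circ{}^\sigma\varphi=\varphi\circ\mu_\sigma$ for all $\varphi\in\mathrm{End}(E^* )$. $L/K$ is the smallest extension such that $E^*_L\sim E_L$; $L/\mathbb{Q}$ is Galois. A $c$-representation of a finite group $G$ on a finite-dimensional vector space $V$ over a field $k$ is a map $\varrho_V:G\to\mathrm{GL}(V)$ with $\varrho_V(1)=1$ for which there is a map $c_V:G\times G\to k^\times$ with $\varrho_V(\sigma)\varrho_V(\tau)=\varrho_V(\sigma\tau)c_V(\sigma,\tau)$ for all $\sigma,\tau$. A homomorphism of $c$-representations $V\to W$ is a $k$-linear map $f$ with $f(v)=\varrho_W(\sigma)(f(\varrho_V(\sigma)^{-1}v))$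 for all $v\in V$, $\sigma\in G$. Fix a system of isogenies $\{\mu_\sigma:{}^\sigma E^*\to E^*\}_{\sigma\in\mathrm{Gal}(L/M)}$, each defined over $N$ and satisfying $\mu_\sigma\circ{}^\sigma\varphi=\varphi\circ\mu_\sigma$ for all $\varphi\in\mathrm{End}(E^* )$, with $\mu_1=\mathrm{id}$, and identify $\mathrm{End}(E^* )$ with $M$. $V$ is an $M$-vector space via precomposition with $\mathrm{End}(E^* )=M$, and $\varrho_V(\sigma)(f)={}^\sigma f\circ\mu_\sigma^{-1}$, with $c_V(\sigma,\tau)=c_{E^*}^L(\sigma,\tau)=\mu_{\sigma\tau}\circ{}^\sigma\mu_\tau^{-1}\circ\mu_\sigma^{-1}$. $R=\mathrm{End}(A_K)\simeq\mathrm{M}_2(M)$ is an $M$-vector space through its center $M$, identified with $\mathrm{End}(E^* )=M$ so that $m\circ f=f\circ m$ for $f\in V$, $m\in M$. *)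

theory Defs
  imports "HOL-Algebra.Algebraic_Closure_Type" "HOL-Algebra.Embedded_Algebras"
    "HOL-Algebra.QuotRing" "HOL-Algebra.Bij"
begin

section \<open>Fields of algebraic numbers and Galois groups\<close>

type_synonym qbar = "rat alg_closure"

abbreviation Qbar :: "qbar ring" where
  "Qbar \<equiv> ring_of_type_algebra"

definition fld :: "qbar set \<Rightarrow> qbar ring" where
  "fld F = Qbar\<lparr>carrier := F\<rparr>"

definition finite_extension :: "qbar set \<Rightarrow> qbar set \<Rightarrow> bool" where
  "finite_extension F L \<longleftrightarrow>
     subfield F Qbar \<and> subfield L Qbar \<and> F \<subseteq> L \<and> ring.finite_dimension Qbar F L"

definition number_field :: "qbar set \<Rightarrow> bool" where
  "number_field L \<longleftrightarrow> finite_extension \<rat> L"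

definition imaginary_quadratic :: "qbar set \<Rightarrow> bool" where
  "imaginary_quadratic M \<longleftrightarrow>
     (\<exists>(d::nat) s. d > 0 \<and> s * s = - of_nat d \<and> M = {a + b * s | a b. a \<in> \<rat> \<and> b \<in> \<rat>})"

definition Gal :: "qbar set \<Rightarrow> qbar set \<Rightarrow> (qbar \<Rightarrow> qbar) monoid" where
  "Gal L F = (BijGroup L)\<lparr>carrier := {\<sigma> \<in> Bij L.
      (\<forall>x\<in>L. \<forall>y\<in>L. \<sigma> (x + y) = \<sigma> x + \<sigma> y \<and> \<sigma> (x * y) = \<sigma> x * \<sigma> y) \<and> (\<forall>x\<in>F. \<sigma> x = x)}\<rparr>"

definition galois_extension :: "qbar set \<Rightarrow> qbar set \<Rightarrow> bool" where
  "galois_extension F L \<longleftrightarrow>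
     finite_extension F L \<and> {x \<in> L. \<forall>\<sigma>\<in>carrier (Gal L F). \<sigma> x = x} = F"

definition absGal :: "qbar set \<Rightarrow> (qbar \<Rightarrow> qbar) set" where
  "absGal F = carrier (Gal UNIV F)"

text \<open>An arbitrary extension of an automorphism of \<open>L\<close> to an automorphism of the algebraic closure.
  It is only used to conjugate objects that are defined over \<open>L\<close>, for which the choice is
  irrelevant.\<close>

definition gal_lift :: "qbar set \<Rightarrow> (qbar \<Rightarrow> qbar) \<Rightarrow> (qbar \<Rightarrow> qbar)" where
  "gal_lift L \<sigma> = (SOME \<tau>. \<tau> \<in> absGal \<rat> \<and> (\<forall>x\<in>L. \<tau> x = \<sigma> x))"


section \<open>Projective varieties\<close>

text \<open>
  Varieties are treated classically: a projective variety over a field \<open>F\<close> of algebraic numbers is an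
  irreducible Zariski closed set of \<open>Qbar\<close>-points in a product of projective spaces
  \<open>P^(n_1) x ... x P^(n_k)\<close> that is cut out by multihomogeneous polynomials with
  coefficients in \<open>F\<close>. By the Segre embedding these are the usual projective varieties
  (geometrically integral, as the base field is perfect); allowing several factors makes the product
  of two varieties the concatenation of lists. Base change to a larger field does not change the
  set of \<open>Qbar\<close>-points, so \<open>A_L\<close> and \<open>A\<close> are the same object, and only the field of definition of
  the morphisms varies.

  A point of \<open>P^n\<close> is a line of \<open>Qbar^(n+1)\<close> with the origin removed, and vectors of \<open>Qbar^(n+1)\<close>
  are sequences that vanish beyond \<open>n\<close>.
\<close>

type_synonym point = "(nat \<Rightarrow> qbar) set list"

definition line :: "(nat \<Rightarrow> qbar) \<Rightarrow> (nat \<Rightarrow> qbar) set" where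
  "line v = {(\<lambda>j. c * v j) | c. c \<noteq> 0}"

definition proj_space :: "nat \<Rightarrow> (nat \<Rightarrow> qbar) set set" where
  "proj_space n = {line v | v. v \<noteq> (\<lambda>_. 0) \<and> (\<forall>j>n. v j = 0)}"

definition multiproj_space :: "nat list \<Rightarrow> point set" where
  "multiproj_space ns =
     {x. length x = length ns \<and> (\<forall>i<length ns. x ! i \<in> proj_space (ns ! i))}"

text \<open>Homogeneous coordinates: \<open>v i j\<close> is the \<open>j\<close>-th coordinate of the \<open>i\<close>-th component.\<close>

definition reps :: "point \<Rightarrow> (nat \<Rightarrow> nat \<Rightarrow> qbar) set" where
  "reps x = {v. \<forall>i<length x. v i \<in> x ! i}"

text \<open>\<open>multiform F k d\<close>: the polynomial functions with coefficients in \<open>F\<close> in the coordinates of the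
  components \<open>0, ..., k - 1\<close> that are homogeneous of degree \<open>d i\<close> in those of the
  \<open>i\<close>-th component.\<close>

inductive multiform :: "qbar set \<Rightarrow> nat \<Rightarrow> (nat \<Rightarrow> nat) \<Rightarrow> ((nat \<Rightarrow> nat \<Rightarrow> qbar) \<Rightarrow> qbar) \<Rightarrow> bool"
  for F k where
  const: "c \<in> F \<Longrightarrow> multiform F k (\<lambda>_. 0) (\<lambda>v. c)"
| coord: "i < k \<Longrightarrow> multiform F k (\<lambda>i'. if i' = i then 1 else 0) (\<lambda>v. v i j)"
| add: "multiform F k d p \<Longrightarrow> multiform F k d q \<Longrightarrow> multiform F k d (\<lambda>v. p v + q v)"
| mult: "multiform F k d p \<Longrightarrow> multiform F k e q \<Longrightarrow>
           multiform F k (\<lambda>i. d i + e i) (\<lambda>v. p v * q v)"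

definition zariski_closed :: "qbar set \<Rightarrow> point set \<Rightarrow> bool" where
  "zariski_closed F U \<longleftrightarrow> (\<exists>ns S. (\<forall>p\<in>S. \<exists>d. multiform F (length ns) d p) \<and>
     U = {x \<in> multiproj_space ns. \<forall>p\<in>S. \<forall>v\<in>reps x. p v = 0})"

definition irreducible_set :: "point set \<Rightarrow> bool" where
  "irreducible_set U \<longleftrightarrow> U \<noteq> {} \<and> (\<forall>Y Z. zariski_closed UNIV Y \<and> zariski_closed UNIV Z \<and>
     U \<subseteq> Y \<union> Z \<longrightarrow> U \<subseteq> Y \<or> U \<subseteq> Z)"

definition projective_variety :: "qbar set \<Rightarrow> point set \<Rightarrow> bool" where
  "projective_variety F U \<longleftrightarrow> zariski_closed F U \<and> irreducible_set U"

definition has_chain :: "point set \<Rightarrow> nat \<Rightarrow> bool" where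
  "has_chain U d \<longleftrightarrow> (\<exists>Z :: nat \<Rightarrow> point set.
     (\<forall>i\<le>d. zariski_closed UNIV (Z i) \<and> irreducible_set (Z i) \<and> Z i \<subseteq> U) \<and>
     (\<forall>i<d. Z i \<subset> Z (Suc i)))"

definition has_dimension :: "point set \<Rightarrow> nat \<Rightarrow> bool" where
  "has_dimension U d \<longleftrightarrow> has_chain U d \<and> (\<forall>e>d. \<not> has_chain U e)"

definition variety_prod :: "point set \<Rightarrow> point set \<Rightarrow> point set" where
  "variety_prod U Y = {x @ y | x y. x \<in> U \<and> y \<in> Y}"

text \<open>Morphisms defined over \<open>F\<close>: around every point each component is given by forms of the same
  multidegree with coefficients in \<open>F\<close>.\<close>

definition regular :: "qbar set \<Rightarrow> point set \<Rightarrow> point set \<Rightarrow> (point \<Rightarrow> point) \<Rightarrow> bool" where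
  "regular F U Y f \<longleftrightarrow> f \<in> U \<rightarrow> Y \<and>
     (\<forall>x\<in>U. \<forall>l<length (f x). \<exists>d p. (\<forall>j. multiform F (length x) d (p j)) \<and>
        (\<exists>v\<in>reps x. (\<lambda>j. p j v) \<noteq> (\<lambda>_. 0)) \<and>
        (\<forall>y\<in>U. \<forall>v\<in>reps y. (\<lambda>j. p j v) \<noteq> (\<lambda>_. 0) \<longrightarrow> f y ! l = line (\<lambda>j. p j v)))"

definition rational_point :: "qbar set \<Rightarrow> point \<Rightarrow> bool" where
  "rational_point F x \<longleftrightarrow> (\<exists>v\<in>reps x. \<forall>i<length x. \<forall>j. v i j \<in> F)"


section \<open>Abelian varieties\<close>

text \<open>The group law is a map on the product variety, whose points \<open>x @ y\<close> are split again
  with \<open>take\<close> and \<open>drop\<close> at the number of projective factors. Commutativity, which is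
  automatic for projective group varieties, is part of the definition.\<close>

definition abelian_variety :: "qbar set \<Rightarrow> point monoid \<Rightarrow> bool" where
  "abelian_variety F A \<longleftrightarrow>
     projective_variety F (carrier A) \<and> comm_group A \<and> rational_point F \<one>\<^bsub>A\<^esub> \<and>
     regular F (variety_prod (carrier A) (carrier A)) (carrier A)
       (\<lambda>z. take (length \<one>\<^bsub>A\<^esub>) z \<otimes>\<^bsub>A\<^esub> drop (length \<one>\<^bsub>A\<^esub>) z) \<and>
     regular F (carrier A) (carrier A) (\<lambda>x. inv\<^bsub>A\<^esub> x)"

definition elliptic_curve :: "qbar set \<Rightarrow> point monoid \<Rightarrow> bool" where
  "elliptic_curve F E \<longleftrightarrow> abelian_variety F E \<and> has_dimension (carrier E) 1"

definition abelian_surface :: "qbar set \<Rightarrow> point monoid \<Rightarrow> bool" where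
  "abelian_surface F A \<longleftrightarrow> abelian_variety F A \<and> has_dimension (carrier A) 2"

definition av_prod :: "point monoid \<Rightarrow> point monoid \<Rightarrow> point monoid" where
  "av_prod A B =
     \<lparr>carrier = variety_prod (carrier A) (carrier B),
      monoid.mult = (\<lambda>z w. (take (length \<one>\<^bsub>A\<^esub>) z \<otimes>\<^bsub>A\<^esub> take (length \<one>\<^bsub>A\<^esub>) w) @
                    (drop (length \<one>\<^bsub>A\<^esub>) z \<otimes>\<^bsub>B\<^esub> drop (length \<one>\<^bsub>A\<^esub>) w)),
      one = \<one>\<^bsub>A\<^esub> @ \<one>\<^bsub>B\<^esub>\<rparr>"

definition av_hom :: "qbar set \<Rightarrow> point monoid \<Rightarrow> point monoid \<Rightarrow> (point \<Rightarrow> point) set" where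
  "av_hom F A B = {f \<in> hom A B. regular F (carrier A) (carrier B) f}"


section \<open>The category of abelian varieties up to isogeny\<close>

text \<open>\<open>qfrac A B f n\<close> is the element \<open>f \<otimes> 1/n\<close> of the tensor product of the group of homomorphisms
  over \<open>Qbar\<close> with the rationals, as an equivalence class of fractions. (Two maps that agree on
  \<open>carrier A\<close> give the same class.) The tensor product of the group of homomorphisms defined over \<open>F\<close>
  with the rationals is the subset of the classes of fractions with a numerator defined over \<open>F\<close>.\<close>

type_synonym qmor = "((point \<Rightarrow> point) \<times> nat) set"

definition qfrac :: "point monoid \<Rightarrow> point monoid \<Rightarrow> (point \<Rightarrow> point) \<Rightarrow> nat \<Rightarrow> qmor" where
  "qfrac A B f n = {(g, m). g \<in> av_hom UNIV A B \<and> m > 0 \<and>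
     (\<exists>k>0. \<forall>x\<in>carrier A. f x [^]\<^bsub>B\<^esub> (k * m) = g x [^]\<^bsub>B\<^esub> (k * n))}"

definition qhom :: "qbar set \<Rightarrow> point monoid \<Rightarrow> point monoid \<Rightarrow> qmor set" where
  "qhom F A B = {qfrac A B f n | f n. f \<in> av_hom F A B \<and> n > 0}"

definition qid :: "point monoid \<Rightarrow> qmor" where
  "qid A = qfrac A A (\<lambda>x. x) 1"

definition qzero :: "point monoid \<Rightarrow> point monoid \<Rightarrow> qmor" where
  "qzero A B = qfrac A B (\<lambda>x. \<one>\<^bsub>B\<^esub>) 1"

definition qadd :: "point monoid \<Rightarrow> point monoid \<Rightarrow> qmor \<Rightarrow> qmor \<Rightarrow> qmor" where
  "qadd A B \<phi> \<psi> = (\<Union>(f, n)\<in>\<phi>. \<Union>(g, m)\<in>\<psi>.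
     qfrac A B (\<lambda>x. f x [^]\<^bsub>B\<^esub> m \<otimes>\<^bsub>B\<^esub> g x [^]\<^bsub>B\<^esub> n) (n * m))"

text \<open>\<open>qcomp A C \<phi> \<psi>\<close> is the composition of \<open>\<psi> : A \<rightarrow> B\<close> followed by \<open>\<phi> : B \<rightarrow> C\<close>.\<close>

definition qcomp :: "point monoid \<Rightarrow> point monoid \<Rightarrow> qmor \<Rightarrow> qmor \<Rightarrow> qmor" where
  "qcomp A C \<phi> \<psi> = (\<Union>(f, n)\<in>\<phi>. \<Union>(g, m)\<in>\<psi>. qfrac A C (f \<circ> g) (n * m))"

definition qend :: "qbar set \<Rightarrow> point monoid \<Rightarrow> qmor ring" where
  "qend F A = \<lparr>carrier = qhom F A A, monoid.mult = qcomp A A, one = qid A,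
               ring.zero = qzero A A, add = qadd A A\<rparr>"

text \<open>Isogenies are taken up to rational multiples, i.e. they are the isomorphisms of the category of
  abelian varieties up to isogeny.\<close>

definition isogeny :: "qbar set \<Rightarrow> point monoid \<Rightarrow> point monoid \<Rightarrow> qmor \<Rightarrow> bool" where
  "isogeny F A B \<phi> \<longleftrightarrow> \<phi> \<in> qhom F A B \<and>
     (\<exists>\<psi>\<in>qhom F B A. qcomp A A \<psi> \<phi> = qid A \<and> qcomp B B \<phi> \<psi> = qid B)"

definition isogenous :: "qbar set \<Rightarrow> point monoid \<Rightarrow> point monoid \<Rightarrow> bool" where
  "isogenous F A B \<longleftrightarrow> (\<exists>\<phi>. isogeny F A B \<phi>)"

definition qinv :: "point monoid \<Rightarrow> point monoid \<Rightarrow> qmor \<Rightarrow> qmor" where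
  "qinv A B \<phi> = (THE \<psi>. \<psi> \<in> qhom UNIV B A \<and> qcomp A A \<psi> \<phi> = qid A \<and> qcomp B B \<phi> \<psi> = qid B)"

definition has_CM :: "point monoid \<Rightarrow> qbar set \<Rightarrow> bool" where
  "has_CM E M \<longleftrightarrow> fld M \<simeq> qend UNIV E"


section \<open>Galois conjugation\<close>

definition gal_point :: "(qbar \<Rightarrow> qbar) \<Rightarrow> point \<Rightarrow> point" where
  "gal_point \<tau> = map (\<lambda>l. (\<lambda>v. \<tau> \<circ> v) ` l)"

definition gal_av :: "(qbar \<Rightarrow> qbar) \<Rightarrow> point monoid \<Rightarrow> point monoid" where
  "gal_av \<tau> A =
     \<lparr>carrier = gal_point \<tau> ` carrier A,
      monoid.mult = (\<lambda>x y. gal_point \<tau> (gal_point (inv_into UNIV \<tau>) x \<otimes>\<^bsub>A\<^esub> gal_point (inv_into UNIV \<tau>) y)),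
      one = gal_point \<tau> \<one>\<^bsub>A\<^esub>\<rparr>"

definition gal_qmor :: "(qbar \<Rightarrow> qbar) \<Rightarrow> qmor \<Rightarrow> qmor" where
  "gal_qmor \<tau> \<phi> = (\<lambda>(f, n). (gal_point \<tau> \<circ> f \<circ> gal_point (inv_into UNIV \<tau>), n)) ` \<phi>"

text \<open>\<open>\<mu>\<close> is an isogeny over \<open>N\<close> from the conjugate of \<open>E\<close> by \<open>\<tau>\<close> to \<open>E\<close> that is compatible with the
  endomorphisms of \<open>E\<close>.\<close>

definition compatible_isogeny ::
    "qbar set \<Rightarrow> point monoid \<Rightarrow> (qbar \<Rightarrow> qbar) \<Rightarrow> qmor \<Rightarrow> bool" where
  "compatible_isogeny N E \<tau> \<mu> \<longleftrightarrow> isogeny N (gal_av \<tau> E) E \<mu> \<and>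
     (\<forall>\<phi>\<in>qhom N E E. qcomp (gal_av \<tau> E) E \<mu> (gal_qmor \<tau> \<phi>) = qcomp (gal_av \<tau> E) E \<phi> \<mu>)"

definition ribet_curve :: "qbar set \<Rightarrow> qbar set \<Rightarrow> point monoid \<Rightarrow> bool" where
  "ribet_curve M N E \<longleftrightarrow> elliptic_curve N E \<and> (\<forall>\<tau>\<in>absGal M. \<exists>\<mu>. compatible_isogeny N E \<tau> \<mu>)"


section \<open>c-representations\<close>

definition linear_maps ::
    "('k, 'a) ring_scheme \<Rightarrow> ('k, 'v, 'b) module_scheme \<Rightarrow> ('k, 'w, 'c) module_scheme \<Rightarrow> ('v \<Rightarrow> 'w) set" where
  "linear_maps k V W = {f \<in> carrier V \<rightarrow> carrier W.
     (\<forall>u\<in>carrier V. \<forall>v\<in>carrier V. f (u \<oplus>\<^bsub>V\<^esub> v) = f u \<oplus>\<^bsub>W\<^esub> f v) \<and>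
     (\<forall>a\<in>carrier k. \<forall>v\<in>carrier V. f (a \<odot>\<^bsub>V\<^esub> v) = a \<odot>\<^bsub>W\<^esub> f v)}"

definition findim_space :: "('k, 'a) ring_scheme \<Rightarrow> ('k, 'v, 'b) module_scheme \<Rightarrow> bool" where
  "findim_space k V \<longleftrightarrow> field k \<and> module k V \<and>
     (\<exists>B. finite B \<and> B \<subseteq> carrier V \<and>
        (\<forall>v\<in>carrier V. \<exists>a\<in>B \<rightarrow> carrier k. v = (\<Oplus>\<^bsub>V\<^esub>b\<in>B. a b \<odot>\<^bsub>V\<^esub> b)))"

definition c_rep ::
    "('g, 'a) monoid_scheme \<Rightarrow> ('k, 'b) ring_scheme \<Rightarrow> ('k, 'v, 'c) module_scheme \<Rightarrow>
     ('g \<Rightarrow> 'v \<Rightarrow> 'v) \<Rightarrow> ('g \<Rightarrow> 'g \<Rightarrow> 'k) \<Rightarrow> bool" where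
  "c_rep G k V \<rho> c \<longleftrightarrow> group G \<and> finite (carrier G) \<and> findim_space k V \<and>
     (\<forall>\<sigma>\<in>carrier G. \<rho> \<sigma> \<in> linear_maps k V V \<and> bij_betw (\<rho> \<sigma>) (carrier V) (carrier V)) \<and>
     (\<forall>v\<in>carrier V. \<rho> \<one>\<^bsub>G\<^esub> v = v) \<and>
     (\<forall>\<sigma>\<in>carrier G. \<forall>\<tau>\<in>carrier G. c \<sigma> \<tau> \<in> carrier k - {\<zero>\<^bsub>k\<^esub>} \<and>
        (\<forall>v\<in>carrier V. \<rho> \<sigma> (\<rho> \<tau> v) = c \<sigma> \<tau> \<odot>\<^bsub>V\<^esub> \<rho> (\<sigma> \<otimes>\<^bsub>G\<^esub> \<tau>) v))"

definition c_rep_hom ::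
    "('g, 'a) monoid_scheme \<Rightarrow> ('k, 'b) ring_scheme \<Rightarrow>
     ('k, 'v, 'c) module_scheme \<Rightarrow> ('g \<Rightarrow> 'v \<Rightarrow> 'v) \<Rightarrow>
     ('k, 'w, 'd) module_scheme \<Rightarrow> ('g \<Rightarrow> 'w \<Rightarrow> 'w) \<Rightarrow> ('v \<Rightarrow> 'w) \<Rightarrow> bool" where
  "c_rep_hom G k V \<rho>\<^sub>V W \<rho>\<^sub>W f \<longleftrightarrow> f \<in> linear_maps k V W \<and>
     (\<forall>\<sigma>\<in>carrier G. \<forall>v\<in>carrier V. f v = \<rho>\<^sub>W \<sigma> (f (inv_into (carrier V) (\<rho>\<^sub>V \<sigma>) v)))"

definition c_rep_iso ::
    "('g, 'a) monoid_scheme \<Rightarrow> ('k, 'b) ring_scheme \<Rightarrow>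
     ('k, 'v, 'c) module_scheme \<Rightarrow> ('g \<Rightarrow> 'v \<Rightarrow> 'v) \<Rightarrow>
     ('k, 'w, 'd) module_scheme \<Rightarrow> ('g \<Rightarrow> 'w \<Rightarrow> 'w) \<Rightarrow> ('v \<Rightarrow> 'w) \<Rightarrow> bool" where
  "c_rep_iso G k V \<rho>\<^sub>V W \<rho>\<^sub>W f \<longleftrightarrow>
     c_rep_hom G k V \<rho>\<^sub>V W \<rho>\<^sub>W f \<and> bij_betw f (carrier V) (carrier W)"

definition hom_module ::
    "('k, 'a) ring_scheme \<Rightarrow> ('k, 'v, 'b) module_scheme \<Rightarrow> ('k, 'w, 'c) module_scheme \<Rightarrow> ('k, 'v \<Rightarrow> 'w) module" where
  "hom_module k V W =
     \<lparr>carrier = linear_maps k V W \<inter> extensional (carrier V),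
      monoid.mult = undefined, one = undefined,
      ring.zero = (\<lambda>v\<in>carrier V. \<zero>\<^bsub>W\<^esub>),
      add = (\<lambda>f g. \<lambda>v\<in>carrier V. f v \<oplus>\<^bsub>W\<^esub> g v),
      module.smult = (\<lambda>a f. \<lambda>v\<in>carrier V. a \<odot>\<^bsub>W\<^esub> f v)\<rparr>"

definition end_rep ::
    "('k, 'v, 'b) module_scheme \<Rightarrow> ('g \<Rightarrow> 'v \<Rightarrow> 'v) \<Rightarrow> 'g \<Rightarrow> ('v \<Rightarrow> 'v) \<Rightarrow> ('v \<Rightarrow> 'v)" where
  "end_rep V \<rho> \<sigma> g = (\<lambda>v\<in>carrier V. \<rho> \<sigma> (g (inv_into (carrier V) (\<rho> \<sigma>) v)))"


section \<open>Modules over the group algebra\<close>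

text \<open>The locale \<open>module\<close> of the library requires a commutative ring of scalars.\<close>

definition left_module :: "('r, 'a) ring_scheme \<Rightarrow> ('r, 'v, 'b) module_scheme \<Rightarrow> bool" where
  "left_module S V \<longleftrightarrow> ring S \<and> abelian_group V \<and>
     (\<forall>a\<in>carrier S. \<forall>v\<in>carrier V. a \<odot>\<^bsub>V\<^esub> v \<in> carrier V) \<and>
     (\<forall>a\<in>carrier S. \<forall>b\<in>carrier S. \<forall>v\<in>carrier V.
        (a \<oplus>\<^bsub>S\<^esub> b) \<odot>\<^bsub>V\<^esub> v = a \<odot>\<^bsub>V\<^esub> v \<oplus>\<^bsub>V\<^esub> b \<odot>\<^bsub>V\<^esub> v \<and>
        (a \<otimes>\<^bsub>S\<^esub> b) \<odot>\<^bsub>V\<^esub> v = a \<odot>\<^bsub>V\<^esub> (b \<odot>\<^bsub>V\<^esub> v)) \<and>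
     (\<forall>a\<in>carrier S. \<forall>u\<in>carrier V. \<forall>v\<in>carrier V.
        a \<odot>\<^bsub>V\<^esub> (u \<oplus>\<^bsub>V\<^esub> v) = a \<odot>\<^bsub>V\<^esub> u \<oplus>\<^bsub>V\<^esub> a \<odot>\<^bsub>V\<^esub> v) \<and>
     (\<forall>v\<in>carrier V. \<one>\<^bsub>S\<^esub> \<odot>\<^bsub>V\<^esub> v = v)"

definition left_module_iso ::
    "('r, 'a) ring_scheme \<Rightarrow> ('r, 'v, 'b) module_scheme \<Rightarrow> ('r, 'w, 'c) module_scheme \<Rightarrow> ('v \<Rightarrow> 'w) \<Rightarrow> bool" where
  "left_module_iso S V W f \<longleftrightarrow> left_module S V \<and> left_module S W \<and>
     f \<in> linear_maps S V W \<and> bij_betw f (carrier V) (carrier W)"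

definition group_algebra ::
    "('k, 'a) ring_scheme \<Rightarrow> ('g, 'b) monoid_scheme \<Rightarrow> ('g \<Rightarrow> 'k) ring" where
  "group_algebra k G =
     \<lparr>carrier = carrier G \<rightarrow>\<^sub>E carrier k,
      monoid.mult = (\<lambda>a b. \<lambda>\<sigma>\<in>carrier G. \<Oplus>\<^bsub>k\<^esub>\<tau>\<in>carrier G. a \<tau> \<otimes>\<^bsub>k\<^esub> b (inv\<^bsub>G\<^esub> \<tau> \<otimes>\<^bsub>G\<^esub> \<sigma>)),
      one = (\<lambda>\<sigma>\<in>carrier G. if \<sigma> = \<one>\<^bsub>G\<^esub> then \<one>\<^bsub>k\<^esub> else \<zero>\<^bsub>k\<^esub>),
      ring.zero = (\<lambda>\<sigma>\<in>carrier G. \<zero>\<^bsub>k\<^esub>),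
      add = (\<lambda>a b. \<lambda>\<sigma>\<in>carrier G. a \<sigma> \<oplus>\<^bsub>k\<^esub> b \<sigma>)\<rparr>"

definition rep_module ::
    "('g, 'a) monoid_scheme \<Rightarrow> ('k, 'v, 'b) module_scheme \<Rightarrow> ('g \<Rightarrow> 'v \<Rightarrow> 'v) \<Rightarrow> ('g \<Rightarrow> 'k, 'v) module" where
  "rep_module G V \<rho> =
     \<lparr>carrier = carrier V, monoid.mult = monoid.mult V, one = one V, ring.zero = ring.zero V, add = ring.add V,
      module.smult = (\<lambda>a v. \<Oplus>\<^bsub>V\<^esub>\<sigma>\<in>carrier G. a \<sigma> \<odot>\<^bsub>V\<^esub> \<rho> \<sigma> v)\<rparr>"


section \<open>The representations attached to \<open>E\<^sup>*\<close> and \<open>A\<close>\<close>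

text \<open>In this section \<open>\<iota>\<close> is the identification of \<open>M\<close> with the endomorphism algebra of the Ribet
  curve \<open>Es\<close>, and \<open>j\<close> the one of \<open>M\<close> with the center of the endomorphism algebra of \<open>A\<close>.\<close>

definition V_module ::
    "qbar set \<Rightarrow> point monoid \<Rightarrow> point monoid \<Rightarrow> (qbar \<Rightarrow> qmor) \<Rightarrow> (qbar, qmor) module" where
  "V_module L Es A \<iota> =
     \<lparr>carrier = qhom L Es A, monoid.mult = undefined, one = undefined,
      ring.zero = qzero Es A, add = qadd Es A, module.smult = (\<lambda>m f. qcomp Es A f (\<iota> m))\<rparr>"

definition V_rep ::
    "qbar set \<Rightarrow> point monoid \<Rightarrow> point monoid \<Rightarrow> ((qbar \<Rightarrow> qbar) \<Rightarrow> qmor) \<Rightarrow>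
     (qbar \<Rightarrow> qbar) \<Rightarrow> qmor \<Rightarrow> qmor" where
  "V_rep L Es A \<mu> \<sigma> f =
     qcomp Es A (gal_qmor (gal_lift L \<sigma>) f) (qinv (gal_av (gal_lift L \<sigma>) Es) Es (\<mu> \<sigma>))"

definition c_curve ::
    "qbar set \<Rightarrow> qbar set \<Rightarrow> point monoid \<Rightarrow> (qbar \<Rightarrow> qmor) \<Rightarrow> ((qbar \<Rightarrow> qbar) \<Rightarrow> qmor) \<Rightarrow>
     (qbar \<Rightarrow> qbar) \<Rightarrow> (qbar \<Rightarrow> qbar) \<Rightarrow> qbar" where
  "c_curve L M Es \<iota> \<mu> \<sigma> \<tau> =
     inv_into M \<iota>
       (qcomp Es Es (\<mu> (\<sigma> \<otimes>\<^bsub>Gal L M\<^esub> \<tau>))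
         (qcomp Es (gal_av (gal_lift L \<sigma>) (gal_av (gal_lift L \<tau>) Es))
           (gal_qmor (gal_lift L \<sigma>) (qinv (gal_av (gal_lift L \<tau>) Es) Es (\<mu> \<tau>)))
           (qinv (gal_av (gal_lift L \<sigma>) Es) Es (\<mu> \<sigma>))))"

definition qend_center :: "qbar set \<Rightarrow> point monoid \<Rightarrow> qmor ring" where
  "qend_center K A = (qend K A)\<lparr>carrier :=
     {z \<in> qhom K A A. \<forall>\<psi>\<in>qhom K A A. qcomp A A z \<psi> = qcomp A A \<psi> z}\<rparr>"

definition R_module :: "qbar set \<Rightarrow> point monoid \<Rightarrow> (qbar \<Rightarrow> qmor) \<Rightarrow> (qbar, qmor) module" where
  "R_module K A j =
     \<lparr>carrier = qhom K A A, monoid.mult = qcomp A A, one = qid A,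
      ring.zero = qzero A A, add = qadd A A, module.smult = (\<lambda>m \<psi>. qcomp A A (j m) \<psi>)\<rparr>"

definition R_rep :: "qbar set \<Rightarrow> (qbar \<Rightarrow> qbar) \<Rightarrow> qmor \<Rightarrow> qmor" where
  "R_rep L \<sigma> \<psi> = gal_qmor (gal_lift L \<sigma>) \<psi>"

definition Phi :: "qbar set \<Rightarrow> point monoid \<Rightarrow> point monoid \<Rightarrow> qmor \<Rightarrow> (qmor \<Rightarrow> qmor)" where
  "Phi L Es A \<psi> = (\<lambda>f\<in>qhom L Es A. qcomp Es A \<psi> f)"

end

(* Over L both A ~ E^2 and Es ~ E, so there are i1, i2 : Es -> A and p1, p2 : A -> Es with
   i1 p1 + i2 p2 = 1. Since Es has CM by M and its endomorphisms by M are already defined over N, all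
   its endomorphisms are given by M. Hence f = i1 (p1 f) + i2 (p2 f) is an M-linear combination of i1
   and i2 for every f in V. This makes Phi injective, as psi = (psi i1) p1 + (psi i2) p2, and
   surjective, as an M-linear endomorphism g of V is composition with (g i1) p1 + (g i2) p2.
   Equivariance is functoriality of Galois conjugation; M-linearity of the conjugation on R follows
   from that on V by the injectivity of Phi. *)

theory Submission
  imports Defs
begin


section \<open>Multihomogeneous forms and regular maps\<close>

text \<open>An element of \<open>Gal L M\<close> can act on points and morphisms only through an
  automorphism of all algebraic numbers that extends it. Such extensions come from Zorn's lemma, and
  the chosen lifts are not multiplicative: the lift of a product agrees with the product of the
  lifts on \<open>L\<close> only. So the argument rests on the fact that automorphisms agreeing on
  \<open>L\<close> conjugate everything defined over \<open>L\<close> alike; this yields the cocycle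
  \<open>c_curve\<close> on V and the trivial cocycle on R.

  CM is stated for E over the algebraic closure, while \<open>\<iota>\<close> describes the
  endomorphisms of \<open>Es\<close> over N. Comparing the two through an isogeny gives a ring
  endomorphism of M. It is onto because M is generated over the rationals by a square root, which
  can only go to plus or minus itself; hence \<open>\<iota>\<close> misses no endomorphism of
  \<open>Es\<close>.

  The representation on T is not verified directly: linearity, finite dimension and the trivial
  cocycle are carried over from R along the bijection \<open>Phi\<close>.\<close>

lemma multiform_mono:
  "multiform F k d p \<Longrightarrow> F \<subseteq> F' \<Longrightarrow> k \<le> k' \<Longrightarrow> multiform F' k' d p"
  by (induction rule: multiform.induct) (auto intro: multiform.intros)

text \<open>Multihomogeneity: whether a form vanishes at a point does not depend on the chosen
  homogeneous coordinates, as rescaling these multiplies its value by a monomial in the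
  scalars.\<close>

lemma multiform_scale:
  assumes "multiform F k d p"
  shows "p (\<lambda>i j. c i * v i j) = (\<Prod>i<k. c i ^ d i) * p v"
  using assms
proof induction
  case (coord i j)
  have "(\<Prod>i'<k. c i' ^ (if i' = i then 1 else 0)) = (\<Prod>i'<k. if i' = i then c i' else 1)"
    by (intro prod.cong) auto
  with coord show ?case by (simp add: prod.delta)
qed (simp_all add: algebra_simps power_add prod.distrib)

text \<open>Members of \<open>reps\<close> are arbitrary beyond the last component of a point. Only
  after these coordinates are ignored do two representatives differ by a rescaling.\<close>

lemma multiform_local:
  assumes "multiform F k d p" "\<And>i j. i < k \<Longrightarrow> v i j = w i j"
  shows "p v = p w"
  using assms by induction auto

text \<open>All coordinates of the \<open>l\<close>-th component are replaced by forms of one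
  multidegree \<open>e l\<close>, as regular maps provide them. Each factor taken from that
  component then contributes \<open>e l\<close>, whence the sum.\<close>

lemma multiform_compose:
  assumes "multiform F k d q" "\<And>l j. l < k \<Longrightarrow> multiform F k' (e l) (p l j)"
  shows "multiform F k' (\<lambda>i. \<Sum>l<k. d l * e l i) (\<lambda>v. q (\<lambda>l j. p l j v))"
  using assms
proof induction
  case (coord i j)
  have "(\<lambda>i'. \<Sum>l<k. (if l = i then 1 else 0) * e l i') = e i"
  proof
    fix i'
    have "(\<Sum>l<k. (if l = i then 1 else 0) * e l i') = (\<Sum>l<k. if l = i then e l i' else 0)"
      by (intro sum.cong) auto
    with coord show "(\<Sum>l<k. (if l = i then 1 else 0) * e l i') = e i i'"
      by (simp add: sum.delta)
  qed
  with coord show ?case by simp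
next
  case (mult d p' e' q)
  then have "multiform F k' (\<lambda>i. (\<Sum>l<k. d l * e l i) + (\<Sum>l<k. e' l * e l i))
     (\<lambda>v. p' (\<lambda>l j. p l j v) * q (\<lambda>l j. p l j v))"
    by (intro multiform.mult) auto
  then show ?case by (simp add: algebra_simps sum.distrib)
qed (auto intro: multiform.intros)

text \<open>Serves the composition of regular maps, where forms are multiplied by one nonvanishing
  coordinate from each component.\<close>

lemma multiform_mult_prod:
  fixes n :: nat
  assumes "multiform F k d q"
  shows "(\<And>l. l < n \<Longrightarrow> multiform F k (e l) (p l)) \<Longrightarrow>
    multiform F k (\<lambda>i. d i + (\<Sum>l<n. e l i)) (\<lambda>v. q v * (\<Prod>l<n. p l v))"
proof (induction n)
  case (Suc n)
  then have "multiform F k (\<lambda>i. d i + (\<Sum>l<n. e l i)) (\<lambda>v. q v * (\<Prod>l<n. p l v))" by simp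
  from multiform.mult[OF this Suc.prems[of n]] show ?case by (simp add: algebra_simps)
qed (use assms in simp)

section \<open>Points and their homogeneous coordinates\<close>

lemma mem_line [simp]: "v \<in> line v"
  unfolding line_def by (auto intro!: exI[of _ 1])

lemma line_scale:
  assumes "c \<noteq> 0"
  shows "line (\<lambda>j. c * v j) = line v"
proof -
  have "\<exists>c'. (\<lambda>j. d * (c * v j)) = (\<lambda>j. c' * v j) \<and> c' \<noteq> 0" if "d \<noteq> 0" for d
    using that assms by (intro exI[of _ "d * c"]) (auto simp: algebra_simps)
  moreover have "\<exists>c'. (\<lambda>j. d * v j) = (\<lambda>j. c' * (c * v j)) \<and> c' \<noteq> 0" if "d \<noteq> 0" for d
    using that assms by (intro exI[of _ "d / c"]) auto
  ultimately show ?thesis unfolding line_def by blast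
qed

lemma line_eqI:
  assumes "w \<in> line v"
  shows "line w = line v"
proof -
  obtain c where "w = (\<lambda>j. c * v j)" "c \<noteq> 0" using assms by (auto simp: line_def)
  then show ?thesis using line_scale[of c v] by simp
qed

lemma multiproj_space_length: "x \<in> multiproj_space ns \<Longrightarrow> length x = length ns"
  by (simp add: multiproj_space_def)

lemma reps_line:
  assumes "x \<in> multiproj_space ns" "v \<in> reps x" "i < length x"
  shows "x ! i = line (v i)" "v i \<noteq> (\<lambda>_. 0)"
proof -
  from assms obtain u where u: "x ! i = line u" "u \<noteq> (\<lambda>_. 0)"
    by (auto simp: multiproj_space_def proj_space_def)
  moreover have v: "v i \<in> line u" using assms u by (auto simp: reps_def)
  ultimately show "x ! i = line (v i)" by (simp add: line_eqI)
  from v obtain c where c: "v i = (\<lambda>j. c * u j)" "c \<noteq> 0" by (auto simp: line_def)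
  with u(2) show "v i \<noteq> (\<lambda>_. 0)" by (auto simp: fun_eq_iff)
qed

lemma reps_nonempty:
  assumes "x \<in> multiproj_space ns"
  obtains v where "v \<in> reps x"
proof -
  have "\<exists>v. i < length x \<longrightarrow> v \<in> x ! i" for i
  proof (cases "i < length x")
    case True
    then have "x ! i \<in> proj_space (ns ! i)" using assms by (simp add: multiproj_space_def)
    then obtain v where "x ! i = line v" by (auto simp: proj_space_def)
    then show ?thesis by (intro exI[of _ v]) simp
  qed simp
  then obtain v where "\<forall>i. i < length x \<longrightarrow> v i \<in> x ! i" by metis
  with that show ?thesis by (auto simp: reps_def)
qed

lemma reps_scale:
  assumes "x \<in> multiproj_space ns" "v \<in> reps x" "w \<in> reps x"
  obtains c where "\<And>i. c i \<noteq> 0" "\<And>i j. i < length x \<Longrightarrow> w i j = c i * v i j"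
proof -
  have "\<exists>c. c \<noteq> 0 \<and> (i < length x \<longrightarrow> (\<forall>j. w i j = c * v i j))" for i
  proof (cases "i < length x")
    case True
    then have "w i \<in> line (v i)"
      using assms reps_line(1)[OF assms(1,2) True] by (auto simp: reps_def)
    then show ?thesis by (auto simp: line_def)
  qed (auto intro!: exI[of _ 1])
  then have "\<exists>c. \<forall>i. c i \<noteq> 0 \<and> (i < length x \<longrightarrow> (\<forall>j. w i j = c i * v i j))" by metis
  then show thesis using that by auto
qed

text \<open>\<open>regular\<close> asks for nonvanishing at one representative; by scaling it then
  holds at all of them.\<close>

lemma multiform_reps:
  assumes "x \<in> multiproj_space ns" "v \<in> reps x" "w \<in> reps x"
    and "\<And>j. multiform F (length x) d (p j)" "(\<lambda>j. p j v) \<noteq> (\<lambda>_. 0)"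
  shows "(\<lambda>j. p j w) \<noteq> (\<lambda>_. 0)"
proof -
  obtain c where c: "\<And>i. c i \<noteq> 0" "\<And>i j. i < length x \<Longrightarrow> w i j = c i * v i j"
    using reps_scale[OF assms(1-3)] by blast
  have "p j w = (\<Prod>i<length x. c i ^ d i) * p j v" for j
    using multiform_local[OF assms(4), of w "\<lambda>i j. c i * v i j"] multiform_scale[OF assms(4)] c(2)
    by metis
  moreover have "(\<Prod>i<length x. c i ^ d i) \<noteq> 0" using c(1) by simp
  ultimately show ?thesis using assms(5) by (auto simp: fun_eq_iff)
qed

section \<open>Regular maps\<close>

lemma regular_funcset: "regular F U Y f \<Longrightarrow> f \<in> U \<rightarrow> Y"
  by (simp add: regular_def)

lemma regularE:
  assumes "regular F U Y f" "U \<subseteq> multiproj_space ns" "x \<in> U" "l < length (f x)"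
  obtains d p where "\<And>j. multiform F (length ns) d (p j)"
    and "\<And>v. v \<in> reps x \<Longrightarrow> (\<lambda>j. p j v) \<noteq> (\<lambda>_. 0)"
    and "\<And>y v. y \<in> U \<Longrightarrow> v \<in> reps y \<Longrightarrow> (\<lambda>j. p j v) \<noteq> (\<lambda>_. 0) \<Longrightarrow> f y ! l = line (\<lambda>j. p j v)"
proof -
  have x: "x \<in> multiproj_space ns" using assms by auto
  obtain d p v0 where *: "\<And>j. multiform F (length x) d (p j)" "v0 \<in> reps x" "(\<lambda>j. p j v0) \<noteq> (\<lambda>_. 0)"
      "\<And>y v. y \<in> U \<Longrightarrow> v \<in> reps y \<Longrightarrow> (\<lambda>j. p j v) \<noteq> (\<lambda>_. 0) \<Longrightarrow> f y ! l = line (\<lambda>j. p j v)"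
    using assms unfolding regular_def by metis
  show thesis
  proof (rule that[of d p])
    show "multiform F (length ns) d (p j)" for j
      using *(1) multiproj_space_length[OF x] by simp
    show "(\<lambda>j. p j v) \<noteq> (\<lambda>_. 0)" if "v \<in> reps x" for v
      using multiform_reps[OF x *(2) that *(1,3)] by simp
  qed (fact *(4))
qed

text \<open>The local condition in \<open>regular\<close> for a single component \<open>h\<close> of
  the map, so that constructions such as concatenation can be checked component by
  component.\<close>

definition forms_near ::
    "qbar set \<Rightarrow> nat \<Rightarrow> point set \<Rightarrow> point \<Rightarrow> (point \<Rightarrow> (nat \<Rightarrow> qbar) set) \<Rightarrow> bool" where
  "forms_near F k U x h \<longleftrightarrow> (\<exists>d p. (\<forall>j. multiform F k d (p j)) \<and>
     (\<exists>v\<in>reps x. (\<lambda>j. p j v) \<noteq> (\<lambda>_. 0)) \<and>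
     (\<forall>y\<in>U. \<forall>v\<in>reps y. (\<lambda>j. p j v) \<noteq> (\<lambda>_. 0) \<longrightarrow> h y = line (\<lambda>j. p j v)))"

lemma forms_nearI:
  assumes "\<And>j. multiform F k d (p j)" "v \<in> reps x" "(\<lambda>j. p j v) \<noteq> (\<lambda>_. 0)"
    and "\<And>y v. y \<in> U \<Longrightarrow> v \<in> reps y \<Longrightarrow> (\<lambda>j. p j v) \<noteq> (\<lambda>_. 0) \<Longrightarrow> h y = line (\<lambda>j. p j v)"
  shows "forms_near F k U x h"
  unfolding forms_near_def
  by (rule exI[of _ d], rule exI[of _ p]) (intro conjI allI ballI impI bexI[of _ v] assms)

lemma regularI:
  assumes "f \<in> U \<rightarrow> Y" "U \<subseteq> multiproj_space ns"
    and "\<And>x l. x \<in> U \<Longrightarrow> l < length (f x) \<Longrightarrow> forms_near F (length ns) U x (\<lambda>y. f y ! l)"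
  shows "regular F U Y f"
  unfolding regular_def
proof (intro conjI ballI allI impI)
  fix x l assume x: "x \<in> U" "l < length (f x)"
  then have "length x = length ns" using assms(2) multiproj_space_length by blast
  with assms(3)[OF x] show "\<exists>d p. (\<forall>j. multiform F (length x) d (p j)) \<and>
        (\<exists>v\<in>reps x. (\<lambda>j. p j v) \<noteq> (\<lambda>_. 0)) \<and>
        (\<forall>y\<in>U. \<forall>v\<in>reps y. (\<lambda>j. p j v) \<noteq> (\<lambda>_. 0) \<longrightarrow> f y ! l = line (\<lambda>j. p j v))"
    by (simp add: forms_near_def)
qed (fact assms(1))

lemma regular_cong:
  assumes "\<And>x. x \<in> U \<Longrightarrow> f x = g x"
  shows "regular F U Y f \<longleftrightarrow> regular F U Y g"
proof -
  have "f \<in> U \<rightarrow> Y \<longleftrightarrow> g \<in> U \<rightarrow> Y" using assms by (auto simp: Pi_iff)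
  with assms show ?thesis unfolding regular_def by simp
qed

lemma regular_mono:
  assumes "regular F U Y f" "F \<subseteq> F'"
  shows "regular F' U Y f"
  unfolding regular_def
proof (intro conjI ballI allI impI)
  fix x l assume "x \<in> U" "l < length (f x)"
  then obtain d p where p: "\<forall>j. multiform F (length x) d (p j)"
    and "(\<exists>v\<in>reps x. (\<lambda>j. p j v) \<noteq> (\<lambda>_. 0)) \<and>
        (\<forall>y\<in>U. \<forall>v\<in>reps y. (\<lambda>j. p j v) \<noteq> (\<lambda>_. 0) \<longrightarrow> f y ! l = line (\<lambda>j. p j v))"
    using assms(1) unfolding regular_def by blast
  moreover have "\<forall>j. multiform F' (length x) d (p j)"
    using p multiform_mono[OF _ assms(2) order_refl] by blast
  ultimately show "\<exists>d p. (\<forall>j. multiform F' (length x) d (p j)) \<and>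
        (\<exists>v\<in>reps x. (\<lambda>j. p j v) \<noteq> (\<lambda>_. 0)) \<and>
        (\<forall>y\<in>U. \<forall>v\<in>reps y. (\<lambda>j. p j v) \<noteq> (\<lambda>_. 0) \<longrightarrow> f y ! l = line (\<lambda>j. p j v))"
    by blast
qed (rule regular_funcset[OF assms(1)])

text \<open>The local forms are the coordinates of the selected component, which never vanish
  simultaneously. The identity and both projections of a product are of this shape.\<close>

lemma regular_select:
  assumes "f \<in> U \<rightarrow> Y" "U \<subseteq> multiproj_space ns"
    and "\<And>x l. x \<in> U \<Longrightarrow> l < length (f x) \<Longrightarrow> \<pi> l < length ns \<and> f x ! l = x ! \<pi> l"
    and "\<And>x y. x \<in> U \<Longrightarrow> y \<in> U \<Longrightarrow> length (f x) = length (f y)"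
  shows "regular F U Y f"
proof (rule regularI[OF assms(1,2)])
  fix x l assume x: "x \<in> U" "l < length (f x)"
  then have xm: "x \<in> multiproj_space ns" using assms(2) by auto
  obtain v where v: "v \<in> reps x" using reps_nonempty[OF xm] .
  have \<pi>: "\<pi> l < length ns" using assms(3)[OF x] by simp
  show "forms_near F (length ns) U x (\<lambda>y. f y ! l)"
  proof (rule forms_nearI[where p = "\<lambda>j v. v (\<pi> l) j"])
    show "multiform F (length ns) (\<lambda>i. if i = \<pi> l then 1 else 0) (\<lambda>v. v (\<pi> l) j)" for j
      using \<pi> by (rule multiform.coord)
    show "(\<lambda>j. v (\<pi> l) j) \<noteq> (\<lambda>_. 0)"
      using reps_line(2)[OF xm v] \<pi> multiproj_space_length[OF xm] by simp
    show "f y ! l = line (\<lambda>j. w (\<pi> l) j)" if "y \<in> U" "w \<in> reps y" for y w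
    proof -
      have ym: "y \<in> multiproj_space ns" using that assms(2) by auto
      have "f y ! l = y ! \<pi> l" using assms(3)[OF that(1), of l] assms(4)[OF x(1) that(1)] x(2) by simp
      also have "\<dots> = line (w (\<pi> l))"
        using reps_line(1)[OF ym that(2)] \<pi> multiproj_space_length[OF ym] by simp
      finally show ?thesis by simp
    qed
  qed (fact v)
qed

text \<open>Rationality of the point over \<open>F\<close> supplies constant forms with coefficients
  in \<open>F\<close>.\<close>

lemma regular_const:
  assumes "rational_point F a" "a \<in> Y" "U \<subseteq> multiproj_space ns" "Y \<subseteq> multiproj_space ms"
  shows "regular F U Y (\<lambda>_. a)"
proof (rule regularI[OF _ assms(3)])
  fix x l assume x: "x \<in> U" "l < length a"
  obtain w where w: "w \<in> reps a" "\<And>i j. i < length a \<Longrightarrow> w i j \<in> F"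
    using assms(1) by (auto simp: rational_point_def)
  obtain v where v: "v \<in> reps x" using x assms(3) reps_nonempty by blast
  have am: "a \<in> multiproj_space ms" using assms by auto
  have "multiform F (length ns) (\<lambda>_. 0) (\<lambda>_. w l j)" for j
    using w(2) x(2) by (intro multiform.const) auto
  show "forms_near F (length ns) U x (\<lambda>_. a ! l)"
  proof (rule forms_nearI[where p = "\<lambda>j v. w l j"])
    show "multiform F (length ns) (\<lambda>_. 0) (\<lambda>_. w l j)" for j by fact
    show "(\<lambda>j. w l j) \<noteq> (\<lambda>_. 0)" "a ! l = line (\<lambda>j. w l j)"
      using reps_line[OF am w(1) x(2)] by auto
  qed (fact v)
qed (use assms(2) in auto)

lemma regular_append:
  assumes "regular F U Y f" "regular F U Z g" "U \<subseteq> multiproj_space ns" "Y \<subseteq> multiproj_space ms"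
  shows "regular F U (variety_prod Y Z) (\<lambda>x. f x @ g x)"
proof (rule regularI[OF _ assms(3)])
  have f: "f \<in> U \<rightarrow> Y" and g: "g \<in> U \<rightarrow> Z" using assms by (simp_all add: regular_funcset)
  then show "(\<lambda>x. f x @ g x) \<in> U \<rightarrow> variety_prod Y Z" by (auto simp: variety_prod_def)
  have len: "length (f x) = length ms" if "x \<in> U" for x
    using f that assms(4) multiproj_space_length by blast
  fix x l assume x: "x \<in> U" "l < length (f x @ g x)"
  obtain v where v: "v \<in> reps x" using x assms(3) reps_nonempty by blast
  show "forms_near F (length ns) U x (\<lambda>y. (f y @ g y) ! l)"
  proof (cases "l < length (f x)")
    case True
    obtain d p where *: "\<And>j. multiform F (length ns) d (p j)"
      "\<And>v. v \<in> reps x \<Longrightarrow> (\<lambda>j. p j v) \<noteq> (\<lambda>_. 0)"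
      "\<And>y v. y \<in> U \<Longrightarrow> v \<in> reps y \<Longrightarrow> (\<lambda>j. p j v) \<noteq> (\<lambda>_. 0) \<Longrightarrow> f y ! l = line (\<lambda>j. p j v)"
      using regularE[OF assms(1,3) x(1) True] by metis
    have "(f y @ g y) ! l = f y ! l" if "y \<in> U" for y
      using True len[OF that] len[OF x(1)] by (simp add: nth_append)
    with *(3) have "(f y @ g y) ! l = line (\<lambda>j. p j w)"
      if "y \<in> U" "w \<in> reps y" "(\<lambda>j. p j w) \<noteq> (\<lambda>_. 0)" for y w
      using that by simp
    then show ?thesis by (rule forms_nearI[OF *(1) v *(2)[OF v]])
  next
    case False
    define l' where "l' = l - length (f x)"
    have l': "l' < length (g x)" "l = length (f x) + l'" using False x(2) by (auto simp: l'_def)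
    obtain d p where *: "\<And>j. multiform F (length ns) d (p j)"
      "\<And>v. v \<in> reps x \<Longrightarrow> (\<lambda>j. p j v) \<noteq> (\<lambda>_. 0)"
      "\<And>y v. y \<in> U \<Longrightarrow> v \<in> reps y \<Longrightarrow> (\<lambda>j. p j v) \<noteq> (\<lambda>_. 0) \<Longrightarrow> g y ! l' = line (\<lambda>j. p j v)"
      using regularE[OF assms(2,3) x(1) l'(1)] by metis
    have "(f y @ g y) ! l = g y ! l'" if "y \<in> U" for y
      using l' len[OF that] len[OF x(1)] by (simp add: nth_append)
    with *(3) have "(f y @ g y) ! l = line (\<lambda>j. p j w)"
      if "y \<in> U" "w \<in> reps y" "(\<lambda>j. p j w) \<noteq> (\<lambda>_. 0)" for y w
      using that by simp
    then show ?thesis by (rule forms_nearI[OF *(1) v *(2)[OF v]])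
  qed
qed

text \<open>Forms \<open>q\<close> for \<open>g\<close> with the forms \<open>p\<close> for
  \<open>f\<close> substituted need not describe \<open>g \<circ> f\<close> where all
  \<open>p l j\<close> of some component vanish, since these are then no coordinates of the image
  point. A factor \<open>p l (t l)\<close> for each component, chosen nonzero at the base point,
  forces the product to vanish at such points.\<close>

lemma regular_comp:
  assumes f: "regular F U Y f" and g: "regular F Y Z g"
    and U: "U \<subseteq> multiproj_space ns" and Y: "Y \<subseteq> multiproj_space ms"
  shows "regular F U Z (g \<circ> f)"
proof (rule regularI[OF _ U])
  have fY: "f \<in> U \<rightarrow> Y" and gZ: "g \<in> Y \<rightarrow> Z" using f g by (simp_all add: regular_funcset)
  then show "g \<circ> f \<in> U \<rightarrow> Z" by auto
  fix x m assume x: "x \<in> U" and m: "m < length ((g \<circ> f) x)"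
  define k where "k = length ms"
  have fx: "f x \<in> Y" using fY x by auto
  have len: "length (f y) = k" if "y \<in> U" for y
    using fY that Y multiproj_space_length unfolding k_def by blast
  obtain dq q where q: "\<And>j. multiform F k dq (q j)"
      "\<And>v. v \<in> reps (f x) \<Longrightarrow> (\<lambda>j. q j v) \<noteq> (\<lambda>_. 0)"
      "\<And>y v. y \<in> Y \<Longrightarrow> v \<in> reps y \<Longrightarrow> (\<lambda>j. q j v) \<noteq> (\<lambda>_. 0) \<Longrightarrow> g y ! m = line (\<lambda>j. q j v)"
    using regularE[OF g Y fx] m unfolding k_def comp_apply by metis
  \<comment> \<open>Degree and forms are bundled in one predicate so that they can be chosen for all
    components at once.\<close>
  define G where "G l d p \<longleftrightarrow> (\<forall>j. multiform F (length ns) d (p j)) \<and>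
      (\<forall>v\<in>reps x. (\<lambda>j. p j v) \<noteq> (\<lambda>_. 0)) \<and>
      (\<forall>y\<in>U. \<forall>v\<in>reps y. (\<lambda>j. p j v) \<noteq> (\<lambda>_. 0) \<longrightarrow> f y ! l = line (\<lambda>j. p j v))" for l d p
  have "\<exists>d p. l < k \<longrightarrow> G l d p" for l
  proof (cases "l < k")
    case True
    then have l: "l < length (f x)" using len[OF x] by simp
    show ?thesis using regularE[OF f U x l] unfolding G_def by metis
  qed auto
  then have "\<forall>l. \<exists>d p. l < k \<longrightarrow> G l d p" ..
  from choice[OF this] obtain e where "\<forall>l. \<exists>p. l < k \<longrightarrow> G l (e l) p" ..
  from choice[OF this] obtain p where "\<forall>l. l < k \<longrightarrow> G l (e l) (p l)" ..
  then have p: "\<And>l j. l < k \<Longrightarrow> multiform F (length ns) (e l) (p l j)"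
      "\<And>l v. l < k \<Longrightarrow> v \<in> reps x \<Longrightarrow> (\<lambda>j. p l j v) \<noteq> (\<lambda>_. 0)"
      "\<And>l y v. l < k \<Longrightarrow> y \<in> U \<Longrightarrow> v \<in> reps y \<Longrightarrow> (\<lambda>j. p l j v) \<noteq> (\<lambda>_. 0) \<Longrightarrow>
         f y ! l = line (\<lambda>j. p l j v)"
    by (simp_all add: G_def)
  obtain v where v: "v \<in> reps x" using x U reps_nonempty by blast
  have "\<forall>l. \<exists>j. l < k \<longrightarrow> p l j v \<noteq> 0" using p(2)[OF _ v] by (auto simp: fun_eq_iff)
  then obtain t where t: "\<And>l. l < k \<Longrightarrow> p l (t l) v \<noteq> 0" by metis
  define P where "P = (\<lambda>j v. q j (\<lambda>l j. p l j v) * (\<Prod>l<k. p l (t l) v))"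
  have "multiform F (length ns) (\<lambda>i. (\<Sum>l<k. dq l * e l i) + (\<Sum>l<k. e l i)) (P j)" for j
    unfolding P_def using p(1) by (intro multiform_mult_prod multiform_compose[OF q(1)]) auto
  moreover have "(\<lambda>j. P j v) \<noteq> (\<lambda>_. 0)"
  proof -
    have "(\<lambda>l j. p l j v) \<in> reps (f x)"
      using p(3)[OF _ x v p(2)[OF _ v]] by (auto simp: reps_def len[OF x])
    then have "(\<lambda>j. q j (\<lambda>l j. p l j v)) \<noteq> (\<lambda>_. 0)" by (rule q(2))
    moreover have "(\<Prod>l<k. p l (t l) v) \<noteq> 0" using t by simp
    ultimately show ?thesis by (auto simp: P_def fun_eq_iff)
  qed
  moreover have "(g \<circ> f) y ! m = line (\<lambda>j. P j w)"
    if y: "y \<in> U" and w: "w \<in> reps y" and nz: "(\<lambda>j. P j w) \<noteq> (\<lambda>_. 0)" for y w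
  proof -
    have nz': "(\<lambda>j. q j (\<lambda>l j. p l j w)) \<noteq> (\<lambda>_. 0)" "(\<Prod>l<k. p l (t l) w) \<noteq> 0"
      using nz by (auto simp: P_def fun_eq_iff)
    have "(\<lambda>j. p l j w) \<noteq> (\<lambda>_. 0)" if "l < k" for l
    proof
      assume "(\<lambda>j. p l j w) = (\<lambda>_. 0)"
      then have "p l (t l) w = 0" by meson
      with nz'(2) that show False by auto
    qed
    then have "(\<lambda>l j. p l j w) \<in> reps (f y)"
      using p(3)[OF _ y w] by (auto simp: reps_def len[OF y])
    then have "g (f y) ! m = line (\<lambda>j. q j (\<lambda>l j. p l j w))"
      using q(3)[OF _ _ nz'(1)] fY y by auto
    \<comment> \<open>The additional factor is a nonzero scalar, so it does not change the
      line.\<close>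
    also have "\<dots> = line (\<lambda>j. P j w)"
      using line_scale[OF nz'(2), of "\<lambda>j. q j (\<lambda>l j. p l j w)"] by (simp add: P_def mult.commute)
    finally show ?thesis by simp
  qed
  ultimately show "forms_near F (length ns) U x (\<lambda>y. (g \<circ> f) y ! m)"
    by (rule forms_nearI[where p = P and v = v, OF _ v])
qed


lemma variety_prod_multiproj:
  assumes "U \<subseteq> multiproj_space ns" "Y \<subseteq> multiproj_space ms"
  shows "variety_prod U Y \<subseteq> multiproj_space (ns @ ms)"
proof
  fix z assume "z \<in> variety_prod U Y"
  then obtain x y where z: "z = x @ y" "x \<in> multiproj_space ns" "y \<in> multiproj_space ms"
    using assms by (auto simp: variety_prod_def)
  then show "z \<in> multiproj_space (ns @ ms)"
    by (auto simp: multiproj_space_def nth_append)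
qed


section \<open>Homomorphisms up to isogeny\<close>

text \<open>What composition and addition of fractions rest on. It passes visibly to conjugates and
  products, for which closedness and irreducibility would require arguments of their own.\<close>

definition projective_group :: "point monoid \<Rightarrow> bool" where
  "projective_group A \<longleftrightarrow> comm_group A \<and> (\<exists>ns. carrier A \<subseteq> multiproj_space ns)"

text \<open>For such a target the trivial homomorphism, products and inverses of homomorphisms over
  \<open>F\<close> are again defined over \<open>F\<close>.\<close>

definition group_variety :: "qbar set \<Rightarrow> point monoid \<Rightarrow> bool" where
  "group_variety F A \<longleftrightarrow> projective_group A \<and> rational_point F \<one>\<^bsub>A\<^esub> \<and>
     regular F (variety_prod (carrier A) (carrier A)) (carrier A)
       (\<lambda>z. take (length \<one>\<^bsub>A\<^esub>) z \<otimes>\<^bsub>A\<^esub> drop (length \<one>\<^bsub>A\<^esub>) z) \<and>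
     regular F (carrier A) (carrier A) (\<lambda>x. inv\<^bsub>A\<^esub> x)"

lemma projective_groupD [dest, simp]: "projective_group A \<Longrightarrow> comm_group A"
  by (simp add: projective_group_def)

lemma projective_groupE:
  assumes "projective_group A"
  obtains ns where "carrier A \<subseteq> multiproj_space ns"
  using assms by (auto simp: projective_group_def)

text \<open>All points lie in one product of projective spaces. This is why \<open>take\<close> and
  \<open>drop\<close> at the length of the neutral element split a concatenated point.\<close>

lemma projective_group_length:
  assumes "projective_group A" "x \<in> carrier A"
  shows "length x = length \<one>\<^bsub>A\<^esub>"
proof -
  interpret comm_group A using assms(1) by auto
  obtain ns where "carrier A \<subseteq> multiproj_space ns" using assms(1) by (rule projective_groupE)
  with assms(2) one_closed show ?thesis using multiproj_space_length by (metis subsetD)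
qed

lemma abelian_variety_group_variety:
  assumes "abelian_variety F A"
  shows "group_variety F A"
proof -
  obtain ns where "carrier A \<subseteq> multiproj_space ns"
    using assms by (auto simp: abelian_variety_def projective_variety_def zariski_closed_def)
  with assms show ?thesis by (auto simp: abelian_variety_def group_variety_def projective_group_def)
qed

lemma group_variety_projective [dest, simp]: "group_variety F A \<Longrightarrow> projective_group A"
  by (simp add: group_variety_def)

lemma rational_point_mono: "rational_point F x \<Longrightarrow> F \<subseteq> F' \<Longrightarrow> rational_point F' x"
  unfolding rational_point_def by blast

lemma group_variety_mono: "group_variety F A \<Longrightarrow> F \<subseteq> F' \<Longrightarrow> group_variety F' A"
  unfolding group_variety_def using regular_mono rational_point_mono by blast

lemma av_homD:
  assumes "f \<in> av_hom F A B"
  shows "f \<in> hom A B" "regular F (carrier A) (carrier B) f" "x \<in> carrier A \<Longrightarrow> f x \<in> carrier B"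
    "x \<in> carrier A \<Longrightarrow> y \<in> carrier A \<Longrightarrow> f (x \<otimes>\<^bsub>A\<^esub> y) = f x \<otimes>\<^bsub>B\<^esub> f y"
  using assms by (auto simp: av_hom_def hom_def)

lemma av_hom_nat_pow:
  assumes "f \<in> av_hom F A B" "projective_group A" "projective_group B" "x \<in> carrier A"
  shows "f (x [^]\<^bsub>A\<^esub> (n::nat)) = f x [^]\<^bsub>B\<^esub> n"
proof -
  interpret A: comm_group A using assms by auto
  interpret B: comm_group B using assms by auto
  show ?thesis using hom_nat_pow[OF av_homD(1)[OF assms(1)] assms(4)] A.group_axioms B.group_axioms by simp
qed

lemma av_homI: "f \<in> hom A B \<Longrightarrow> regular F (carrier A) (carrier B) f \<Longrightarrow> f \<in> av_hom F A B"
  by (simp add: av_hom_def)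

lemma av_hom_mono: "F \<subseteq> F' \<Longrightarrow> av_hom F A B \<subseteq> av_hom F' A B"
  using regular_mono by (auto simp: av_hom_def)

lemma av_hom_UNIV: "f \<in> av_hom F A B \<Longrightarrow> f \<in> av_hom UNIV A B"
  using av_hom_mono[of F UNIV] by auto

lemma av_hom_id:
  assumes "projective_group A"
  shows "(\<lambda>x. x) \<in> av_hom F A A"
proof (rule av_homI)
  obtain ns where ns: "carrier A \<subseteq> multiproj_space ns" using assms by (rule projective_groupE)
  show "regular F (carrier A) (carrier A) (\<lambda>x. x)"
  proof (rule regular_select[OF _ ns, where \<pi> = "\<lambda>l. l"])
    show "length x = length y" if "x \<in> carrier A" "y \<in> carrier A" for x y
      using that projective_group_length[OF assms] by simp
    show "l < length ns \<and> x ! l = x ! l" if "x \<in> carrier A" "l < length x" for x l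
      using that ns multiproj_space_length by fastforce
  qed simp
qed (simp add: hom_def)

lemma av_hom_comp:
  assumes "f \<in> av_hom F A B" "g \<in> av_hom F B C" "projective_group A" "projective_group B"
  shows "g \<circ> f \<in> av_hom F A C"
proof (rule av_homI)
  obtain ns where ns: "carrier A \<subseteq> multiproj_space ns" using assms(3) by (rule projective_groupE)
  obtain ms where ms: "carrier B \<subseteq> multiproj_space ms" using assms(4) by (rule projective_groupE)
  show "regular F (carrier A) (carrier C) (g \<circ> f)"
    by (rule regular_comp[OF av_homD(2)[OF assms(1)] av_homD(2)[OF assms(2)] ns ms])
  show "g \<circ> f \<in> hom A C" using av_homD(1)[OF assms(1)] av_homD(1)[OF assms(2)] hom_compose by blast
qed

lemma av_hom_one:
  assumes "projective_group A" "group_variety F B"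
  shows "(\<lambda>x. \<one>\<^bsub>B\<^esub>) \<in> av_hom F A B"
proof (rule av_homI)
  interpret B: comm_group B using assms by auto
  obtain ns where ns: "carrier A \<subseteq> multiproj_space ns" using assms(1) by (rule projective_groupE)
  obtain ms where ms: "carrier B \<subseteq> multiproj_space ms"
    using assms(2) projective_groupE[of B] by auto
  show "regular F (carrier A) (carrier B) (\<lambda>x. \<one>\<^bsub>B\<^esub>)"
    using assms(2) by (intro regular_const[OF _ B.one_closed ns ms]) (simp add: group_variety_def)
  show "(\<lambda>x. \<one>\<^bsub>B\<^esub>) \<in> hom A B" by (auto simp: hom_def)
qed

text \<open>The sum is the group law after the pairing of \<open>f\<close> and \<open>g\<close>,
  hence regular; commutativity of B makes it a homomorphism.\<close>

lemma av_hom_mult: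
  assumes f: "f \<in> av_hom F A B" and g: "g \<in> av_hom F A B"
    and A: "projective_group A" and B: "group_variety F B"
  shows "(\<lambda>x. f x \<otimes>\<^bsub>B\<^esub> g x) \<in> av_hom F A B"
proof (rule av_homI)
  interpret B: comm_group B using B by auto
  show "(\<lambda>x. f x \<otimes>\<^bsub>B\<^esub> g x) \<in> hom A B"
    using av_homD(3,4)[OF f] av_homD(3,4)[OF g] by (auto simp: hom_def B.m_ac)
  obtain ns where ns: "carrier A \<subseteq> multiproj_space ns" using A by (rule projective_groupE)
  obtain ms where ms: "carrier B \<subseteq> multiproj_space ms" using B projective_groupE[of B] by auto
  note ms2 = variety_prod_multiproj[OF ms ms]
  let ?m = "\<lambda>z. take (length \<one>\<^bsub>B\<^esub>) z \<otimes>\<^bsub>B\<^esub> drop (length \<one>\<^bsub>B\<^esub>) z"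
  have "regular F (carrier A) (carrier B) (?m \<circ> (\<lambda>x. f x @ g x))"
    using B by (intro regular_comp[OF regular_append[OF av_homD(2)[OF f] av_homD(2)[OF g] ns ms] _ ns ms2])
      (simp add: group_variety_def)
  moreover have "regular F (carrier A) (carrier B) (?m \<circ> (\<lambda>x. f x @ g x)) \<longleftrightarrow>
      regular F (carrier A) (carrier B) (\<lambda>x. f x \<otimes>\<^bsub>B\<^esub> g x)"
  proof (rule regular_cong)
    show "(?m \<circ> (\<lambda>x. f x @ g x)) x = f x \<otimes>\<^bsub>B\<^esub> g x" if "x \<in> carrier A" for x
      using projective_group_length[of B "f x"] av_homD(3)[OF f that] B by simp
  qed
  ultimately show "regular F (carrier A) (carrier B) (\<lambda>x. f x \<otimes>\<^bsub>B\<^esub> g x)" by (simp only:)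
qed

lemma av_hom_pow:
  assumes "f \<in> av_hom F A B" "projective_group A" "group_variety F B"
  shows "(\<lambda>x. f x [^]\<^bsub>B\<^esub> (n::nat)) \<in> av_hom F A B"
proof (induction n)
  case 0
  then show ?case using av_hom_one[OF assms(2,3)] by simp
next
  case (Suc n)
  interpret B: comm_group B using assms by auto
  show ?case using av_hom_mult[OF Suc assms] by simp
qed

lemma av_hom_inv:
  assumes "f \<in> av_hom F A B" "projective_group A" "group_variety F B"
  shows "(\<lambda>x. inv\<^bsub>B\<^esub> (f x)) \<in> av_hom F A B"
proof (rule av_homI)
  interpret B: comm_group B using assms by auto
  obtain ns where ns: "carrier A \<subseteq> multiproj_space ns" using assms(2) by (rule projective_groupE)
  obtain ms where ms: "carrier B \<subseteq> multiproj_space ms"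
    using assms(3) projective_groupE[of B] by auto
  show "(\<lambda>x. inv\<^bsub>B\<^esub> (f x)) \<in> hom A B"
    using av_homD(3,4)[OF assms(1)] by (auto simp: hom_def B.inv_mult)
  have "regular F (carrier A) (carrier B) ((\<lambda>x. inv\<^bsub>B\<^esub> x) \<circ> f)"
    using assms(3) by (intro regular_comp[OF av_homD(2)[OF assms(1)] _ ns ms])
      (simp add: group_variety_def)
  then show "regular F (carrier A) (carrier B) (\<lambda>x. inv\<^bsub>B\<^esub> (f x))" by (simp add: comp_def)
qed

section \<open>Fractions of homomorphisms and their independence of representatives\<close>

lemma mem_qfrac:
  "(g, m) \<in> qfrac A B f n \<longleftrightarrow> g \<in> av_hom UNIV A B \<and> m > 0 \<and>
     (\<exists>k>0. \<forall>x\<in>carrier A. f x [^]\<^bsub>B\<^esub> (k * m) = g x [^]\<^bsub>B\<^esub> (k * n))"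
  by (simp add: qfrac_def)

lemma qfrac_self: "f \<in> av_hom UNIV A B \<Longrightarrow> n > 0 \<Longrightarrow> (f, n) \<in> qfrac A B f n"
  by (auto simp: mem_qfrac)

text \<open>Transitivity of equality of fractions. The exponent \<open>k\<close> allows for torsion,
  so equalities cannot be divided; instead the two exponents are multiplied, together with the
  denominator \<open>m\<close> in the middle.\<close>

lemma qfrac_eqI:
  assumes "comm_group B" "f \<in> carrier A \<rightarrow> carrier B" "g \<in> carrier A \<rightarrow> carrier B" "n > 0" "m > 0" "k > 0"
    and eq: "\<And>x. x \<in> carrier A \<Longrightarrow> f x [^]\<^bsub>B\<^esub> (k * m) = g x [^]\<^bsub>B\<^esub> (k * n)"
  shows "qfrac A B f n = qfrac A B g m"
proof -
  interpret B: comm_group B by fact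
  have *: "(h, l) \<in> qfrac A B f n"
    if "(h, l) \<in> qfrac A B g m" "f \<in> carrier A \<rightarrow> carrier B" "g \<in> carrier A \<rightarrow> carrier B" "m > 0"
      "\<And>x. x \<in> carrier A \<Longrightarrow> f x [^]\<^bsub>B\<^esub> (k * m) = g x [^]\<^bsub>B\<^esub> (k * n)" for f g h l n m
  proof -
    from that(1) obtain k' where h: "h \<in> av_hom UNIV A B" "l > 0" "k' > 0"
      "\<And>x. x \<in> carrier A \<Longrightarrow> g x [^]\<^bsub>B\<^esub> (k' * l) = h x [^]\<^bsub>B\<^esub> (k' * m)"
      by (auto simp: mem_qfrac)
    have "f x [^]\<^bsub>B\<^esub> ((k * k' * m) * l) = h x [^]\<^bsub>B\<^esub> ((k * k' * m) * n)" if x: "x \<in> carrier A" for x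
    proof -
      have cl: "f x \<in> carrier B" "g x \<in> carrier B" "h x \<in> carrier B"
        using x \<open>f \<in> _\<close> \<open>g \<in> _\<close> av_homD(3)[OF h(1)] by auto
      have "f x [^]\<^bsub>B\<^esub> ((k * k' * m) * l) = (f x [^]\<^bsub>B\<^esub> (k * m)) [^]\<^bsub>B\<^esub> (k' * l)"
        using cl by (simp add: B.nat_pow_pow ac_simps)
      also have "\<dots> = (g x [^]\<^bsub>B\<^esub> (k' * l)) [^]\<^bsub>B\<^esub> (k * n)"
        using cl \<open>\<And>x. x \<in> carrier A \<Longrightarrow> f x [^]\<^bsub>B\<^esub> (k * m) = g x [^]\<^bsub>B\<^esub> (k * n)\<close>[OF x]
        by (simp add: B.nat_pow_pow ac_simps)
      also have "\<dots> = h x [^]\<^bsub>B\<^esub> ((k * k' * m) * n)"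
        using cl h(4)[OF x] by (simp add: B.nat_pow_pow ac_simps)
      finally show ?thesis .
    qed
    with h(1,2,3) \<open>k > 0\<close> \<open>m > 0\<close> show ?thesis
      unfolding mem_qfrac by (intro conjI exI[of _ "k * k' * m"]) simp_all
  qed
  show ?thesis
    using *[OF _ assms(2,3,5) eq] *[OF _ assms(3,2,4) eq[symmetric]] by auto
qed

lemma qfrac_cong:
  assumes "\<And>x. x \<in> carrier A \<Longrightarrow> f x = g x"
  shows "qfrac A B f n = qfrac A B g n"
  unfolding qfrac_def using assms by auto

text \<open>\<open>qcomp\<close> and \<open>qadd\<close> are unions over all representatives; they
  are operations on classes because every choice yields the same class.\<close>

lemma UN_UN_const:
  assumes "\<phi> \<noteq> {}" "\<psi> \<noteq> {}" "\<And>f n g m. (f, n) \<in> \<phi> \<Longrightarrow> (g, m) \<in> \<psi> \<Longrightarrow> H f n g m = c"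
  shows "(\<Union>(f, n)\<in>\<phi>. \<Union>(g, m)\<in>\<psi>. H f n g m) = c"
  using assms by auto blast

text \<open>Representatives are changed on both sides. As \<open>f\<close> is a homomorphism, the
  power that relates \<open>g\<close> to \<open>g'\<close> can be moved inside its argument.\<close>

lemma qcomp_qfrac:
  assumes f: "f \<in> av_hom UNIV B C" and g: "g \<in> av_hom UNIV A B" and n: "n > 0" "m > 0"
    and pg: "projective_group A" "projective_group B" "projective_group C"
  shows "qcomp A C (qfrac B C f n) (qfrac A B g m) = qfrac A C (f \<circ> g) (n * m)"
  unfolding qcomp_def
proof (rule UN_UN_const)
  interpret B: comm_group B using pg by auto
  interpret C: comm_group C using pg by auto
  show "qfrac B C f n \<noteq> {}" "qfrac A B g m \<noteq> {}"
    using qfrac_self[OF f n(1)] qfrac_self[OF g n(2)] by auto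
  fix f' n' g' m' assume "(f', n') \<in> qfrac B C f n" "(g', m') \<in> qfrac A B g m"
  then obtain k k' where f': "f' \<in> av_hom UNIV B C" "n' > 0" "k > 0"
      "\<And>x. x \<in> carrier B \<Longrightarrow> f x [^]\<^bsub>C\<^esub> (k * n') = f' x [^]\<^bsub>C\<^esub> (k * n)"
    and g': "g' \<in> av_hom UNIV A B" "m' > 0" "k' > 0"
      "\<And>x. x \<in> carrier A \<Longrightarrow> g x [^]\<^bsub>B\<^esub> (k' * m') = g' x [^]\<^bsub>B\<^esub> (k' * m)"
    by (auto simp: mem_qfrac)
  have "(f \<circ> g) x [^]\<^bsub>C\<^esub> ((k * k') * (n' * m')) = (f' \<circ> g') x [^]\<^bsub>C\<^esub> ((k * k') * (n * m))"
    if x: "x \<in> carrier A" for x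
  proof -
    have cl: "g x \<in> carrier B" "g' x \<in> carrier B" "f (g x) \<in> carrier C" "f (g' x) \<in> carrier C"
      "f' (g' x) \<in> carrier C"
      using x av_homD(3)[OF f] av_homD(3)[OF g] av_homD(3)[OF f'(1)] av_homD(3)[OF g'(1)] by auto
    have "f (g x) [^]\<^bsub>C\<^esub> ((k * k') * (n' * m')) = f (g x [^]\<^bsub>B\<^esub> (k' * m')) [^]\<^bsub>C\<^esub> (k * n')"
      using cl by (simp add: av_hom_nat_pow[OF f pg(2,3)] C.nat_pow_pow ac_simps)
    also have "\<dots> = (f (g' x) [^]\<^bsub>C\<^esub> (k * n')) [^]\<^bsub>C\<^esub> (k' * m)"
      using cl by (simp add: g'(4)[OF x] av_hom_nat_pow[OF f pg(2,3)] C.nat_pow_pow ac_simps)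
    also have "\<dots> = f' (g' x) [^]\<^bsub>C\<^esub> ((k * k') * (n * m))"
      using cl by (simp only: f'(4)[OF cl(2)] C.nat_pow_pow) (simp add: ac_simps)
    finally show ?thesis by simp
  qed
  then show "qfrac A C (f' \<circ> g') (n' * m') = qfrac A C (f \<circ> g) (n * m)"
    using n f'(2,3) g'(2,3) av_homD(3)[OF f] av_homD(3)[OF g] av_homD(3)[OF f'(1)] av_homD(3)[OF g'(1)]
    by (intro qfrac_eqI[symmetric, where k = "k * k'"] C.comm_group_axioms) auto
qed

text \<open>Commutativity lets the power of a product be taken factor by factor, so the two
  representatives can be changed independently.\<close>

lemma qadd_qfrac:
  assumes f: "f \<in> av_hom UNIV A B" and g: "g \<in> av_hom UNIV A B" and n: "n > 0" "m > 0"
    and B: "comm_group B"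
  shows "qadd A B (qfrac A B f n) (qfrac A B g m) =
    qfrac A B (\<lambda>x. f x [^]\<^bsub>B\<^esub> m \<otimes>\<^bsub>B\<^esub> g x [^]\<^bsub>B\<^esub> n) (n * m)"
  unfolding qadd_def
proof (rule UN_UN_const)
  interpret B: comm_group B using B by auto
  show "qfrac A B f n \<noteq> {}" "qfrac A B g m \<noteq> {}"
    using qfrac_self[OF f n(1)] qfrac_self[OF g n(2)] by auto
  fix f' n' g' m' assume "(f', n') \<in> qfrac A B f n" "(g', m') \<in> qfrac A B g m"
  then obtain k k' where f': "f' \<in> av_hom UNIV A B" "n' > 0" "k > 0"
      "\<And>x. x \<in> carrier A \<Longrightarrow> f x [^]\<^bsub>B\<^esub> (k * n') = f' x [^]\<^bsub>B\<^esub> (k * n)"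
    and g': "g' \<in> av_hom UNIV A B" "m' > 0" "k' > 0"
      "\<And>x. x \<in> carrier A \<Longrightarrow> g x [^]\<^bsub>B\<^esub> (k' * m') = g' x [^]\<^bsub>B\<^esub> (k' * m)"
    by (auto simp: mem_qfrac)
  have "(f x [^]\<^bsub>B\<^esub> m \<otimes>\<^bsub>B\<^esub> g x [^]\<^bsub>B\<^esub> n) [^]\<^bsub>B\<^esub> ((k * k') * (n' * m')) =
        (f' x [^]\<^bsub>B\<^esub> m' \<otimes>\<^bsub>B\<^esub> g' x [^]\<^bsub>B\<^esub> n') [^]\<^bsub>B\<^esub> ((k * k') * (n * m))"
    if x: "x \<in> carrier A" for x
  proof -
    have cl: "f x \<in> carrier B" "g x \<in> carrier B" "f' x \<in> carrier B" "g' x \<in> carrier B"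
      using x av_homD(3)[OF f] av_homD(3)[OF g] av_homD(3)[OF f'(1)] av_homD(3)[OF g'(1)] by auto
    have "(f x [^]\<^bsub>B\<^esub> m) [^]\<^bsub>B\<^esub> ((k * k') * (n' * m')) = (f x [^]\<^bsub>B\<^esub> (k * n')) [^]\<^bsub>B\<^esub> (k' * m * m')"
      using cl by (simp add: B.nat_pow_pow ac_simps)
    also have "\<dots> = (f' x [^]\<^bsub>B\<^esub> m') [^]\<^bsub>B\<^esub> ((k * k') * (n * m))"
      using cl by (simp only: f'(4)[OF x] B.nat_pow_pow) (simp add: ac_simps)
    finally have 1: "(f x [^]\<^bsub>B\<^esub> m) [^]\<^bsub>B\<^esub> ((k * k') * (n' * m')) = \<dots>" .
    have "(g x [^]\<^bsub>B\<^esub> n) [^]\<^bsub>B\<^esub> ((k * k') * (n' * m')) = (g x [^]\<^bsub>B\<^esub> (k' * m')) [^]\<^bsub>B\<^esub> (k * n * n')"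
      using cl by (simp add: B.nat_pow_pow ac_simps)
    also have "\<dots> = (g' x [^]\<^bsub>B\<^esub> n') [^]\<^bsub>B\<^esub> ((k * k') * (n * m))"
      using cl by (simp only: g'(4)[OF x] B.nat_pow_pow) (simp add: ac_simps)
    finally have 2: "(g x [^]\<^bsub>B\<^esub> n) [^]\<^bsub>B\<^esub> ((k * k') * (n' * m')) = \<dots>" .
    show ?thesis using cl 1 2 by (simp add: B.nat_pow_distrib)
  qed
  then show "qfrac A B (\<lambda>x. f' x [^]\<^bsub>B\<^esub> m' \<otimes>\<^bsub>B\<^esub> g' x [^]\<^bsub>B\<^esub> n') (n' * m') =
     qfrac A B (\<lambda>x. f x [^]\<^bsub>B\<^esub> m \<otimes>\<^bsub>B\<^esub> g x [^]\<^bsub>B\<^esub> n) (n * m)"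
    using n f'(2,3) g'(2,3) av_homD(3)[OF f] av_homD(3)[OF g] av_homD(3)[OF f'(1)] av_homD(3)[OF g'(1)]
    by (intro qfrac_eqI[symmetric, where k = "k * k'"] B.comm_group_axioms) auto
qed

lemma qhomI: "f \<in> av_hom F A B \<Longrightarrow> n > 0 \<Longrightarrow> qfrac A B f n \<in> qhom F A B"
  by (auto simp: qhom_def)

lemma qhomE:
  assumes "\<phi> \<in> qhom F A B"
  obtains f n where "\<phi> = qfrac A B f n" "f \<in> av_hom F A B" "f \<in> av_hom UNIV A B" "n > 0"
  using assms av_hom_UNIV by (auto simp: qhom_def)

lemma qhom_mono: "F \<subseteq> F' \<Longrightarrow> qhom F A B \<subseteq> qhom F' A B"
  using av_hom_mono[of F F' A B] by (fastforce simp: qhom_def)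

lemma qhom_UNIV: "\<phi> \<in> qhom F A B \<Longrightarrow> \<phi> \<in> qhom UNIV A B"
  using qhom_mono[of F UNIV A B] by blast

lemma qzero_closed: "projective_group A \<Longrightarrow> group_variety F B \<Longrightarrow> qzero A B \<in> qhom F A B"
  unfolding qzero_def by (intro qhomI av_hom_one) auto

section \<open>The additive category of abelian varieties up to isogeny\<close>

lemma qcomp_closed:
  assumes "\<phi> \<in> qhom F B C" "\<psi> \<in> qhom F A B" "projective_group A" "projective_group B" "projective_group C"
  shows "qcomp A C \<phi> \<psi> \<in> qhom F A C"
proof -
  obtain f n where f: "\<phi> = qfrac B C f n" "f \<in> av_hom F B C" "f \<in> av_hom UNIV B C" "n > 0"
    using assms(1) by (rule qhomE)
  obtain g m where g: "\<psi> = qfrac A B g m" "g \<in> av_hom F A B" "g \<in> av_hom UNIV A B" "m > 0"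
    using assms(2) by (rule qhomE)
  show ?thesis using f g assms(3-5) by (auto simp: qcomp_qfrac intro!: qhomI av_hom_comp)
qed

lemma qcomp_assoc:
  assumes "\<chi> \<in> qhom UNIV C D" "\<phi> \<in> qhom UNIV B C" "\<psi> \<in> qhom UNIV A B"
    and pg: "projective_group A" "projective_group B" "projective_group C" "projective_group D"
  shows "qcomp A D (qcomp B D \<chi> \<phi>) \<psi> = qcomp A D \<chi> (qcomp A C \<phi> \<psi>)"
proof -
  obtain f n where f: "\<phi> = qfrac B C f n" "f \<in> av_hom UNIV B C" "n > 0"
    using assms(2) by (rule qhomE)
  obtain g m where g: "\<psi> = qfrac A B g m" "g \<in> av_hom UNIV A B" "m > 0"
    using assms(3) by (rule qhomE)
  obtain h l where h: "\<chi> = qfrac C D h l" "h \<in> av_hom UNIV C D" "l > 0"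
    using assms(1) by (rule qhomE)
  show ?thesis using f g h pg by (simp add: qcomp_qfrac av_hom_comp comp_assoc mult.assoc)
qed

lemma qcomp_qid:
  assumes "\<phi> \<in> qhom UNIV A B" "projective_group A" "projective_group B"
  shows "qcomp A B \<phi> (qid A) = \<phi>" "qcomp A B (qid B) \<phi> = \<phi>"
proof -
  obtain f n where f: "\<phi> = qfrac A B f n" "f \<in> av_hom UNIV A B" "n > 0"
    using assms(1) by (rule qhomE)
  show "qcomp A B \<phi> (qid A) = \<phi>" "qcomp A B (qid B) \<phi> = \<phi>"
    using f assms(2,3) by (simp_all add: qid_def qcomp_qfrac av_hom_id comp_def)
qed

lemma qadd_closed:
  assumes "\<phi> \<in> qhom F A B" "\<psi> \<in> qhom F A B" "projective_group A" "group_variety F B"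
  shows "qadd A B \<phi> \<psi> \<in> qhom F A B"
proof -
  obtain f n where f: "\<phi> = qfrac A B f n" "f \<in> av_hom F A B" "f \<in> av_hom UNIV A B" "n > 0"
    using assms(1) by (rule qhomE)
  obtain g m where g: "\<psi> = qfrac A B g m" "g \<in> av_hom F A B" "g \<in> av_hom UNIV A B" "m > 0"
    using assms(2) by (rule qhomE)
  have "comm_group B" using assms(4) by auto
  with f g assms(3,4) show ?thesis by (auto simp: qadd_qfrac intro!: qhomI av_hom_mult av_hom_pow)
qed

lemma qadd_assoc:
  assumes "\<phi> \<in> qhom UNIV A B" "\<psi> \<in> qhom UNIV A B" "\<chi> \<in> qhom UNIV A B"
    and A: "projective_group A" and B: "group_variety UNIV B"
  shows "qadd A B (qadd A B \<phi> \<psi>) \<chi> = qadd A B \<phi> (qadd A B \<psi> \<chi>)"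
proof -
  interpret B: comm_group B using B by auto
  obtain f n where f: "\<phi> = qfrac A B f n" "f \<in> av_hom UNIV A B" "n > 0"
    using assms(1) by (rule qhomE)
  obtain g m where g: "\<psi> = qfrac A B g m" "g \<in> av_hom UNIV A B" "m > 0"
    using assms(2) by (rule qhomE)
  obtain h l where h: "\<chi> = qfrac A B h l" "h \<in> av_hom UNIV A B" "l > 0"
    using assms(3) by (rule qhomE)
  show ?thesis
    using f g h A B av_homD(3)[OF f(2)] av_homD(3)[OF g(2)] av_homD(3)[OF h(2)]
    by (auto simp: qadd_qfrac B.comm_group_axioms av_hom_mult av_hom_pow B.nat_pow_distrib
        B.nat_pow_pow B.m_ac ac_simps intro!: qfrac_cong)
qed

lemma qadd_commute:
  assumes "\<phi> \<in> qhom UNIV A B" "\<psi> \<in> qhom UNIV A B" and B: "comm_group B"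
  shows "qadd A B \<phi> \<psi> = qadd A B \<psi> \<phi>"
proof -
  interpret B: comm_group B by fact
  obtain f n where f: "\<phi> = qfrac A B f n" "f \<in> av_hom UNIV A B" "n > 0"
    using assms(1) by (rule qhomE)
  obtain g m where g: "\<psi> = qfrac A B g m" "g \<in> av_hom UNIV A B" "m > 0"
    using assms(2) by (rule qhomE)
  show ?thesis
    using f g av_homD(3)[OF f(2)] av_homD(3)[OF g(2)]
    by (auto simp: qadd_qfrac B.comm_group_axioms B.m_comm mult.commute intro!: qfrac_cong)
qed

lemma qadd_qzero:
  assumes "\<phi> \<in> qhom UNIV A B" and A: "projective_group A" and B: "group_variety UNIV B"
  shows "qadd A B (qzero A B) \<phi> = \<phi>"
proof -
  interpret B: comm_group B using B by auto
  obtain f n where f: "\<phi> = qfrac A B f n" "f \<in> av_hom UNIV A B" "n > 0"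
    using assms(1) by (rule qhomE)
  show ?thesis
    using f A B av_homD(3)[OF f(2)]
    by (auto simp: qzero_def qadd_qfrac B.comm_group_axioms av_hom_one intro!: qfrac_cong)
qed

lemma qadd_inverse:
  assumes "\<phi> \<in> qhom F A B" and A: "projective_group A" and B: "group_variety F B"
  shows "\<exists>\<psi>\<in>qhom F A B. qadd A B \<psi> \<phi> = qzero A B"
proof -
  interpret B: comm_group B using B by auto
  obtain f n where f: "\<phi> = qfrac A B f n" "f \<in> av_hom F A B" "f \<in> av_hom UNIV A B" "n > 0"
    using assms(1) by (rule qhomE)
  have inv: "(\<lambda>x. inv\<^bsub>B\<^esub> (f x)) \<in> av_hom F A B" using f A B by (intro av_hom_inv)
  have "qadd A B (qfrac A B (\<lambda>x. inv\<^bsub>B\<^esub> (f x)) n) \<phi> =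
    qfrac A B (\<lambda>x. inv\<^bsub>B\<^esub> (f x) [^]\<^bsub>B\<^esub> n \<otimes>\<^bsub>B\<^esub> f x [^]\<^bsub>B\<^esub> n) (n * n)"
    using f av_hom_UNIV[OF inv] by (simp add: qadd_qfrac B.comm_group_axioms)
  also have "\<dots> = qzero A B" unfolding qzero_def
    using av_homD(3)[OF f(2)] f(4)
    by (intro qfrac_eqI[where k = 1] B.comm_group_axioms) (auto simp: B.nat_pow_inv B.l_inv)
  finally show ?thesis using qhomI[OF inv f(4)] by blast
qed

text \<open>Composing before adding leaves an additional factor \<open>l\<close>, the denominator of
  \<open>\<chi>\<close>, in both exponents and in the denominator; equality of fractions removes
  it.\<close>

lemma qcomp_qadd_left:
  assumes "\<phi> \<in> qhom UNIV B C" "\<psi> \<in> qhom UNIV B C" "\<chi> \<in> qhom UNIV A B"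
    and A: "projective_group A" and B: "projective_group B" and C: "group_variety UNIV C"
  shows "qcomp A C (qadd B C \<phi> \<psi>) \<chi> = qadd A C (qcomp A C \<phi> \<chi>) (qcomp A C \<psi> \<chi>)"
proof -
  interpret C: comm_group C using C by auto
  obtain f n where f: "\<phi> = qfrac B C f n" "f \<in> av_hom UNIV B C" "n > 0"
    using assms(1) by (rule qhomE)
  obtain g m where g: "\<psi> = qfrac B C g m" "g \<in> av_hom UNIV B C" "m > 0"
    using assms(2) by (rule qhomE)
  obtain h l where h: "\<chi> = qfrac A B h l" "h \<in> av_hom UNIV A B" "l > 0"
    using assms(3) by (rule qhomE)
  note cl = av_homD(3)[OF f(2)] av_homD(3)[OF g(2)] av_homD(3)[OF h(2)]
  have pC: "projective_group C" using C by auto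
  have "qcomp A C (qadd B C \<phi> \<psi>) \<chi> =
      qfrac A C ((\<lambda>x. f x [^]\<^bsub>C\<^esub> m \<otimes>\<^bsub>C\<^esub> g x [^]\<^bsub>C\<^esub> n) \<circ> h) (n * m * l)"
    using f g h A B C pC
    by (simp add: qadd_qfrac C.comm_group_axioms qcomp_qfrac av_hom_mult av_hom_pow)
  also have "\<dots> = qfrac A C (\<lambda>x. f (h x) [^]\<^bsub>C\<^esub> (m * l) \<otimes>\<^bsub>C\<^esub> g (h x) [^]\<^bsub>C\<^esub> (n * l)) ((n * l) * (m * l))"
    using f(3) g(3) h(3) cl
    by (intro qfrac_eqI[where k = 1] C.comm_group_axioms)
       (auto simp: C.nat_pow_distrib C.nat_pow_pow ac_simps)
  also have "\<dots> = qadd A C (qcomp A C \<phi> \<chi>) (qcomp A C \<psi> \<chi>)"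
    using f g h A B C pC by (simp add: qadd_qfrac C.comm_group_axioms qcomp_qfrac av_hom_comp)
  finally show ?thesis .
qed

text \<open>Unlike distributivity for precomposition, which is pointwise, this uses that the
  numerator of \<open>\<chi>\<close> is a homomorphism.\<close>

lemma qcomp_qadd_right:
  assumes "\<phi> \<in> qhom UNIV A B" "\<psi> \<in> qhom UNIV A B" "\<chi> \<in> qhom UNIV B C"
    and A: "projective_group A" and B: "group_variety UNIV B" and C: "projective_group C"
  shows "qcomp A C \<chi> (qadd A B \<phi> \<psi>) = qadd A C (qcomp A C \<chi> \<phi>) (qcomp A C \<chi> \<psi>)"
proof -
  interpret C: comm_group C using C by auto
  interpret B: comm_group B using B by auto
  obtain f n where f: "\<phi> = qfrac A B f n" "f \<in> av_hom UNIV A B" "n > 0"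
    using assms(1) by (rule qhomE)
  obtain g m where g: "\<psi> = qfrac A B g m" "g \<in> av_hom UNIV A B" "m > 0"
    using assms(2) by (rule qhomE)
  obtain h l where h: "\<chi> = qfrac B C h l" "h \<in> av_hom UNIV B C" "l > 0"
    using assms(3) by (rule qhomE)
  note cl = av_homD(3)[OF f(2)] av_homD(3)[OF g(2)] av_homD(3)[OF h(2)]
  have pB: "projective_group B" using B by auto
  have "qcomp A C \<chi> (qadd A B \<phi> \<psi>) =
      qfrac A C (h \<circ> (\<lambda>x. f x [^]\<^bsub>B\<^esub> m \<otimes>\<^bsub>B\<^esub> g x [^]\<^bsub>B\<^esub> n)) (l * (n * m))"
    using f g h A B C pB
    by (simp add: qadd_qfrac B.comm_group_axioms qcomp_qfrac av_hom_mult av_hom_pow)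
  also have "\<dots> = qfrac A C (\<lambda>x. h (f x) [^]\<^bsub>C\<^esub> (l * m) \<otimes>\<^bsub>C\<^esub> h (g x) [^]\<^bsub>C\<^esub> (l * n)) ((l * n) * (l * m))"
    using f(3) g(3) h(3) cl
    by (intro qfrac_eqI[where k = 1] C.comm_group_axioms)
       (auto simp: C.nat_pow_distrib C.nat_pow_pow av_homD(4)[OF h(2)]
         av_hom_nat_pow[OF h(2) pB C] ac_simps)
  also have "\<dots> = qadd A C (qcomp A C \<chi> \<phi>) (qcomp A C \<chi> \<psi>)"
    using f g h A B C pB by (simp add: qadd_qfrac C.comm_group_axioms qcomp_qfrac av_hom_comp)
  finally show ?thesis .
qed


section \<open>Galois conjugation\<close>

lemma absGal_iff:
  "\<tau> \<in> absGal F \<longleftrightarrow> bij \<tau> \<and> (\<forall>x y. \<tau> (x + y) = \<tau> x + \<tau> y \<and> \<tau> (x * y) = \<tau> x * \<tau> y) \<and> (\<forall>x\<in>F. \<tau> x = x)"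
  by (auto simp: absGal_def Gal_def BijGroup_def Bij_def)

lemma absGal_mono: "\<tau> \<in> absGal F \<Longrightarrow> F' \<subseteq> F \<Longrightarrow> \<tau> \<in> absGal F'"
  by (auto simp: absGal_iff)

lemma absGalD:
  assumes "\<tau> \<in> absGal F"
  shows "bij \<tau>" "\<tau> (x + y) = \<tau> x + \<tau> y" "\<tau> (x * y) = \<tau> x * \<tau> y" "x \<in> F \<Longrightarrow> \<tau> x = x"
    and "\<tau> 0 = 0" "\<tau> x = 0 \<longleftrightarrow> x = 0" "\<tau> (inv_into UNIV \<tau> x) = x" "inv_into UNIV \<tau> (\<tau> x) = x"
proof -
  from assms show *: "bij \<tau>" "\<And>x y. \<tau> (x + y) = \<tau> x + \<tau> y" "\<tau> (x * y) = \<tau> x * \<tau> y" "x \<in> F \<Longrightarrow> \<tau> x = x"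
    by (auto simp: absGal_iff)
  from *(2)[of 0 0] show 0: "\<tau> 0 = 0" by simp
  show "\<tau> x = 0 \<longleftrightarrow> x = 0" using 0 *(1) by (metis bij_pointE)
  show "\<tau> (inv_into UNIV \<tau> x) = x" "inv_into UNIV \<tau> (\<tau> x) = x"
    using *(1) by (simp_all add: bij_is_surj surj_f_inv_f bij_is_inj)
qed

lemma absGal_inv:
  assumes "\<tau> \<in> absGal F"
  shows "inv_into UNIV \<tau> \<in> absGal F"
proof -
  note \<tau> = absGalD[OF assms]
  have "inv_into UNIV \<tau> (x + y) = inv_into UNIV \<tau> x + inv_into UNIV \<tau> y" for x y
    using \<tau>(2)[of "inv_into UNIV \<tau> x" "inv_into UNIV \<tau> y"] by (metis \<tau>(7,8))
  moreover have "inv_into UNIV \<tau> (x * y) = inv_into UNIV \<tau> x * inv_into UNIV \<tau> y" for x y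
    using \<tau>(3)[of "inv_into UNIV \<tau> x" "inv_into UNIV \<tau> y"] by (metis \<tau>(7,8))
  moreover have "inv_into UNIV \<tau> x = x" if "x \<in> F" for x
    using \<tau>(4)[OF that] by (metis \<tau>(8))
  ultimately show ?thesis using \<tau>(1) by (simp add: absGal_iff bij_imp_bij_inv)
qed

lemma absGal_comp: "\<tau> \<in> absGal F \<Longrightarrow> \<rho> \<in> absGal F \<Longrightarrow> \<tau> \<circ> \<rho> \<in> absGal F"
  by (simp add: absGal_iff bij_comp)

lemma inv_inv_absGal: "\<tau> \<in> absGal F \<Longrightarrow> inv_into UNIV (inv_into UNIV \<tau>) = \<tau>"
  by (simp add: absGal_iff inv_inv_eq)

lemma inv_comp_absGal:
  "\<tau> \<in> absGal F \<Longrightarrow> \<rho> \<in> absGal F' \<Longrightarrow> inv_into UNIV (\<tau> \<circ> \<rho>) = inv_into UNIV \<rho> \<circ> inv_into UNIV \<tau>"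
  by (rule o_inv_distrib) (auto simp: absGal_iff)

lemma gal_point_comp: "gal_point \<tau> (gal_point \<rho> x) = gal_point (\<tau> \<circ> \<rho>) x"
  by (simp add: gal_point_def image_image comp_assoc)

lemma gal_point_id [simp]: "gal_point (\<lambda>x. x) x = x" "gal_point id x = x"
  by (simp_all add: gal_point_def comp_def map_idI)

lemma gal_point_inv [simp]:
  assumes "\<tau> \<in> absGal F"
  shows "gal_point \<tau> (gal_point (inv_into UNIV \<tau>) x) = x"
    "gal_point (inv_into UNIV \<tau>) (gal_point \<tau> x) = x"
  using absGalD(7,8)[OF assms] by (simp_all add: gal_point_comp comp_def)

lemma length_gal_point [simp]: "length (gal_point \<tau> x) = length x"
  by (simp add: gal_point_def)

lemma gal_point_append: "gal_point \<tau> (x @ y) = gal_point \<tau> x @ gal_point \<tau> y"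
  by (simp add: gal_point_def)

text \<open>Scalars move through \<tau> to their images; as \<tau> is onto, every nonzero scalar is
  reached and the image is the whole line.\<close>

lemma gal_line:
  assumes "\<tau> \<in> absGal F"
  shows "(\<lambda>v. \<tau> \<circ> v) ` line u = line (\<lambda>j. \<tau> (u j))"
proof
  note \<tau> = absGalD[OF assms]
  show "(\<lambda>v. \<tau> \<circ> v) ` line u \<subseteq> line (\<lambda>j. \<tau> (u j))"
    by (force simp: line_def comp_def \<tau>(3,6))
  show "line (\<lambda>j. \<tau> (u j)) \<subseteq> (\<lambda>v. \<tau> \<circ> v) ` line u"
  proof
    fix w assume "w \<in> line (\<lambda>j. \<tau> (u j))"
    then obtain c where c: "c \<noteq> 0" "w = (\<lambda>j. c * \<tau> (u j))" by (auto simp: line_def)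
    define d where "d = inv_into UNIV \<tau> c"
    have d: "\<tau> d = c" by (simp add: d_def \<tau>(7))
    then have "d \<noteq> 0" using c(1) \<tau>(5) by auto
    then have "w = \<tau> \<circ> (\<lambda>j. d * u j)" "(\<lambda>j. d * u j) \<in> line u"
      using c(2) d by (auto simp: comp_def \<tau>(3) line_def)
    then show "w \<in> (\<lambda>v. \<tau> \<circ> v) ` line u" by blast
  qed
qed

lemma gal_point_multiproj:
  assumes "\<tau> \<in> absGal F" "x \<in> multiproj_space ns"
  shows "gal_point \<tau> x \<in> multiproj_space ns"
proof -
  have "gal_point \<tau> x ! i \<in> proj_space (ns ! i)" if i: "i < length ns" for i
  proof -
    have len: "length x = length ns" using assms(2) by (rule multiproj_space_length)
    have "x ! i \<in> proj_space (ns ! i)" using assms(2) i by (simp add: multiproj_space_def)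
    then obtain v where v: "x ! i = line v" "v \<noteq> (\<lambda>_. 0)" "\<And>j. j > ns ! i \<Longrightarrow> v j = 0"
      by (auto simp: proj_space_def)
    have "gal_point \<tau> x ! i = line (\<lambda>j. \<tau> (v j))"
      using gal_line[OF assms(1)] v(1) i len by (simp add: gal_point_def)
    moreover have "(\<lambda>j. \<tau> (v j)) \<noteq> (\<lambda>_. 0)" using v(2) by (auto simp: fun_eq_iff absGalD(6)[OF assms(1)])
    ultimately show ?thesis unfolding proj_space_def using v(3) absGalD(6)[OF assms(1)] by blast
  qed
  then show ?thesis using assms(2) by (simp add: multiproj_space_def)
qed

lemma gal_reps: "v \<in> reps x \<Longrightarrow> (\<lambda>i j. \<tau> (v i j)) \<in> reps (gal_point \<tau> x)"
  unfolding reps_def gal_point_def by (auto simp: comp_def image_iff fun_eq_iff)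

lemma gal_reps_inv:
  assumes "\<tau> \<in> absGal F" "v \<in> reps (gal_point \<tau> x)"
  shows "(\<lambda>i j. inv_into UNIV \<tau> (v i j)) \<in> reps x"
  using gal_reps[OF assms(2), of "inv_into UNIV \<tau>"] assms(1) by simp

text \<open>This is the polynomial with \<tau> applied to its coefficients, written as a function:
  undo \<tau> on the coordinates, evaluate, apply \<tau>.\<close>

lemma multiform_gal:
  assumes "\<tau> \<in> absGal G" "multiform F k d p"
  shows "multiform (\<tau> ` F) k d (\<lambda>v. \<tau> (p (\<lambda>i j. inv_into UNIV \<tau> (v i j))))"
  using assms(2)
  by induction (auto simp: absGalD(2,3,7)[OF assms(1)] intro: multiform.intros)

lemma multiform_gal_fixed:
  assumes "\<tau> \<in> absGal F" "multiform F k d p"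
  shows "p (\<lambda>i j. \<tau> (v i j)) = \<tau> (p v)"
  using assms(2)
  by induction (auto simp: absGalD(2,3,4)[OF assms(1)])

lemma gal_point_nth:
  assumes "\<tau> \<in> absGal G" "x ! l = line v" "l < length x"
  shows "gal_point \<tau> x ! l = line (\<lambda>j. \<tau> (v j))"
  using assms gal_line[OF assms(1)] by (simp add: gal_point_def)

text \<open>The conjugated local forms of \<open>f\<close> serve as local forms of the conjugate
  map: they are nonzero at the conjugate of a point exactly where the original forms are nonzero at
  the point.\<close>

lemma regular_gal:
  assumes \<tau>: "\<tau> \<in> absGal G" and f: "regular F U Y f"
    and U: "U \<subseteq> multiproj_space ns" and Y: "Y \<subseteq> multiproj_space ms"
  shows "regular (\<tau> ` F) (gal_point \<tau> ` U) (gal_point \<tau> ` Y)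
    (gal_point \<tau> \<circ> f \<circ> gal_point (inv_into UNIV \<tau>))"
proof (rule regularI)
  have fY: "f \<in> U \<rightarrow> Y" by (rule regular_funcset[OF f])
  then show "gal_point \<tau> \<circ> f \<circ> gal_point (inv_into UNIV \<tau>) \<in> gal_point \<tau> ` U \<rightarrow> gal_point \<tau> ` Y"
    using \<tau> by auto
  show "gal_point \<tau> ` U \<subseteq> multiproj_space ns" using gal_point_multiproj[OF \<tau>] U by auto
  fix x' l assume "x' \<in> gal_point \<tau> ` U"
    and "l < length ((gal_point \<tau> \<circ> f \<circ> gal_point (inv_into UNIV \<tau>)) x')"
  then obtain x where x: "x \<in> U" "x' = gal_point \<tau> x" and l: "l < length (f x)" using \<tau> by auto
  obtain d p where p: "\<And>j. multiform F (length ns) d (p j)"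
      "\<And>v. v \<in> reps x \<Longrightarrow> (\<lambda>j. p j v) \<noteq> (\<lambda>_. 0)"
      "\<And>y v. y \<in> U \<Longrightarrow> v \<in> reps y \<Longrightarrow> (\<lambda>j. p j v) \<noteq> (\<lambda>_. 0) \<Longrightarrow> f y ! l = line (\<lambda>j. p j v)"
    using regularE[OF f U x(1) l] by metis
  obtain v where v: "v \<in> reps x" using x U reps_nonempty by blast
  let ?q = "\<lambda>j v. \<tau> (p j (\<lambda>i j. inv_into UNIV \<tau> (v i j)))"
  show "forms_near (\<tau> ` F) (length ns) (gal_point \<tau> ` U) x'
    (\<lambda>y. (gal_point \<tau> \<circ> f \<circ> gal_point (inv_into UNIV \<tau>)) y ! l)"
  proof (rule forms_nearI[where p = ?q])
    show "multiform (\<tau> ` F) (length ns) d (?q j)" for j by (rule multiform_gal[OF \<tau> p(1)])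
    show "(\<lambda>i j. \<tau> (v i j)) \<in> reps x'" using gal_reps[OF v] x(2) by simp
    show "(\<lambda>j. ?q j (\<lambda>i j. \<tau> (v i j))) \<noteq> (\<lambda>_. 0)"
      using p(2)[OF v] absGalD(6,8)[OF \<tau>] by (simp add: fun_eq_iff)
    fix y' w assume y': "y' \<in> gal_point \<tau> ` U" and w: "w \<in> reps y'" and nz: "(\<lambda>j. ?q j w) \<noteq> (\<lambda>_. 0)"
    from y' obtain y where y: "y \<in> U" "y' = gal_point \<tau> y" by auto
    have nz': "(\<lambda>j. p j (\<lambda>i j. inv_into UNIV \<tau> (w i j))) \<noteq> (\<lambda>_. 0)"
      using nz absGalD(6)[OF \<tau>] by (simp add: fun_eq_iff)
    have "f y ! l = line (\<lambda>j. p j (\<lambda>i j. inv_into UNIV \<tau> (w i j)))"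
      using w y(2) by (intro p(3)[OF y(1) _ nz'] gal_reps_inv[OF \<tau>]) simp
    moreover have "l < length (f y)"
      using l fY x(1) y(1) Y multiproj_space_length by (metis PiE subsetD)
    ultimately show "(gal_point \<tau> \<circ> f \<circ> gal_point (inv_into UNIV \<tau>)) y' ! l = line (\<lambda>j. ?q j w)"
      using gal_point_nth[OF \<tau>] y(2) \<tau> by simp
  qed
qed

text \<open>The same local forms describe \<open>f\<close> at \<open>x\<close> and at its conjugate:
  their coefficients are fixed by \<tau>, so evaluating them commutes with \<tau>, and they do not
  all vanish at the conjugate either.\<close>

lemma regular_gal_fixed:
  assumes \<tau>: "\<tau> \<in> absGal F" and f: "regular F U Y f"
    and U: "U \<subseteq> multiproj_space ns" and Y: "Y \<subseteq> multiproj_space ms"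
    and x: "x \<in> U" "gal_point \<tau> x \<in> U"
  shows "f (gal_point \<tau> x) = gal_point \<tau> (f x)"
proof (rule nth_equalityI)
  have fY: "f \<in> U \<rightarrow> Y" by (rule regular_funcset[OF f])
  show len: "length (f (gal_point \<tau> x)) = length (gal_point \<tau> (f x))"
    using fY x Y multiproj_space_length by (metis PiE subsetD length_gal_point)
  fix l assume "l < length (f (gal_point \<tau> x))"
  then have l: "l < length (f x)" using len by simp
  obtain d p where p: "\<And>j. multiform F (length ns) d (p j)"
      "\<And>v. v \<in> reps x \<Longrightarrow> (\<lambda>j. p j v) \<noteq> (\<lambda>_. 0)"
      "\<And>y v. y \<in> U \<Longrightarrow> v \<in> reps y \<Longrightarrow> (\<lambda>j. p j v) \<noteq> (\<lambda>_. 0) \<Longrightarrow> f y ! l = line (\<lambda>j. p j v)"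
    using regularE[OF f U x(1) l] by metis
  obtain v where v: "v \<in> reps x" using x U reps_nonempty by blast
  have "f x ! l = line (\<lambda>j. p j v)" by (rule p(3)[OF x(1) v p(2)[OF v]])
  then have 1: "gal_point \<tau> (f x) ! l = line (\<lambda>j. \<tau> (p j v))" by (rule gal_point_nth[OF \<tau> _ l])
  have eq: "(\<lambda>j. p j (\<lambda>i j. \<tau> (v i j))) = (\<lambda>j. \<tau> (p j v))"
    using multiform_gal_fixed[OF \<tau> p(1)] by simp
  moreover have "(\<lambda>j. \<tau> (p j v)) \<noteq> (\<lambda>_. 0)"
    using p(2)[OF v] absGalD(6)[OF \<tau>] by (simp add: fun_eq_iff)
  ultimately have "f (gal_point \<tau> x) ! l = line (\<lambda>j. p j (\<lambda>i j. \<tau> (v i j)))"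
    by (intro p(3)[OF x(2) gal_reps[OF v]]) simp
  with 1 eq show "f (gal_point \<tau> x) ! l = gal_point \<tau> (f x) ! l" by simp
qed

text \<open>Equations with coefficients in \<open>F\<close> are preserved by every automorphism over
  \<open>F\<close>; the inclusion for the inverse automorphism gives equality.\<close>

lemma zariski_closed_gal:
  assumes \<tau>: "\<tau> \<in> absGal F" and U: "zariski_closed F U"
  shows "gal_point \<tau> ` U = U"
proof -
  obtain ns S where S: "\<And>p. p \<in> S \<Longrightarrow> \<exists>d. multiform F (length ns) d p"
    "U = {x \<in> multiproj_space ns. \<forall>p\<in>S. \<forall>v\<in>reps x. p v = 0}"
    using U by (auto simp: zariski_closed_def)
  have *: "gal_point \<rho> x \<in> U" if \<rho>: "\<rho> \<in> absGal F" and x: "x \<in> U" for \<rho> x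
  proof -
    have "p v = 0" if p: "p \<in> S" and v: "v \<in> reps (gal_point \<rho> x)" for p v
    proof -
      obtain d where d: "multiform F (length ns) d p" using S(1)[OF p] by blast
      have "p (\<lambda>i j. inv_into UNIV \<rho> (v i j)) = 0"
        using x p gal_reps_inv[OF \<rho> v] by (auto simp: S(2))
      then have "\<rho> (p (\<lambda>i j. inv_into UNIV \<rho> (v i j))) = 0" by (simp add: absGalD(5)[OF \<rho>])
      then show ?thesis by (simp add: multiform_gal_fixed[OF \<rho> d, symmetric] absGalD(7)[OF \<rho>])
    qed
    then show ?thesis using x gal_point_multiproj[OF \<rho>] by (simp add: S(2))
  qed
  have "x \<in> gal_point \<tau> ` U" if "x \<in> U" for x
    using *[OF absGal_inv[OF \<tau>] that] gal_point_inv(1)[OF \<tau>, of x] by (metis imageI)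
  with *[OF \<tau>] show ?thesis by blast
qed

lemma rational_point_gal:
  assumes \<tau>: "\<tau> \<in> absGal F" and x: "rational_point F x" "x \<in> multiproj_space ns"
  shows "gal_point \<tau> x = x"
proof (rule nth_equalityI)
  fix i assume "i < length (gal_point \<tau> x)"
  then have i: "i < length x" by simp
  obtain v where v: "v \<in> reps x" "\<And>i j. i < length x \<Longrightarrow> v i j \<in> F"
    using x(1) by (auto simp: rational_point_def)
  have "x ! i = line (v i)" by (rule reps_line(1)[OF x(2) v(1) i])
  then show "gal_point \<tau> x ! i = x ! i"
    using gal_point_nth[OF \<tau> _ i, of "v i"] v(2)[OF i] absGalD(4)[OF \<tau>] by simp
qed simp

section \<open>Conjugates of groups and of morphisms up to isogeny\<close>

lemma gal_av_simps:
  assumes "\<tau> \<in> absGal G"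
  shows "carrier (gal_av \<tau> A) = gal_point \<tau> ` carrier A"
    "gal_point \<tau> x \<otimes>\<^bsub>gal_av \<tau> A\<^esub> gal_point \<tau> y = gal_point \<tau> (x \<otimes>\<^bsub>A\<^esub> y)"
    "\<one>\<^bsub>gal_av \<tau> A\<^esub> = gal_point \<tau> \<one>\<^bsub>A\<^esub>"
  using assms by (simp_all add: gal_av_def)

lemma gal_av_nat_pow:
  assumes "\<tau> \<in> absGal G"
  shows "gal_point \<tau> x [^]\<^bsub>gal_av \<tau> A\<^esub> (n::nat) = gal_point \<tau> (x [^]\<^bsub>A\<^esub> n)"
  by (induction n) (simp_all add: gal_av_simps[OF assms])

lemma gal_av_projective:
  assumes \<tau>: "\<tau> \<in> absGal G" and A: "projective_group A"
  shows "projective_group (gal_av \<tau> A)"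
  unfolding projective_group_def
proof
  interpret A: comm_group A using A by auto
  show "comm_group (gal_av \<tau> A)"
  proof (rule comm_groupI)
    fix x assume "x \<in> carrier (gal_av \<tau> A)"
    then obtain x' where x': "x = gal_point \<tau> x'" "x' \<in> carrier A" by (auto simp: gal_av_simps[OF \<tau>])
    then have "gal_point \<tau> (inv\<^bsub>A\<^esub> x') \<in> carrier (gal_av \<tau> A)"
      "gal_point \<tau> (inv\<^bsub>A\<^esub> x') \<otimes>\<^bsub>gal_av \<tau> A\<^esub> x = \<one>\<^bsub>gal_av \<tau> A\<^esub>"
      by (simp_all add: gal_av_simps[OF \<tau>])
    then show "\<exists>y\<in>carrier (gal_av \<tau> A). y \<otimes>\<^bsub>gal_av \<tau> A\<^esub> x = \<one>\<^bsub>gal_av \<tau> A\<^esub>" by blast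
  qed (auto simp: gal_av_simps[OF \<tau>] A.m_ac)
  obtain ns where "carrier A \<subseteq> multiproj_space ns" using A by (rule projective_groupE)
  then show "\<exists>ns. carrier (gal_av \<tau> A) \<subseteq> multiproj_space ns"
    using gal_point_multiproj[OF \<tau>] by (auto simp: gal_av_simps[OF \<tau>])
qed

text \<open>An equality of records, because conjugation transports the operation on all lists and
  not only on the carrier.\<close>

lemma gal_av_comp:
  assumes "\<tau> \<in> absGal F" "\<rho> \<in> absGal F'"
  shows "gal_av \<tau> (gal_av \<rho> A) = gal_av (\<tau> \<circ> \<rho>) A"
  unfolding gal_av_def
  by (simp add: gal_point_comp image_image inv_comp_absGal[OF assms])

lemma gal_av_id: "gal_av id A = A"
  unfolding gal_av_def by (cases A) simp

lemma gal_av_inv: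
  assumes "\<tau> \<in> absGal F"
  shows "gal_av (inv_into UNIV \<tau>) (gal_av \<tau> A) = A"
proof -
  have "inv_into UNIV \<tau> \<circ> \<tau> = id" using absGalD(8)[OF assms] by auto
  then show ?thesis using gal_av_comp[OF absGal_inv[OF assms] assms] gal_av_id by simp
qed

lemma av_hom_gal:
  assumes \<tau>: "\<tau> \<in> absGal G" and f: "f \<in> av_hom F A B"
    and A: "projective_group A" and B: "projective_group B"
  shows "gal_point \<tau> \<circ> f \<circ> gal_point (inv_into UNIV \<tau>) \<in> av_hom (\<tau> ` F) (gal_av \<tau> A) (gal_av \<tau> B)"
proof (rule av_homI)
  obtain ns where ns: "carrier A \<subseteq> multiproj_space ns" using A by (rule projective_groupE)
  obtain ms where ms: "carrier B \<subseteq> multiproj_space ms" using B by (rule projective_groupE)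
  show "regular (\<tau> ` F) (carrier (gal_av \<tau> A)) (carrier (gal_av \<tau> B))
      (gal_point \<tau> \<circ> f \<circ> gal_point (inv_into UNIV \<tau>))"
    using regular_gal[OF \<tau> av_homD(2)[OF f] ns ms] by (simp add: gal_av_simps[OF \<tau>])
  show "gal_point \<tau> \<circ> f \<circ> gal_point (inv_into UNIV \<tau>) \<in> hom (gal_av \<tau> A) (gal_av \<tau> B)"
    using av_homD(3,4)[OF f] \<tau> by (auto simp: hom_def gal_av_simps[OF \<tau>])
qed

text \<open>\<open>gal_qmor\<close> conjugates each member of a class. The result is a full class
  because every representative of the conjugate class can be conjugated back.\<close>

lemma gal_qmor_qfrac:
  assumes \<tau>: "\<tau> \<in> absGal G" and A: "projective_group A" and B: "projective_group B"
  shows "gal_qmor \<tau> (qfrac A B f n) =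
    qfrac (gal_av \<tau> A) (gal_av \<tau> B) (gal_point \<tau> \<circ> f \<circ> gal_point (inv_into UNIV \<tau>)) n"
proof -
  have UNIV: "\<tau> ` UNIV = UNIV" "inv_into UNIV \<tau> ` UNIV = UNIV"
    using absGalD(1)[OF \<tau>] absGalD(1)[OF absGal_inv[OF \<tau>]] by (simp_all add: bij_is_surj)
  note [simp] = gal_av_simps[OF \<tau>] gal_av_nat_pow[OF \<tau>] gal_point_inv[OF \<tau>]
  show ?thesis
  proof (intro subset_antisym subrelI)
    fix h m assume "(h, m) \<in> gal_qmor \<tau> (qfrac A B f n)"
    then obtain g where g: "h = gal_point \<tau> \<circ> g \<circ> gal_point (inv_into UNIV \<tau>)" "(g, m) \<in> qfrac A B f n"
      by (auto simp: gal_qmor_def)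
    then show "(h, m) \<in> qfrac (gal_av \<tau> A) (gal_av \<tau> B) (gal_point \<tau> \<circ> f \<circ> gal_point (inv_into UNIV \<tau>)) n"
      using av_hom_gal[OF \<tau> _ A B, of g UNIV] UNIV by (auto simp: mem_qfrac)
  next
    fix h m
    assume h: "(h, m) \<in> qfrac (gal_av \<tau> A) (gal_av \<tau> B) (gal_point \<tau> \<circ> f \<circ> gal_point (inv_into UNIV \<tau>)) n"
    define g where "g = gal_point (inv_into UNIV \<tau>) \<circ> h \<circ> gal_point \<tau>"
    have "h \<in> av_hom UNIV (gal_av \<tau> A) (gal_av \<tau> B)" using h by (simp add: mem_qfrac)
    from av_hom_gal[OF absGal_inv[OF \<tau>] this gal_av_projective[OF \<tau> A] gal_av_projective[OF \<tau> B]]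
    have g: "g \<in> av_hom UNIV A B"
      by (simp add: UNIV inv_inv_absGal[OF \<tau>] gal_av_inv[OF \<tau>] g_def)
    obtain k where k: "k > 0" "m > 0" "\<And>x. x \<in> carrier A \<Longrightarrow>
        gal_point \<tau> (f x [^]\<^bsub>B\<^esub> (k * m)) = h (gal_point \<tau> x) [^]\<^bsub>gal_av \<tau> B\<^esub> (k * n)"
      using h by (auto simp: mem_qfrac)
    have "f x [^]\<^bsub>B\<^esub> (k * m) = g x [^]\<^bsub>B\<^esub> (k * n)" if x: "x \<in> carrier A" for x
    proof -
      have "gal_point \<tau> (g x [^]\<^bsub>B\<^esub> (k * n)) = gal_point \<tau> (g x) [^]\<^bsub>gal_av \<tau> B\<^esub> (k * n)" by simp
      also have "\<dots> = gal_point \<tau> (f x [^]\<^bsub>B\<^esub> (k * m))" using k(3)[OF x] by (simp add: g_def)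
      finally show ?thesis by (metis gal_point_inv(2)[OF \<tau>])
    qed
    with g k have "(g, m) \<in> qfrac A B f n" by (auto simp: mem_qfrac)
    moreover have "h = gal_point \<tau> \<circ> g \<circ> gal_point (inv_into UNIV \<tau>)" by (simp add: g_def fun_eq_iff)
    ultimately show "(h, m) \<in> gal_qmor \<tau> (qfrac A B f n)" by (force simp: gal_qmor_def)
  qed
qed

lemma gal_qmor_closed:
  assumes \<tau>: "\<tau> \<in> absGal G" and \<phi>: "\<phi> \<in> qhom F A B" and A: "projective_group A" and B: "projective_group B"
  shows "gal_qmor \<tau> \<phi> \<in> qhom (\<tau> ` F) (gal_av \<tau> A) (gal_av \<tau> B)"
proof -
  obtain f n where f: "\<phi> = qfrac A B f n" "f \<in> av_hom F A B" "n > 0" using \<phi> by (rule qhomE)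
  then show ?thesis using av_hom_gal[OF \<tau> f(2) A B] by (simp add: gal_qmor_qfrac[OF \<tau> A B] qhomI)
qed

lemma gal_qmor_closed_UNIV:
  assumes \<tau>: "\<tau> \<in> absGal G" and \<phi>: "\<phi> \<in> qhom UNIV A B" and A: "projective_group A" and B: "projective_group B"
  shows "gal_qmor \<tau> \<phi> \<in> qhom UNIV (gal_av \<tau> A) (gal_av \<tau> B)"
  using gal_qmor_closed[OF assms] by (rule qhom_UNIV)

lemma gal_qmor_qcomp:
  assumes \<tau>: "\<tau> \<in> absGal G" and \<phi>: "\<phi> \<in> qhom UNIV B C" and \<psi>: "\<psi> \<in> qhom UNIV A B"
    and A: "projective_group A" and B: "projective_group B" and C: "projective_group C"
  shows "gal_qmor \<tau> (qcomp A C \<phi> \<psi>) = qcomp (gal_av \<tau> A) (gal_av \<tau> C) (gal_qmor \<tau> \<phi>) (gal_qmor \<tau> \<psi>)"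
proof -
  have UNIV: "\<tau> ` UNIV = UNIV" using absGalD(1)[OF \<tau>] by (rule bij_is_surj)
  obtain f n where f: "\<phi> = qfrac B C f n" "f \<in> av_hom UNIV B C" "n > 0" using \<phi> by (rule qhomE)
  obtain g m where g: "\<psi> = qfrac A B g m" "g \<in> av_hom UNIV A B" "m > 0" using \<psi> by (rule qhomE)
  have [simp]: "gal_point \<tau> \<circ> f \<circ> gal_point (inv_into UNIV \<tau>) \<circ> (gal_point \<tau> \<circ> g \<circ> gal_point (inv_into UNIV \<tau>))
      = gal_point \<tau> \<circ> (f \<circ> g) \<circ> gal_point (inv_into UNIV \<tau>)"
    using \<tau> by (simp add: fun_eq_iff)
  show ?thesis
    using f g A B C av_hom_gal[OF \<tau> f(2) B C] av_hom_gal[OF \<tau> g(2) A B]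
    by (simp add: gal_qmor_qfrac[OF \<tau>] qcomp_qfrac gal_av_projective[OF \<tau>] UNIV)
qed

lemma gal_qmor_qadd:
  assumes \<tau>: "\<tau> \<in> absGal G" and \<phi>: "\<phi> \<in> qhom UNIV A B" and \<psi>: "\<psi> \<in> qhom UNIV A B"
    and A: "projective_group A" and B: "projective_group B"
  shows "gal_qmor \<tau> (qadd A B \<phi> \<psi>) = qadd (gal_av \<tau> A) (gal_av \<tau> B) (gal_qmor \<tau> \<phi>) (gal_qmor \<tau> \<psi>)"
proof -
  have UNIV: "\<tau> ` UNIV = UNIV" using absGalD(1)[OF \<tau>] by (rule bij_is_surj)
  obtain f n where f: "\<phi> = qfrac A B f n" "f \<in> av_hom UNIV A B" "n > 0" using \<phi> by (rule qhomE)
  obtain g m where g: "\<psi> = qfrac A B g m" "g \<in> av_hom UNIV A B" "m > 0" using \<psi> by (rule qhomE)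
  have B': "comm_group B" "comm_group (gal_av \<tau> B)"
    using B gal_av_projective[OF \<tau> B] by auto
  show ?thesis
    using f g A B av_hom_gal[OF \<tau> f(2) A B] av_hom_gal[OF \<tau> g(2) A B]
    by (simp add: gal_qmor_qfrac[OF \<tau>] qadd_qfrac B' gal_av_nat_pow[OF \<tau>] gal_av_simps[OF \<tau>] UNIV comp_def)
qed

lemma gal_qmor_comp:
  assumes "\<tau> \<in> absGal F" "\<rho> \<in> absGal F'"
  shows "gal_qmor \<tau> (gal_qmor \<rho> \<phi>) = gal_qmor (\<tau> \<circ> \<rho>) \<phi>"
  unfolding gal_qmor_def image_image inv_comp_absGal[OF assms]
  by (rule image_cong) (auto simp: fun_eq_iff gal_point_comp)

lemma gal_qmor_id: "gal_qmor id \<phi> = \<phi>"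
  by (auto simp: gal_qmor_def comp_def image_iff)

lemma gal_qmor_inv:
  assumes "\<tau> \<in> absGal F"
  shows "gal_qmor (inv_into UNIV \<tau>) (gal_qmor \<tau> \<phi>) = \<phi>"
    "gal_qmor \<tau> (gal_qmor (inv_into UNIV \<tau>) \<phi>) = \<phi>"
proof -
  have "inv_into UNIV \<tau> \<circ> \<tau> = id" "\<tau> \<circ> inv_into UNIV \<tau> = id"
    using absGalD(7,8)[OF assms] by auto
  then show "gal_qmor (inv_into UNIV \<tau>) (gal_qmor \<tau> \<phi>) = \<phi>"
    "gal_qmor \<tau> (gal_qmor (inv_into UNIV \<tau>) \<phi>) = \<phi>"
    using gal_qmor_comp[OF absGal_inv[OF assms] assms] gal_qmor_comp[OF assms absGal_inv[OF assms]]
      gal_qmor_id by simp_all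
qed

text \<open>A conjugate of \<open>A\<close> by an automorphism that fixes the field of definition has the same points and
  the same group law on these, but the operation may differ outside the carrier.\<close>

definition same_group :: "point monoid \<Rightarrow> point monoid \<Rightarrow> bool" where
  "same_group A B \<longleftrightarrow> carrier A = carrier B \<and> \<one>\<^bsub>A\<^esub> = \<one>\<^bsub>B\<^esub> \<and>
     (\<forall>x\<in>carrier A. \<forall>y\<in>carrier A. x \<otimes>\<^bsub>A\<^esub> y = x \<otimes>\<^bsub>B\<^esub> y)"

lemma same_group_refl [simp]: "same_group A A"
  by (simp add: same_group_def)

lemma same_group_mult:
  "same_group A B \<Longrightarrow> x \<in> carrier A \<Longrightarrow> y \<in> carrier A \<Longrightarrow> x \<otimes>\<^bsub>A\<^esub> y = x \<otimes>\<^bsub>B\<^esub> y"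
  by (simp add: same_group_def)

lemma same_group_nat_pow:
  assumes "same_group A B" "comm_group A" "x \<in> carrier A"
  shows "x [^]\<^bsub>A\<^esub> (n::nat) = x [^]\<^bsub>B\<^esub> n"
proof -
  interpret comm_group A by fact
  show ?thesis
  proof (induction n)
    case (Suc n)
    have "x [^]\<^bsub>A\<^esub> Suc n = x [^]\<^bsub>A\<^esub> n \<otimes>\<^bsub>B\<^esub> x"
      using same_group_mult[OF assms(1) nat_pow_closed[OF assms(3)] assms(3)] by simp
    then show ?case by (simp add: Suc)
  qed (use assms(1) in \<open>simp add: same_group_def\<close>)
qed

lemma same_group_av_hom:
  assumes "same_group A A'" "same_group B B'"
  shows "av_hom F A B = av_hom F A' B'"
proof -
  have "hom A B = hom A' B'" using assms by (auto simp: hom_def same_group_def Pi_iff)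
  with assms show ?thesis by (simp add: av_hom_def same_group_def)
qed

text \<open>A class of fractions sees the operation of the target only through powers of values of
  homomorphisms, and these lie in the carrier.\<close>

lemma same_group_qfrac:
  assumes "same_group A A'" "same_group B B'" "comm_group B" "f \<in> carrier A \<rightarrow> carrier B"
  shows "qfrac A B f n = qfrac A' B' f n"
proof -
  have car: "carrier A' = carrier A" using assms(1) by (simp add: same_group_def)
  have "f x [^]\<^bsub>B\<^esub> (k::nat) = f x [^]\<^bsub>B'\<^esub> k" if "x \<in> carrier A" for x k
    using same_group_nat_pow[OF assms(2,3)] assms(4) that by blast
  moreover have "g x [^]\<^bsub>B\<^esub> (k::nat) = g x [^]\<^bsub>B'\<^esub> k" if "g \<in> av_hom UNIV A B" "x \<in> carrier A" for g x k
    using same_group_nat_pow[OF assms(2,3) av_homD(3)[OF that]] .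
  ultimately show ?thesis
    unfolding qfrac_def same_group_av_hom[OF assms(1,2), symmetric] car by auto
qed

lemma same_group_qhom:
  assumes "same_group A A'" "same_group B B'" "comm_group B"
  shows "qhom F A B = qhom F A' B'"
proof -
  have "qfrac A B f n = qfrac A' B' f n" if "f \<in> av_hom F A B" for f n
    using that av_homD(3) by (intro same_group_qfrac assms) auto
  then show ?thesis
    unfolding qhom_def same_group_av_hom[OF assms(1,2), symmetric] by metis
qed

text \<open>The middle object does not occur in \<open>qcomp\<close>, so only source and target have
  to be replaced.\<close>

lemma same_group_qcomp:
  assumes "same_group A A'" "same_group C C'" "comm_group C" "\<phi> \<in> qhom UNIV B C" "\<psi> \<in> qhom UNIV A B"
  shows "qcomp A C \<phi> \<psi> = qcomp A' C' \<phi> \<psi>"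
  unfolding qcomp_def
proof (intro SUP_cong refl, clarsimp)
  have "qfrac A C (f \<circ> g) (n * m) = qfrac A' C' (f \<circ> g) (n * m)"
    if "(f, n) \<in> \<phi>" "(g, m) \<in> \<psi>" for f g n m
  proof -
    have "f \<in> av_hom UNIV B C" "g \<in> av_hom UNIV A B"
      using that assms(4,5) by (auto simp: qhom_def mem_qfrac)
    then show ?thesis using av_homD(3) by (intro same_group_qfrac assms) auto
  qed
  then show "(\<Union>(g, m)\<in>\<psi>. qfrac A C (f \<circ> g) (n * m)) = (\<Union>(g, m)\<in>\<psi>. qfrac A' C' (f \<circ> g) (n * m))"
    if "(f, n) \<in> \<phi>" for f n
    using that by (intro SUP_cong refl) auto
qed

lemma same_group_qadd:
  assumes "same_group A A'" "same_group B B'" "comm_group B" "\<phi> \<in> qhom UNIV A B" "\<psi> \<in> qhom UNIV A B"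
  shows "qadd A B \<phi> \<psi> = qadd A' B' \<phi> \<psi>"
  unfolding qadd_def
proof (intro SUP_cong refl, clarsimp)
  interpret B: comm_group B by fact
  have "qfrac A B (\<lambda>x. f x [^]\<^bsub>B\<^esub> m \<otimes>\<^bsub>B\<^esub> g x [^]\<^bsub>B\<^esub> n) (n * m) =
      qfrac A' B' (\<lambda>x. f x [^]\<^bsub>B'\<^esub> m \<otimes>\<^bsub>B'\<^esub> g x [^]\<^bsub>B'\<^esub> n) (n * m)"
    if "(f, n) \<in> \<phi>" "(g, m) \<in> \<psi>" for f g n m
  proof -
    have fg: "f \<in> av_hom UNIV A B" "g \<in> av_hom UNIV A B"
      using that assms(4,5) by (auto simp: qhom_def mem_qfrac)
    note cl = av_homD(3)[OF fg(1)] av_homD(3)[OF fg(2)]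
    have "qfrac A B (\<lambda>x. f x [^]\<^bsub>B\<^esub> m \<otimes>\<^bsub>B\<^esub> g x [^]\<^bsub>B\<^esub> n) (n * m) =
        qfrac A' B' (\<lambda>x. f x [^]\<^bsub>B\<^esub> m \<otimes>\<^bsub>B\<^esub> g x [^]\<^bsub>B\<^esub> n) (n * m)"
      using cl by (intro same_group_qfrac assms) auto
    also have "\<dots> = qfrac A' B' (\<lambda>x. f x [^]\<^bsub>B'\<^esub> m \<otimes>\<^bsub>B'\<^esub> g x [^]\<^bsub>B'\<^esub> n) (n * m)"
    proof (rule qfrac_cong)
      fix x assume "x \<in> carrier A'"
      then have x: "x \<in> carrier A" using assms(1) by (simp add: same_group_def)
      have "f x [^]\<^bsub>B\<^esub> m \<otimes>\<^bsub>B\<^esub> g x [^]\<^bsub>B\<^esub> n = f x [^]\<^bsub>B\<^esub> m \<otimes>\<^bsub>B'\<^esub> g x [^]\<^bsub>B\<^esub> n"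
        using cl[OF x] by (intro same_group_mult[OF assms(2)] B.nat_pow_closed)
      then show "f x [^]\<^bsub>B\<^esub> m \<otimes>\<^bsub>B\<^esub> g x [^]\<^bsub>B\<^esub> n = f x [^]\<^bsub>B'\<^esub> m \<otimes>\<^bsub>B'\<^esub> g x [^]\<^bsub>B'\<^esub> n"
        using same_group_nat_pow[OF assms(2,3)] cl[OF x] by simp
    qed
    finally show ?thesis .
  qed
  then show "(\<Union>(g, m)\<in>\<psi>. qfrac A B (\<lambda>x. f x [^]\<^bsub>B\<^esub> m \<otimes>\<^bsub>B\<^esub> g x [^]\<^bsub>B\<^esub> n) (n * m)) =
    (\<Union>(g, m)\<in>\<psi>. qfrac A' B' (\<lambda>x. f x [^]\<^bsub>B'\<^esub> m \<otimes>\<^bsub>B'\<^esub> g x [^]\<^bsub>B'\<^esub> n) (n * m))"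
    if "(f, n) \<in> \<phi>" for f n
    using that by (intro SUP_cong refl) auto
qed

section \<open>Conjugation by automorphisms that fix the field of definition\<close>

lemma zariski_closed_mono:
  assumes "zariski_closed F U" "F \<subseteq> F'"
  shows "zariski_closed F' U"
proof -
  obtain ns S where S: "\<forall>p\<in>S. \<exists>d. multiform F (length ns) d p"
    "U = {x \<in> multiproj_space ns. \<forall>p\<in>S. \<forall>v\<in>reps x. p v = 0}"
    using assms(1) unfolding zariski_closed_def by blast
  have "\<exists>d. multiform F' (length ns) d p" if "p \<in> S" for p
    using S(1) that multiform_mono[OF _ assms(2) order_refl] by metis
  with S(2) show ?thesis unfolding zariski_closed_def by (intro exI[of _ ns] exI[of _ S]) simp
qed

lemma abelian_variety_mono: "abelian_variety F A \<Longrightarrow> F \<subseteq> F' \<Longrightarrow> abelian_variety F' A"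
  unfolding abelian_variety_def projective_variety_def
  by (intro conjI; elim conjE; (assumption | rule zariski_closed_mono rational_point_mono regular_mono, assumption+))

text \<open>Equations over \<open>F\<close> give equality of the point sets, rationality of the
  origin equality of the neutral elements, and regularity of the group law over \<open>F\<close>
  equality of sums of points.\<close>

lemma gal_av_same_group:
  assumes A: "abelian_variety F A" and \<tau>: "\<tau> \<in> absGal F"
  shows "same_group (gal_av \<tau> A) A"
proof -
  have gv: "group_variety F A" using A by (rule abelian_variety_group_variety)
  then have pg: "projective_group A" by auto
  interpret A: comm_group A using pg by auto
  obtain ns where ns: "carrier A \<subseteq> multiproj_space ns" using pg by (rule projective_groupE)
  have stable: "gal_point \<tau> ` carrier A = carrier A"
    using A by (intro zariski_closed_gal[OF \<tau>]) (simp add: abelian_variety_def projective_variety_def)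
  have one: "gal_point \<tau> \<one>\<^bsub>A\<^esub> = \<one>\<^bsub>A\<^esub>"
    using rational_point_gal[OF \<tau>] A ns A.one_closed by (auto simp: abelian_variety_def)
  note ns2 = variety_prod_multiproj[OF ns ns]
  let ?m = "\<lambda>z. take (length \<one>\<^bsub>A\<^esub>) z \<otimes>\<^bsub>A\<^esub> drop (length \<one>\<^bsub>A\<^esub>) z"
  have "x \<otimes>\<^bsub>gal_av \<tau> A\<^esub> y = x \<otimes>\<^bsub>A\<^esub> y" if x: "x \<in> carrier A" and y: "y \<in> carrier A" for x y
  proof -
    have "x \<in> gal_point \<tau> ` carrier A" "y \<in> gal_point \<tau> ` carrier A" using x y stable by auto
    then obtain x' y' where x': "x' \<in> carrier A" "x = gal_point \<tau> x'"
      and y': "y' \<in> carrier A" "y = gal_point \<tau> y'" by auto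
    have len: "length x = length \<one>\<^bsub>A\<^esub>" "length x' = length \<one>\<^bsub>A\<^esub>"
      using projective_group_length[OF pg x] projective_group_length[OF pg x'(1)] by auto
    \<comment> \<open>The group law is a map on concatenated points, on which conjugation acts
      componentwise.\<close>
    have "?m (gal_point \<tau> (x' @ y')) = gal_point \<tau> (?m (x' @ y'))"
    proof (rule regular_gal_fixed[where f = ?m, OF \<tau> _ ns2 ns])
      show "regular F (variety_prod (carrier A) (carrier A)) (carrier A) ?m"
        using A by (simp add: abelian_variety_def)
      show "x' @ y' \<in> variety_prod (carrier A) (carrier A)"
        "gal_point \<tau> (x' @ y') \<in> variety_prod (carrier A) (carrier A)"
        using x x' y y' by (auto simp: variety_prod_def gal_point_append)
    qed
    then have "x \<otimes>\<^bsub>A\<^esub> y = gal_point \<tau> (x' \<otimes>\<^bsub>A\<^esub> y')"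
      using len by (simp add: gal_point_append x'(2) y'(2))
    then show ?thesis by (simp add: x'(2) y'(2) gal_av_simps[OF \<tau>])
  qed
  then show ?thesis using stable one by (simp add: same_group_def gal_av_simps[OF \<tau>])
qed

text \<open>On points the numerator commutes with \<tau>, so conjugating it changes nothing; its
  class, formed for the conjugate groups, is first rewritten as one for A and B themselves.\<close>

lemma gal_qmor_fixed:
  assumes A: "abelian_variety F A" and B: "abelian_variety F B" and \<tau>: "\<tau> \<in> absGal F"
    and \<phi>: "\<phi> \<in> qhom F A B"
  shows "gal_qmor \<tau> \<phi> = \<phi>"
proof -
  have pg: "projective_group A" "projective_group B"
    using A B abelian_variety_group_variety by auto
  obtain ns where ns: "carrier A \<subseteq> multiproj_space ns" using pg(1) by (rule projective_groupE)
  obtain ms where ms: "carrier B \<subseteq> multiproj_space ms" using pg(2) by (rule projective_groupE)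
  obtain f n where f: "\<phi> = qfrac A B f n" "f \<in> av_hom F A B" "n > 0" using \<phi> by (rule qhomE)
  let ?f = "gal_point \<tau> \<circ> f \<circ> gal_point (inv_into UNIV \<tau>)"
  have stable: "gal_point (inv_into UNIV \<tau>) ` carrier A = carrier A"
    using A by (intro zariski_closed_gal[OF absGal_inv[OF \<tau>]]) (simp add: abelian_variety_def projective_variety_def)
  have "gal_qmor \<tau> \<phi> = qfrac (gal_av \<tau> A) (gal_av \<tau> B) ?f n"
    by (simp add: f(1) gal_qmor_qfrac[OF \<tau> pg])
  also have "\<dots> = qfrac A B ?f n"
  proof (rule same_group_qfrac[OF gal_av_same_group[OF A \<tau>] gal_av_same_group[OF B \<tau>]])
    show "comm_group (gal_av \<tau> B)" using gal_av_projective[OF \<tau> pg(2)] by auto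
    show "?f \<in> carrier (gal_av \<tau> A) \<rightarrow> carrier (gal_av \<tau> B)"
      using av_homD(3)[OF av_hom_gal[OF \<tau> f(2) pg]] by blast
  qed
  also have "\<dots> = qfrac A B f n"
  proof (rule qfrac_cong)
    fix x assume x: "x \<in> carrier A"
    then have x': "gal_point (inv_into UNIV \<tau>) x \<in> carrier A" using stable by blast
    have "f (gal_point \<tau> (gal_point (inv_into UNIV \<tau>) x)) = gal_point \<tau> (f (gal_point (inv_into UNIV \<tau>) x))"
      using x x' \<tau> by (intro regular_gal_fixed[OF \<tau> av_homD(2)[OF f(2)] ns ms]) simp_all
    then show "?f x = f x" using \<tau> by simp
  qed
  finally show ?thesis by (simp add: f(1))
qed

text \<open>\<open>qinv\<close> is chosen among morphisms over the algebraic closure. Two-sided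
  inverses are unique there, so it is the inverse over \<open>F\<close> that \<open>isogeny\<close>
  provides.\<close>

lemma qinv_isogeny:
  assumes \<phi>: "isogeny F A B \<phi>" and A: "projective_group A" and B: "projective_group B"
  shows "qinv A B \<phi> \<in> qhom F B A" "qcomp A A (qinv A B \<phi>) \<phi> = qid A" "qcomp B B \<phi> (qinv A B \<phi>) = qid B"
proof -
  obtain \<psi> where \<psi>: "\<psi> \<in> qhom F B A" "qcomp A A \<psi> \<phi> = qid A" "qcomp B B \<phi> \<psi> = qid B"
    using \<phi> by (auto simp: isogeny_def)
  have \<phi>': "\<phi> \<in> qhom UNIV A B" using \<phi> by (auto simp: isogeny_def intro: qhom_UNIV)
  have "qinv A B \<phi> = \<psi>"
    unfolding qinv_def
  proof (rule the_equality)
    show "\<psi> \<in> qhom UNIV B A \<and> qcomp A A \<psi> \<phi> = qid A \<and> qcomp B B \<phi> \<psi> = qid B"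
      using \<psi> qhom_UNIV by blast
    fix \<psi>' assume \<psi>': "\<psi>' \<in> qhom UNIV B A \<and> qcomp A A \<psi>' \<phi> = qid A \<and> qcomp B B \<phi> \<psi>' = qid B"
    have "\<psi>' = qcomp B A \<psi>' (qcomp B B \<phi> \<psi>)" using \<psi>' \<psi>(3) A B by (simp add: qcomp_qid)
    also have "\<dots> = qcomp B A (qcomp A A \<psi>' \<phi>) \<psi>"
      using \<psi>' qhom_UNIV[OF \<psi>(1)] \<phi>' A B by (intro qcomp_assoc[symmetric]) auto
    also have "\<dots> = \<psi>" using \<psi>' qhom_UNIV[OF \<psi>(1)] A B by (simp add: qcomp_qid)
    finally show "\<psi>' = \<psi>" .
  qed
  with \<psi> show "qinv A B \<phi> \<in> qhom F B A" "qcomp A A (qinv A B \<phi>) \<phi> = qid A"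
    "qcomp B B \<phi> (qinv A B \<phi>) = qid B" by simp_all
qed


section \<open>Automorphisms of the algebraic numbers\<close>

lemma Qbar_simps [simp]:
  "carrier Qbar = UNIV" "x \<otimes>\<^bsub>Qbar\<^esub> y = x * y" "x \<oplus>\<^bsub>Qbar\<^esub> y = x + y" "\<one>\<^bsub>Qbar\<^esub> = 1" "\<zero>\<^bsub>Qbar\<^esub> = 0"
  by (simp_all add: ring_of_type_algebra_def)

lemma Qbar_ring: "ring Qbar"
  by (rule ring_from_type_algebra)

lemma subfield_Qbar_closed:
  assumes "subfield F Qbar"
  shows "0 \<in> F" "1 \<in> F" "x \<in> F \<Longrightarrow> y \<in> F \<Longrightarrow> x + y \<in> F" "x \<in> F \<Longrightarrow> y \<in> F \<Longrightarrow> x * y \<in> F"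
    "x \<in> F \<Longrightarrow> - x \<in> F" "x \<in> F \<Longrightarrow> inverse x \<in> F"
proof -
  note sr = subringE[OF subfieldE(1)[OF assms]]
  show "0 \<in> F" "1 \<in> F" "x \<in> F \<Longrightarrow> y \<in> F \<Longrightarrow> x + y \<in> F" "x \<in> F \<Longrightarrow> y \<in> F \<Longrightarrow> x * y \<in> F"
    using sr by auto
  show "- x \<in> F" if "x \<in> F"
  proof -
    have "\<ominus>\<^bsub>Qbar\<^esub> x = - x"
      using abelian_group.minus_equality[OF ring.is_abelian_group[OF Qbar_ring], of "- x" x] by simp
    with sr(5)[OF that] show ?thesis by simp
  qed
  show "inverse x \<in> F" if "x \<in> F"
  proof (cases "x = 0")
    case False
    with that ring.subfield_m_inv[OF Qbar_ring assms, of x]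
    have "inv\<^bsub>Qbar\<^esub> x \<in> F" "x * inv\<^bsub>Qbar\<^esub> x = 1" by auto
    then show ?thesis by (metis inverse_unique)
  qed (use \<open>0 \<in> F\<close> in simp)
qed

lemma subfield_Rats:
  assumes "subfield F Qbar"
  shows "\<rat> \<subseteq> F"
proof -
  note cl = subfield_Qbar_closed[OF assms]
  have nat: "of_nat n \<in> F" for n by (induction n) (auto intro: cl)
  have int: "of_int n \<in> F" for n
    by (cases n) (auto intro!: cl nat simp del: of_nat_Suc)
  show ?thesis
  proof
    fix c :: qbar assume "c \<in> \<rat>"
    then obtain a b where "c = of_int a / of_int b" by (rule Rats_cases')
    then show "c \<in> F" using cl(4,6) int by (simp add: divide_inverse)
  qed
qed

section \<open>Extending embeddings of fields of algebraic numbers\<close>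

lemma qbar_algebraic:
  obtains p :: "qbar poly" where "p \<noteq> 0" "\<And>i. Polynomial.coeff p i \<in> \<rat>" "poly p x = 0"
proof -
  obtain q :: "rat poly" where q: "q \<noteq> 0" "poly (map_poly to_ac q) x = 0"
    by (rule alg_closure_algebraic[of x])
  have rat: "to_ac c \<in> \<rat>" for c :: rat
  proof -
    obtain a b where "c = of_int a / of_int b" by (metis quotient_of_div surj_pair)
    then show ?thesis by simp
  qed
  show thesis
  proof (rule that[OF _ _ q(2)])
    show "map_poly to_ac q \<noteq> 0" using q(1) by (simp add: map_poly_eq_0_iff)
    show "Polynomial.coeff (map_poly to_ac q) i \<in> \<rat>" for i using rat by (simp add: coeff_map_poly)
  qed
qed

text \<open>Algebraicity replaces division: a rational relation \<open>c + a * q(a) = 0\<close> with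
  \<open>c\<close> nonzero expresses the inverse of \<open>a\<close> as a polynomial in
  \<open>a\<close>. If the constant term is zero, a factor \<open>a\<close> is cancelled from the
  relation.\<close>

lemma Rats_algebra_inverse_closed:
  assumes "\<rat> \<subseteq> S" "\<And>x y. x \<in> S \<Longrightarrow> y \<in> S \<Longrightarrow> x + y \<in> S" "\<And>x y. x \<in> S \<Longrightarrow> y \<in> S \<Longrightarrow> x * y \<in> S"
    and "(a::qbar) \<in> S"
  shows "inverse a \<in> S"
proof (cases "a = 0")
  case False
  have poly: "poly p a \<in> S" if "\<And>i. Polynomial.coeff p i \<in> \<rat>" for p
    using that
  proof (induction p)
    case (pCons c p)
    have "c \<in> \<rat>" "\<And>i. Polynomial.coeff p i \<in> \<rat>"
      using pCons.prems[of 0] pCons.prems[of "Suc _"] by simp_all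
    with pCons.IH assms show ?case by auto
  qed (use assms(1) in auto)
  have "inverse a \<in> S" if "p \<noteq> 0" "\<And>i. Polynomial.coeff p i \<in> \<rat>" "poly p a = 0" for p
    using that
  proof (induction p)
    case (pCons c p)
    have c: "c \<in> \<rat>" and p: "\<And>i. Polynomial.coeff p i \<in> \<rat>"
      using pCons.prems(2)[of 0] pCons.prems(2)[of "Suc _"] by simp_all
    show ?case
    proof (cases "c = 0")
      case True
      with pCons False p show ?thesis by auto
    next
      case nz: False
      have "inverse a = (- inverse c) * poly p a"
        using pCons.prems(3) False nz by (simp add: field_simps add_eq_0_iff)
      moreover have "- inverse c \<in> S" using c assms(1) by auto
      ultimately show ?thesis using assms(3)[OF _ poly[OF p]] by metis
    qed
  qed simp
  with qbar_algebraic[of a] show ?thesis by blast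
qed (use assms(1) in auto)

text \<open>The graph of a ring homomorphism from a subring \<open>F\<close> of \<open>Qbar\<close> that contains the rationals. As \<open>F\<close> is
  algebraic over the rationals, it is automatically a field. Working with graphs makes the unions of
  chains in Zorn's lemma trivial.\<close>

definition partial_embedding :: "(qbar \<times> qbar) set \<Rightarrow> bool" where
  "partial_embedding g \<longleftrightarrow> single_valued g \<and> (\<forall>c\<in>\<rat>. (c, c) \<in> g) \<and>
     (\<forall>a b c d. (a, b) \<in> g \<and> (c, d) \<in> g \<longrightarrow> (a + c, b + d) \<in> g \<and> (a * c, b * d) \<in> g)"

lemma partial_embeddingD:
  assumes "partial_embedding g"
  shows "c \<in> \<rat> \<Longrightarrow> (c, c) \<in> g" "(a, b) \<in> g \<Longrightarrow> (c, d) \<in> g \<Longrightarrow> (a + c, b + d) \<in> g"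
    "(a, b) \<in> g \<Longrightarrow> (c, d) \<in> g \<Longrightarrow> (a * c, b * d) \<in> g"
    "(a, b) \<in> g \<Longrightarrow> (a, b') \<in> g \<Longrightarrow> b = b'"
  using assms by (auto simp: partial_embedding_def single_valued_def)

lemma partial_embedding_diff:
  assumes "partial_embedding g" "(a, b) \<in> g" "(c, d) \<in> g"
  shows "(a - c, b - d) \<in> g"
proof -
  note g = partial_embeddingD[OF assms(1)]
  have "(-1, -1) \<in> g" by (rule g(1)) simp
  from g(2)[OF assms(2) g(3)[OF this assms(3)]] show ?thesis by simp
qed

text \<open>The right polynomial is the image of the left one under the embedding with graph
  \<open>g\<close>, applied to the coefficients.\<close>

definition poly_rel :: "(qbar \<times> qbar) set \<Rightarrow> qbar poly \<Rightarrow> qbar poly \<Rightarrow> bool" where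
  "poly_rel g p q \<longleftrightarrow> (\<forall>i. (Polynomial.coeff p i, Polynomial.coeff q i) \<in> g)"

lemma poly_rel_add:
  "partial_embedding g \<Longrightarrow> poly_rel g p q \<Longrightarrow> poly_rel g p' q' \<Longrightarrow> poly_rel g (p + p') (q + q')"
  by (auto simp: poly_rel_def partial_embeddingD)

lemma poly_rel_diff:
  "partial_embedding g \<Longrightarrow> poly_rel g p q \<Longrightarrow> poly_rel g p' q' \<Longrightarrow> poly_rel g (p - p') (q - q')"
  by (auto simp: poly_rel_def partial_embedding_diff)

lemma poly_rel_mult:
  assumes g: "partial_embedding g" and "poly_rel g p q" "poly_rel g p' q'"
  shows "poly_rel g (p * p') (q * q')"
  unfolding poly_rel_def coeff_mult
proof
  fix n
  have "(\<Sum>i\<in>I. Polynomial.coeff p i * Polynomial.coeff p' (n - i),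
      \<Sum>i\<in>I. Polynomial.coeff q i * Polynomial.coeff q' (n - i)) \<in> g" if "finite I" for I
    using that
  proof (induction I)
    case empty
    show ?case using partial_embeddingD(1)[OF g, of 0] by simp
  next
    case (insert i I)
    with assms show ?case by (auto simp: poly_rel_def intro!: partial_embeddingD(2,3)[OF g])
  qed
  then show "(\<Sum>i\<le>n. Polynomial.coeff p i * Polynomial.coeff p' (n - i),
      \<Sum>i\<le>n. Polynomial.coeff q i * Polynomial.coeff q' (n - i)) \<in> g" by simp
qed

lemma poly_rel_monom: "partial_embedding g \<Longrightarrow> (a, b) \<in> g \<Longrightarrow> poly_rel g (Polynomial.monom a n) (Polynomial.monom b n)"
  by (auto simp: poly_rel_def partial_embeddingD)

text \<open>The domain is a ring that contains the rationals and so is closed under inverses; a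
  nonzero element is then a unit of the domain, and units go to units.\<close>

lemma partial_embedding_inverse:
  assumes g: "partial_embedding g" and ab: "(a, b) \<in> g" "a \<noteq> 0"
  shows "(inverse a, inverse b) \<in> g" "b \<noteq> 0"
proof -
  note gD = partial_embeddingD[OF g]
  have "inverse a \<in> Domain g"
  proof (rule Rats_algebra_inverse_closed)
    show "a \<in> Domain g" using ab by auto
    show "\<rat> \<subseteq> Domain g" using gD(1) by auto
    fix x y assume "x \<in> Domain g" "y \<in> Domain g"
    then obtain x' y' where "(x, x') \<in> g" "(y, y') \<in> g" by auto
    from gD(2,3)[OF this] show "x + y \<in> Domain g" "x * y \<in> Domain g" by auto
  qed
  then obtain c where c: "(inverse a, c) \<in> g" by auto
  have "(1, b * c) \<in> g" using gD(3)[OF ab(1) c] ab(2) by simp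
  with gD(1)[of 1] gD(4) have bc: "b * c = 1" by auto
  then show "b \<noteq> 0" by auto
  have "c = inverse b" using bc by (simp add: inverse_unique)
  with c show "(inverse a, inverse b) \<in> g" by simp
qed

text \<open>A coefficient is zero exactly when its image is, since the embedding is
  injective.\<close>

lemma poly_rel_degree:
  assumes g: "partial_embedding g" and pq: "poly_rel g p q"
  shows "Polynomial.degree q = Polynomial.degree p"
proof -
  have "Polynomial.coeff q i = 0 \<longleftrightarrow> Polynomial.coeff p i = 0" for i
  proof
    have *: "(Polynomial.coeff p i, Polynomial.coeff q i) \<in> g" using pq by (simp add: poly_rel_def)
    show "Polynomial.coeff p i = 0" if "Polynomial.coeff q i = 0"
      using partial_embedding_inverse(2)[OF g *] that by auto
    show "Polynomial.coeff q i = 0" if "Polynomial.coeff p i = 0"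
      using * that partial_embeddingD(1)[OF g, of 0] partial_embeddingD(4)[OF g] by auto
  qed
  then show ?thesis by (simp add: Polynomial.degree_def)
qed

text \<open>\<open>y\<close> is a root of the image of a polynomial of minimal degree that vanishes at \<open>x\<close>.\<close>

lemma conjugate_root_exists:
  assumes g: "partial_embedding g"
  obtains y where "\<And>p q. poly_rel g p q \<Longrightarrow> poly p x = 0 \<Longrightarrow> poly q y = 0"
proof -
  \<comment> \<open>Nonzero polynomials over the domain of \<open>g\<close> with root
    \<open>x\<close>; one of least degree is the minimal polynomial of \<open>x\<close> up to a
    scalar.\<close>
  define A where "A p \<longleftrightarrow> p \<noteq> 0 \<and> (\<exists>q. poly_rel g p q) \<and> poly p x = 0" for p
  obtain p0 where p0: "p0 \<noteq> 0" "\<And>i. Polynomial.coeff p0 i \<in> \<rat>" "poly p0 x = 0"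
    by (rule qbar_algebraic[of x]) blast
  have "poly_rel g p0 p0" using p0(2) partial_embeddingD(1)[OF g] by (simp add: poly_rel_def)
  with p0 have "A p0" by (auto simp: A_def)
  then obtain p where p: "A p" and min: "\<And>r. A r \<Longrightarrow> Polynomial.degree p \<le> Polynomial.degree r"
    using exists_least_iff[of "\<lambda>n. \<exists>p. A p \<and> Polynomial.degree p = n"] by (metis not_le)
  from p obtain q where pq: "poly_rel g p q" "p \<noteq> 0" "poly p x = 0" by (auto simp: A_def)
  have deg: "Polynomial.degree q = Polynomial.degree p" by (rule poly_rel_degree[OF g pq(1)])
  have "Polynomial.degree p > 0"
  proof (rule ccontr)
    assume "\<not> Polynomial.degree p > 0"
    then obtain c where "p = [:c:]" using degree_eq_zeroE[of p] by auto
    with pq(2,3) show False by simp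
  qed
  \<comment> \<open>\<open>q\<close> is the conjugate of the minimal polynomial; any of its roots
    will do as the image of \<open>x\<close>.\<close>
  then obtain y where y: "poly q y = 0" using deg alg_closed_imp_poly_has_root[of q] by auto
  have "poly s y = 0" if "poly_rel g r s" "poly r x = 0" for r s
    using that
  proof (induction "Polynomial.degree r" arbitrary: r s rule: less_induct)
    case less
    have ds: "Polynomial.degree s = Polynomial.degree r" by (rule poly_rel_degree[OF g less(2)])
    show ?case
    proof (cases "r = 0")
      case True
      have "Polynomial.coeff s i = 0" for i
        using less(2) True partial_embeddingD(1)[OF g, of 0] partial_embeddingD(4)[OF g]
        by (auto simp: poly_rel_def)
      then have "s = 0" by (simp add: poly_eq_iff)
      then show ?thesis by simp
    next
      case False
      with less(2,3) have "A r" by (auto simp: A_def)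
      then have le: "Polynomial.degree p \<le> Polynomial.degree r" by (rule min)
      \<comment> \<open>One step of division with remainder, carried out on both sides of the
        relation: the leading term of \<open>r\<close> is cancelled with a multiple of
        \<open>p\<close>, and \<open>s\<close> is reduced by the corresponding multiple of
        \<open>q\<close>.\<close>
      define n where "n = Polynomial.degree r - Polynomial.degree p"
      define a where "a = Polynomial.lead_coeff r / Polynomial.lead_coeff p"
      define b where "b = Polynomial.coeff s (Polynomial.degree r) / Polynomial.coeff q (Polynomial.degree p)"
      have "(Polynomial.lead_coeff p, Polynomial.coeff q (Polynomial.degree p)) \<in> g"
        "(Polynomial.lead_coeff r, Polynomial.coeff s (Polynomial.degree r)) \<in> g"
        using pq(1) less(2) by (simp_all add: poly_rel_def)
      then have ab: "(a, b) \<in> g"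
        unfolding a_def b_def divide_inverse using pq(2)
        by (intro partial_embeddingD(3)[OF g] partial_embedding_inverse(1)[OF g]) simp_all
      define r' where "r' = r - Polynomial.monom a n * p"
      define s' where "s' = s - Polynomial.monom b n * q"
      have rel: "poly_rel g r' s'" unfolding r'_def s'_def
        by (intro poly_rel_diff poly_rel_mult poly_rel_monom g less(2) pq(1) ab)
      have r'x: "poly r' x = 0" using less(3) pq(3) by (simp add: r'_def)
      have "poly s' y = 0"
      proof (cases "r' = 0")
        case True
        have "Polynomial.coeff s' i = 0" for i
          using rel True partial_embeddingD(1)[OF g, of 0] partial_embeddingD(4)[OF g]
          by (auto simp: poly_rel_def)
        then have "s' = 0" by (simp add: poly_eq_iff)
        then show ?thesis by simp
      next
        case r': False
        have "a \<noteq> 0" using False pq(2) by (simp add: a_def)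
        then have dm: "Polynomial.degree (Polynomial.monom a n * p) = Polynomial.degree r"
          using le pq(2) by (simp add: degree_mult_eq degree_monom_eq n_def monom_eq_0_iff)
        have "Polynomial.degree r' \<le> Polynomial.degree r"
          unfolding r'_def using dm by (intro degree_diff_le) auto
        moreover have "Polynomial.coeff r' (Polynomial.degree r) = 0"
        proof -
          have "Polynomial.coeff (Polynomial.monom a n * p) (Polynomial.degree r) = Polynomial.lead_coeff (Polynomial.monom a n * p)"
            by (simp add: dm)
          also have "\<dots> = a * Polynomial.lead_coeff p" by (simp add: lead_coeff_mult degree_monom_eq \<open>a \<noteq> 0\<close>)
          also have "\<dots> = Polynomial.lead_coeff r" using pq(2) by (simp add: a_def)
          finally show ?thesis by (simp add: r'_def)
        qed
        ultimately have "Polynomial.degree r' < Polynomial.degree r"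
          using r' by (metis le_neq_implies_less leading_coeff_0_iff)
        then show ?thesis using less(1) rel r'x by blast
      qed
      then show ?thesis using y by (simp add: s'_def)
    qed
  qed
  with that show thesis by blast
qed

text \<open>The value of a polynomial at \<open>x\<close> is sent to the value of its image at
  \<open>y\<close>. This is well defined by the choice of \<open>y\<close>: a difference of
  polynomials that vanishes at \<open>x\<close> has an image that vanishes at
  \<open>y\<close>.\<close>

lemma partial_embedding_adjoin:
  assumes g: "partial_embedding g"
  obtains h y where "partial_embedding h" "g \<subseteq> h" "(x, y) \<in> h"
proof -
  obtain y where y: "\<And>p q. poly_rel g p q \<Longrightarrow> poly p x = 0 \<Longrightarrow> poly q y = 0"
    by (rule conjugate_root_exists[OF g]) blast
  define h where "h = {(poly p x, poly q y) | p q. poly_rel g p q}"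
  have hI: "(a, b) \<in> h" if "poly_rel g p q" "a = poly p x" "b = poly q y" for a b p q
    using that by (auto simp: h_def)
  have 0: "(0, 0) \<in> g" using partial_embeddingD(1)[OF g, of 0] by simp
  show thesis
  proof (rule that[of h y])
    show gh: "g \<subseteq> h"
    proof clarify
      fix a b assume "(a, b) \<in> g"
      then show "(a, b) \<in> h"
        by (intro hI[OF poly_rel_monom[OF g, of a b 0]]) (simp_all add: poly_monom)
    qed
    show "(x, y) \<in> h"
      by (rule hI[OF poly_rel_monom[OF g, of 1 1 1]]) (auto simp: poly_monom intro: partial_embeddingD(1)[OF g])
    show "partial_embedding h"
      unfolding partial_embedding_def
    proof (intro conjI allI impI ballI)
      show "(c, c) \<in> h" if "c \<in> \<rat>" for c using gh partial_embeddingD(1)[OF g that] by blast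
      show "single_valued h"
      proof (rule single_valuedI)
        fix a b b' assume "(a, b) \<in> h" "(a, b') \<in> h"
        then obtain p q p' q' where *: "poly_rel g p q" "a = poly p x" "b = poly q y"
          "poly_rel g p' q'" "a = poly p' x" "b' = poly q' y" by (auto simp: h_def)
        have "poly (q - q') y = 0"
          by (rule y[OF poly_rel_diff[OF g *(1,4)]]) (use * in simp)
        then show "b = b'" using * by simp
      qed
      fix a b c d assume "(a, b) \<in> h \<and> (c, d) \<in> h"
      then obtain p q p' q' where *: "poly_rel g p q" "a = poly p x" "b = poly q y"
          "poly_rel g p' q'" "c = poly p' x" "d = poly q' y" by (auto simp: h_def)
      show "(a + c, b + d) \<in> h" by (rule hI[OF poly_rel_add[OF g *(1,4)]]) (use * in simp_all)
      show "(a * c, b * d) \<in> h" by (rule hI[OF poly_rel_mult[OF g *(1,4)]]) (use * in simp_all)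
    qed
  qed
qed

lemma partial_embedding_Union:
  assumes "C \<noteq> {}" "subset.chain (Collect partial_embedding) C"
  shows "partial_embedding (\<Union>C)"
proof -
  \<comment> \<open>Any two pairs lie in a common member of the chain, which reduces each closure
    condition to that member.\<close>
  have *: "\<exists>g\<in>C. u \<in> g \<and> v \<in> g \<and> partial_embedding g" if "u \<in> \<Union>C" "v \<in> \<Union>C" for u v
  proof -
    from that obtain g h where gh: "g \<in> C" "u \<in> g" "h \<in> C" "v \<in> h" by blast
    with assms(2) have "g \<subseteq> h \<or> h \<subseteq> g" "partial_embedding g" "partial_embedding h"
      by (auto simp: subset_chain_def)
    with gh show ?thesis by blast
  qed
  show ?thesis
    unfolding partial_embedding_def
  proof (intro conjI allI impI ballI)
    show "single_valued (\<Union>C)"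
      using * partial_embeddingD(4) by (intro single_valuedI) metis
    fix c :: qbar assume c: "c \<in> \<rat>"
    obtain g where "g \<in> C" using assms(1) by blast
    with assms(2) have "(c, c) \<in> g" by (intro partial_embeddingD(1) c) (auto simp: subset_chain_def)
    with \<open>g \<in> C\<close> show "(c, c) \<in> \<Union>C" by blast
  next
    fix a b c d assume "(a, b) \<in> \<Union>C \<and> (c, d) \<in> \<Union>C"
    then obtain g where g: "g \<in> C" "(a, b) \<in> g" "(c, d) \<in> g" "partial_embedding g"
      using *[of "(a, b)" "(c, d)"] by blast
    then show "(a + c, b + d) \<in> \<Union>C" "(a * c, b * d) \<in> \<Union>C"
      using partial_embeddingD(2,3)[OF g(4)] by blast+
  qed
qed

text \<open>A maximal extension is total, since otherwise an element could be adjoined. As a map it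
  is injective because nonzero elements are invertible, and surjective because it permutes the
  finitely many roots of every nonzero rational polynomial.\<close>

lemma partial_embedding_extends:
  assumes g: "partial_embedding g"
  obtains \<tau> where "\<tau> \<in> absGal \<rat>" "\<And>a b. (a, b) \<in> g \<Longrightarrow> \<tau> a = b"
proof -
  define A where "A = {h. partial_embedding h \<and> g \<subseteq> h}"
  have "\<exists>M\<in>A. \<forall>Y\<in>A. M \<subseteq> Y \<longrightarrow> Y = M"
  proof (rule subset_Zorn_nonempty)
    fix C assume C: "C \<noteq> {}" "subset.chain A C"
    then have "subset.chain (Collect partial_embedding) C" by (auto simp: subset_chain_def A_def)
    then have "partial_embedding (\<Union>C)" by (rule partial_embedding_Union[OF C(1)])
    moreover have "g \<subseteq> h" if "h \<in> C" for h using C(2) that by (auto simp: subset_chain_def A_def)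
    then have "g \<subseteq> \<Union>C" using C(1) by blast
    ultimately show "\<Union>C \<in> A" by (simp add: A_def)
  qed (use g in \<open>auto simp: A_def\<close>)
  then obtain M where M: "partial_embedding M" "g \<subseteq> M"
    and max: "\<And>h. partial_embedding h \<Longrightarrow> M \<subseteq> h \<Longrightarrow> h = M" by (auto simp: A_def)
  note MD = partial_embeddingD[OF M(1)]
  have "\<exists>y. (x, y) \<in> M" for x
    using partial_embedding_adjoin[OF M(1), of x] max by metis
  then obtain \<tau> where \<tau>: "\<And>x. (x, \<tau> x) \<in> M" by metis
  have \<tau>I: "\<tau> a = b" if "(a, b) \<in> M" for a b using MD(4)[OF \<tau> that] .
  have add: "\<tau> (a + b) = \<tau> a + \<tau> b" and mult: "\<tau> (a * b) = \<tau> a * \<tau> b" for a b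
    using MD(2,3)[OF \<tau> \<tau>] by (auto intro: \<tau>I)
  have rat: "\<tau> c = c" if "c \<in> \<rat>" for c using MD(1)[OF that] by (rule \<tau>I)
  have "inj \<tau>"
  proof (rule injI, rule ccontr)
    fix a b assume "\<tau> a = \<tau> b" "a \<noteq> b"
    have "\<tau> (a - b) = \<tau> a - \<tau> b" using add[of "a - b" b] by simp
    then have "\<tau> (a - b) = 0" using \<open>\<tau> a = \<tau> b\<close> by simp
    then have "\<tau> ((a - b) * inverse (a - b)) = 0" by (simp add: mult)
    with \<open>a \<noteq> b\<close> rat[of 1] show False by simp
  qed
  moreover have "surj \<tau>"
  proof -
    have "y \<in> range \<tau>" for y
    proof -
      obtain p where p: "p \<noteq> 0" "\<And>i. Polynomial.coeff p i \<in> \<rat>" "poly p y = 0"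
        by (rule qbar_algebraic[of y]) blast
      have poly: "poly p (\<tau> x) = \<tau> (poly p x)" if "\<And>i. Polynomial.coeff p i \<in> \<rat>" for p x
        using that
      proof (induction p)
        case 0
        show ?case using rat[of 0] by simp
      next
        case (pCons c p)
        have "c \<in> \<rat>" "\<And>i. Polynomial.coeff p i \<in> \<rat>"
          using pCons.prems[of 0] pCons.prems[of "Suc _"] by simp_all
        then show ?case using pCons.IH by (simp add: add mult rat)
      qed
      let ?R = "{x. poly p x = 0}"
      have "\<tau> ` ?R \<subseteq> ?R" using poly[OF p(2)] rat[of 0] by auto
      moreover have "finite ?R" using p(1) by (rule poly_roots_finite)
      ultimately have "\<tau> ` ?R = ?R"
        using inj_on_subset[OF \<open>inj \<tau>\<close>] by (intro endo_inj_surj) auto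
      with p(3) show ?thesis by blast
    qed
    then show ?thesis by blast
  qed
  ultimately have "\<tau> \<in> absGal \<rat>" using add mult rat by (simp add: absGal_iff bij_def)
  moreover have "\<tau> a = b" if "(a, b) \<in> g" for a b using that M(2) by (intro \<tau>I) blast
  ultimately show thesis by (rule that)
qed

section \<open>Galois groups of finite extensions\<close>

lemma Gal_iff:
  "\<sigma> \<in> carrier (Gal L F) \<longleftrightarrow> \<sigma> \<in> Bij L \<and>
     (\<forall>x\<in>L. \<forall>y\<in>L. \<sigma> (x + y) = \<sigma> x + \<sigma> y \<and> \<sigma> (x * y) = \<sigma> x * \<sigma> y) \<and> (\<forall>x\<in>F. \<sigma> x = x)"
  by (simp add: Gal_def)

text \<open>The graph of \<sigma> on L is a partial embedding, so an extension exists and the choice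
  in \<open>gal_lift\<close> has the intended properties.\<close>

lemma gal_lift:
  assumes L: "subfield L Qbar" and M: "subfield M Qbar" "M \<subseteq> L" and \<sigma>: "\<sigma> \<in> carrier (Gal L M)"
  shows "gal_lift L \<sigma> \<in> absGal M" "\<And>x. x \<in> L \<Longrightarrow> gal_lift L \<sigma> x = \<sigma> x" "gal_lift L \<sigma> ` L = L"
proof -
  have "partial_embedding {(x, \<sigma> x) | x. x \<in> L}"
    using \<sigma> subfield_Rats[OF M(1)] M(2) subfield_Qbar_closed[OF L]
    unfolding partial_embedding_def Gal_iff by (auto simp: single_valued_def)
  then obtain \<tau> where "\<tau> \<in> absGal \<rat>" "\<And>a b. (a, b) \<in> {(x, \<sigma> x) | x. x \<in> L} \<Longrightarrow> \<tau> a = b"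
    by (rule partial_embedding_extends) blast
  then have "\<exists>\<tau>. \<tau> \<in> absGal \<rat> \<and> (\<forall>x\<in>L. \<tau> x = \<sigma> x)" by blast
  from someI_ex[OF this] have *: "gal_lift L \<sigma> \<in> absGal \<rat>" "\<forall>x\<in>L. gal_lift L \<sigma> x = \<sigma> x"
    unfolding gal_lift_def by auto
  show 1: "\<And>x. x \<in> L \<Longrightarrow> gal_lift L \<sigma> x = \<sigma> x" using *(2) by blast
  show "gal_lift L \<sigma> \<in> absGal M"
    using *(1) 1 \<sigma> M(2) unfolding absGal_iff Gal_iff by auto
  have "\<sigma> ` L = L" using \<sigma> by (simp add: Gal_iff Bij_def bij_betw_def)
  then show "gal_lift L \<sigma> ` L = L" using 1 by (simp cong: image_cong)
qed

lemma Gal_simps: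
  assumes "\<sigma> \<in> carrier (Gal L F)" "\<tau> \<in> carrier (Gal L F)"
  shows "\<sigma> \<otimes>\<^bsub>Gal L F\<^esub> \<tau> = compose L \<sigma> \<tau>" "\<one>\<^bsub>Gal L F\<^esub> = (\<lambda>x\<in>L. x)"
  using assms by (simp_all add: Gal_def BijGroup_def)

lemma group_Gal:
  assumes "subfield L Qbar" "F \<subseteq> L"
  shows "group (Gal L F)"
proof -
  interpret group "BijGroup L" by (rule group_BijGroup)
  note cl = subfield_Qbar_closed[OF assms(1)]
  have "subgroup (carrier (Gal L F)) (BijGroup L)"
  proof (rule subgroupI)
    show "carrier (Gal L F) \<subseteq> carrier (BijGroup L)" by (auto simp: Gal_iff BijGroup_def)
    have "(\<lambda>x\<in>L. x) \<in> carrier (Gal L F)"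
      using assms(2) cl(3,4) by (auto simp: Gal_iff id_Bij)
    then show "carrier (Gal L F) \<noteq> {}" by blast
    fix \<sigma> assume \<sigma>: "\<sigma> \<in> carrier (Gal L F)"
    then have B: "\<sigma> \<in> Bij L" by (simp add: Gal_iff)
    show "inv\<^bsub>BijGroup L\<^esub> \<sigma> \<in> carrier (Gal L F)"
      unfolding inv_BijGroup[OF B] Gal_iff
    proof (intro conjI ballI)
      show "restrict (inv_into L \<sigma>) L \<in> Bij L" by (rule restrict_inv_into_Bij[OF B])
      fix x assume x: "x \<in> L"
      fix y assume y: "y \<in> L"
      show "restrict (inv_into L \<sigma>) L (x + y) = restrict (inv_into L \<sigma>) L x + restrict (inv_into L \<sigma>) L y"
        using Bij_inv_into_lemma[of L \<sigma> "(+)" x y] \<sigma> B x y cl(3) by (simp add: Gal_iff)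
      show "restrict (inv_into L \<sigma>) L (x * y) = restrict (inv_into L \<sigma>) L x * restrict (inv_into L \<sigma>) L y"
        using Bij_inv_into_lemma[of L \<sigma> "(*)" x y] \<sigma> B x y cl(4) by (simp add: Gal_iff)
    next
      fix x assume "x \<in> F"
      then show "restrict (inv_into L \<sigma>) L x = x"
        using \<sigma> B assms(2) inv_into_f_f[of \<sigma> L x] by (auto simp: Gal_iff Bij_def bij_betw_def)
    qed
    fix \<tau> assume \<tau>: "\<tau> \<in> carrier (Gal L F)"
    have "\<sigma> \<otimes>\<^bsub>BijGroup L\<^esub> \<tau> = compose L \<sigma> \<tau>" using \<sigma> \<tau> by (simp add: BijGroup_def Gal_iff)
    moreover have "\<tau> \<in> L \<rightarrow> L" using \<tau> Bij_imp_funcset by (auto simp: Gal_iff)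
    ultimately show "\<sigma> \<otimes>\<^bsub>BijGroup L\<^esub> \<tau> \<in> carrier (Gal L F)"
      using \<sigma> \<tau> cl(3,4) assms(2) by (auto simp: Gal_iff compose_Bij compose_eq Pi_iff)
  qed
  then have "group ((BijGroup L)\<lparr>carrier := carrier (Gal L F)\<rparr>)"
    by (rule subgroup.subgroup_is_group) (rule group_axioms)
  then show ?thesis by (simp add: Gal_def)
qed

text \<open>An automorphism is determined by the images of a finite spanning set of L over the
  rationals, and each of these images lies among the roots of a rational polynomial.\<close>

lemma finite_Gal:
  assumes L: "finite_extension \<rat> L" and M: "subfield M Qbar" "M \<subseteq> L"
  shows "finite (carrier (Gal L M))"
proof -
  interpret ring Qbar by (rule Qbar_ring)
  have subf: "subfield \<rat> Qbar" "subfield L Qbar" using L by (auto simp: finite_extension_def)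
  obtain n where "dimension n \<rat> L" using L by (auto simp: finite_extension_def finite_dimension_def)
  then obtain Us where Us: "Span \<rat> Us = L" using exists_base[OF subf(1)] by blast
  have Us_L: "set Us \<subseteq> L" using Span_base_incl[OF subf(1), of Us] Us by simp
  have "\<exists>R. finite R \<and> (\<forall>\<sigma>\<in>carrier (Gal L M). \<sigma> u \<in> R)" if u: "u \<in> L" for u
  proof -
    obtain p where p: "p \<noteq> 0" "\<And>i. Polynomial.coeff p i \<in> \<rat>" "poly p u = 0"
      by (rule qbar_algebraic[of u]) blast
    have "poly p (\<tau> x) = \<tau> (poly p x)" if "\<And>i. Polynomial.coeff p i \<in> \<rat>" "\<tau> \<in> absGal \<rat>" for p x \<tau>
      using that(1)
    proof (induction p)
      case 0
      show ?case using absGalD(5)[OF that(2)] by simp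
    next
      case (pCons c p)
      have "c \<in> \<rat>" "\<And>i. Polynomial.coeff p i \<in> \<rat>"
        using pCons.prems[of 0] pCons.prems[of "Suc _"] by simp_all
      then show ?case using pCons.IH absGalD(2-4)[OF that(2)] by simp
    qed
    then have "poly p (\<sigma> u) = 0" if "\<sigma> \<in> carrier (Gal L M)" for \<sigma>
      using gal_lift(1,2)[OF subf(2) M that] absGal_mono[OF _ subfield_Rats[OF M(1)]] p u
        absGalD(5) by metis
    then show ?thesis using poly_roots_finite[OF p(1)] by blast
  qed
  then obtain R where R: "\<And>u. u \<in> L \<Longrightarrow> finite (R u)"
    "\<And>u \<sigma>. u \<in> L \<Longrightarrow> \<sigma> \<in> carrier (Gal L M) \<Longrightarrow> \<sigma> u \<in> R u" by metis
  have "inj_on (\<lambda>\<sigma>. restrict \<sigma> (set Us)) (carrier (Gal L M))"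
  proof (rule inj_onI)
    fix \<sigma> \<sigma>' assume \<sigma>: "\<sigma> \<in> carrier (Gal L M)" "\<sigma>' \<in> carrier (Gal L M)"
      and eq: "restrict \<sigma> (set Us) = restrict \<sigma>' (set Us)"
    define \<tau> \<tau>' where "\<tau> = gal_lift L \<sigma>" and "\<tau>' = gal_lift L \<sigma>'"
    have \<tau>: "\<tau> \<in> absGal \<rat>" "\<tau>' \<in> absGal \<rat>"
      using gal_lift(1)[OF subf(2) M] \<sigma> absGal_mono[OF _ subfield_Rats[OF M(1)]] by (auto simp: \<tau>_def \<tau>'_def)
    have "\<tau> u = \<tau>' u" if "u \<in> set Us" for u
      using gal_lift(2)[OF subf(2) M] \<sigma> that Us_L eq unfolding \<tau>_def \<tau>'_def by (metis restrict_apply' subsetD)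
    \<comment> \<open>\<open>Span\<close> adds rational multiples of the entries one at a time, and
      both lifts are linear over the rationals.\<close>
    then have "\<tau> x = \<tau>' x" if "x \<in> Span \<rat> Us" for x
      using that
    proof (induction Us arbitrary: x)
      case Nil
      then show ?case using absGalD(5)[OF \<tau>(1)] absGalD(5)[OF \<tau>(2)] by simp
    next
      case (Cons u Us)
      then obtain k v where "k \<in> \<rat>" "v \<in> Span \<rat> Us" "x = k * u + v"
        using line_extension_mem_iff[of x \<rat> u "Span \<rat> Us"] by auto
      with Cons show ?case
        by (simp add: absGalD(2,3)[OF \<tau>(1)] absGalD(2,3)[OF \<tau>(2)] absGalD(4)[OF \<tau>(1)] absGalD(4)[OF \<tau>(2)])
    qed
    then have "\<sigma> x = \<sigma>' x" if "x \<in> L" for x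
      using that gal_lift(2)[OF subf(2) M] \<sigma> Us unfolding \<tau>_def \<tau>'_def by metis
    moreover have "\<sigma> \<in> extensional L" "\<sigma>' \<in> extensional L" using \<sigma> by (auto simp: Gal_iff Bij_def)
    ultimately show "\<sigma> = \<sigma>'" by (intro extensionalityI) auto
  qed
  moreover have "(\<lambda>\<sigma>. restrict \<sigma> (set Us)) ` carrier (Gal L M) \<subseteq> PiE (set Us) R"
    using R(2) Us_L by auto
  moreover have "finite (PiE (set Us) R)" using R(1) Us_L by (intro finite_PiE) auto
  ultimately show ?thesis by (meson finite_imageD finite_subset)
qed

text \<open>The map fixes the rationals and sends the square root \<open>s\<close> to a square root
  of the same number, hence to \<open>s\<close> or \<open>- s\<close>. In the second case the
  coefficient of \<open>s\<close> is negated in the preimage.\<close>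

lemma imaginary_quadratic_endo_surj:
  assumes M: "imaginary_quadratic M" "subfield M Qbar"
    and h: "\<And>x y. x \<in> M \<Longrightarrow> y \<in> M \<Longrightarrow> h (x + y) = h x + h y"
      "\<And>x y. x \<in> M \<Longrightarrow> y \<in> M \<Longrightarrow> h (x * y) = h x * h y" "h 1 = 1"
  shows "M \<subseteq> h ` M"
proof -
  obtain d s where s: "s * s = - of_nat d" "M = {a + b * s | a b. a \<in> \<rat> \<and> b \<in> \<rat>}"
    using M(1) by (auto simp: imaginary_quadratic_def)
  note cl = subfield_Qbar_closed[OF M(2)]
  have ratM: "c \<in> M" if "c \<in> \<rat>" for c using subfield_Rats[OF M(2)] that by blast
  have h0: "h 0 = 0" using h(1)[of 0 0] cl(1) by simp
  have neg: "h (- x) = - h x" if "x \<in> M" for x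
    using h(1)[OF that cl(5)[OF that]] h0 by (simp add: eq_neg_iff_add_eq_0 add.commute)
  have nat: "h (of_nat n) = of_nat n" for n
    by (induction n) (use h0 h(1,3) cl(2) ratM in auto)
  have int: "h (of_int n) = of_int n" for n
    by (cases n) (use nat neg ratM in \<open>auto simp del: of_nat_Suc\<close>)
  have rat: "h c = c" if "c \<in> \<rat>" for c
  proof -
    from that obtain a b where ab: "b > 0" "c = of_int a / of_int b"
      by (elim Rats_cases') blast
    then have b: "(of_int b :: qbar) \<noteq> 0" and cb: "c * of_int b = of_int a" by simp_all
    have "h (c * of_int b) = h c * h (of_int b)" by (intro h(2) ratM that) simp
    then have "h c * of_int b = c * of_int b" unfolding cb int by (rule sym)
    with b show ?thesis by (metis mult_right_cancel)
  qed
  have "\<exists>a b. s = a + b * s \<and> a \<in> \<rat> \<and> b \<in> \<rat>"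
    by (rule exI[of _ 0], rule exI[of _ 1]) simp
  then have sM: "s \<in> M" unfolding s(2) by (rule CollectI)
  have "h s * h s = s * s" using h(2)[OF sM sM] s(1) neg[of "of_nat d"] ratM nat by simp
  then have hs: "h s = s \<or> h s = - s" by (simp add: square_eq_iff)
  show ?thesis
  proof
    fix x assume "x \<in> M"
    then obtain a b where x: "x = a + b * s" "a \<in> \<rat>" "b \<in> \<rat>" using s(2) by auto
    define b' where "b' = (if h s = s then b else - b)"
    have "b' \<in> \<rat>" using x(3) by (simp add: b'_def)
    then have "h (a + b' * s) = a + b' * h s"
      using h(1)[of a "b' * s"] h(2)[of b' s] cl(4) sM ratM x(2) rat by simp
    also have "\<dots> = x" using hs x(1) by (auto simp: b'_def)
    finally show "x \<in> h ` M" using s(2) x(2) \<open>b' \<in> \<rat>\<close> by blast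
  qed
qed


section \<open>Linear maps and c-representations\<close>

lemma (in abelian_monoid) finsum_closed_Pi: "(\<And>x. x \<in> A \<Longrightarrow> f x \<in> carrier G) \<Longrightarrow> finsum G f A \<in> carrier G"
  by (intro finsum_closed) auto

lemma (in abelian_monoid) finsum_swap:
  assumes "finite A" "finite B" "\<And>a b. a \<in> A \<Longrightarrow> b \<in> B \<Longrightarrow> h a b \<in> carrier G"
  shows "(\<Oplus>a\<in>A. \<Oplus>b\<in>B. h a b) = (\<Oplus>b\<in>B. \<Oplus>a\<in>A. h a b)"
  using assms(1,3)
proof (induction A)
  case empty
  show ?case by simp
next
  case (insert a A)
  have "(\<Oplus>a\<in>insert a A. \<Oplus>b\<in>B. h a b) = (\<Oplus>b\<in>B. h a b) \<oplus> (\<Oplus>a\<in>A. \<Oplus>b\<in>B. h a b)"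
    using insert by (intro finsum_insert finsum_closed_Pi) (auto intro!: finsum_closed_Pi)
  also have "\<dots> = (\<Oplus>b\<in>B. h a b) \<oplus> (\<Oplus>b\<in>B. \<Oplus>a\<in>A. h a b)"
    using insert by simp
  also have "\<dots> = (\<Oplus>b\<in>B. h a b \<oplus> (\<Oplus>a\<in>A. h a b))"
    using insert by (intro finsum_addf[symmetric]) (auto intro!: finsum_closed_Pi)
  also have "\<dots> = (\<Oplus>b\<in>B. \<Oplus>a\<in>insert a A. h a b)"
    using insert by (intro finsum_cong' refl finsum_insert[symmetric])
      (auto intro!: finsum_closed_Pi)
  finally show ?case .
qed

text \<open>Left translation permutes the group. This is the substitution behind the convolution
  sums of the group algebra.\<close>

lemma (in abelian_monoid) finsum_translate:
  assumes G': "group H" and \<tau>: "\<tau> \<in> carrier H" and f: "\<And>\<sigma>. \<sigma> \<in> carrier H \<Longrightarrow> f \<sigma> \<in> carrier G"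
  shows "(\<Oplus>\<sigma>\<in>carrier H. f \<sigma>) = (\<Oplus>\<omega>\<in>carrier H. f (\<tau> \<otimes>\<^bsub>H\<^esub> \<omega>))"
  using finsum_reindex[of f "\<lambda>\<omega>. \<tau> \<otimes>\<^bsub>H\<^esub> \<omega>" "carrier H"] f group.surj_const_mult[OF G' \<tau>]
    group.inj_on_cmult[OF G' \<tau>] by auto

lemma (in module) smult_finsum_l:
  assumes "finite A" "\<And>i. i \<in> A \<Longrightarrow> a i \<in> carrier R" "x \<in> carrier M"
  shows "(\<Oplus>\<^bsub>R\<^esub>i\<in>A. a i) \<odot>\<^bsub>M\<^esub> x = (\<Oplus>\<^bsub>M\<^esub>i\<in>A. a i \<odot>\<^bsub>M\<^esub> x)"
  using assms(1,2)
proof (induction A)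
  case empty
  then show ?case using assms(3) by (simp add: smult_l_null)
next
  case (insert i A)
  have "(\<Oplus>\<^bsub>R\<^esub>i\<in>insert i A. a i) \<odot>\<^bsub>M\<^esub> x = (a i \<oplus>\<^bsub>R\<^esub> (\<Oplus>\<^bsub>R\<^esub>i\<in>A. a i)) \<odot>\<^bsub>M\<^esub> x"
    using insert by (subst R.finsum_insert) auto
  also have "\<dots> = a i \<odot>\<^bsub>M\<^esub> x \<oplus>\<^bsub>M\<^esub> (\<Oplus>\<^bsub>R\<^esub>i\<in>A. a i) \<odot>\<^bsub>M\<^esub> x"
    using insert assms(3) by (intro smult_l_distr R.finsum_closed_Pi) auto
  also have "\<dots> = (\<Oplus>\<^bsub>M\<^esub>i\<in>insert i A. a i \<odot>\<^bsub>M\<^esub> x)"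
    using insert assms(3) by (subst M.finsum_insert) auto
  finally show ?case .
qed

section \<open>Linear maps and transport of structure\<close>

lemma linear_mapsD:
  assumes "f \<in> linear_maps k V W"
  shows "v \<in> carrier V \<Longrightarrow> f v \<in> carrier W"
    "u \<in> carrier V \<Longrightarrow> v \<in> carrier V \<Longrightarrow> f (u \<oplus>\<^bsub>V\<^esub> v) = f u \<oplus>\<^bsub>W\<^esub> f v"
    "a \<in> carrier k \<Longrightarrow> v \<in> carrier V \<Longrightarrow> f (a \<odot>\<^bsub>V\<^esub> v) = a \<odot>\<^bsub>W\<^esub> f v"
  using assms by (auto simp: linear_maps_def)

lemma linear_map_zero:
  assumes "module k V" "module k W" "f \<in> linear_maps k V W"
  shows "f \<zero>\<^bsub>V\<^esub> = \<zero>\<^bsub>W\<^esub>"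
proof -
  interpret V: module k V by fact
  interpret W: module k W by fact
  have "f (\<zero>\<^bsub>k\<^esub> \<odot>\<^bsub>V\<^esub> \<zero>\<^bsub>V\<^esub>) = \<zero>\<^bsub>k\<^esub> \<odot>\<^bsub>W\<^esub> f \<zero>\<^bsub>V\<^esub>"
    by (intro linear_mapsD(3)[OF assms(3)]) auto
  then show ?thesis using linear_mapsD(1)[OF assms(3)] by (simp add: V.smult_l_null W.smult_l_null)
qed

lemma linear_map_finsum:
  assumes "module k V" "module k W" "f \<in> linear_maps k V W" "finite A" "\<And>i. i \<in> A \<Longrightarrow> g i \<in> carrier V"
  shows "f (\<Oplus>\<^bsub>V\<^esub>i\<in>A. g i) = (\<Oplus>\<^bsub>W\<^esub>i\<in>A. f (g i))"
proof -
  interpret V: module k V by fact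
  interpret W: module k W by fact
  note f = linear_mapsD[OF assms(3)]
  show ?thesis
    using assms(4,5)
  proof (induction A)
    case empty
    show ?case using linear_map_zero[OF assms(1-3)] by simp
  next
    case (insert i A)
    have "f (\<Oplus>\<^bsub>V\<^esub>i\<in>insert i A. g i) = f (g i \<oplus>\<^bsub>V\<^esub> (\<Oplus>\<^bsub>V\<^esub>i\<in>A. g i))"
      using insert by (subst V.M.finsum_insert) auto
    also have "\<dots> = f (g i) \<oplus>\<^bsub>W\<^esub> (\<Oplus>\<^bsub>W\<^esub>i\<in>A. f (g i))"
      using insert f(2)[of "g i" "\<Oplus>\<^bsub>V\<^esub>i\<in>A. g i"] by (simp add: V.M.finsum_closed_Pi)
    also have "\<dots> = (\<Oplus>\<^bsub>W\<^esub>i\<in>insert i A. f (g i))"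
      using insert f(1) by (subst W.M.finsum_insert) auto
    finally show ?case .
  qed
qed

text \<open>Each identity in W is the image of one in V, since \<open>f\<close> is onto.
  Compatibility with zero is a separate assumption because W is not yet known to be a group. In this
  way the module axioms for the space T of endomorphisms come from R.\<close>

lemma module_transfer:
  assumes V: "module k V" and f: "f \<in> linear_maps k V W" "f ` carrier V = carrier W" "f \<zero>\<^bsub>V\<^esub> = \<zero>\<^bsub>W\<^esub>"
  shows "module k W"
proof -
  interpret V: module k V by fact
  note fD = linear_mapsD[OF f(1)]
  have pre: "\<exists>v\<in>carrier V. w = f v" if "w \<in> carrier W" for w using f(2) that by blast
  have ag: "abelian_group W"
  proof (rule abelian_groupI)
    show "\<zero>\<^bsub>W\<^esub> \<in> carrier W" using f(3) fD(1) V.M.zero_closed by metis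
    fix x assume "x \<in> carrier W"
    then obtain x' where x: "x' \<in> carrier V" "x = f x'" using pre by blast
    show "\<zero>\<^bsub>W\<^esub> \<oplus>\<^bsub>W\<^esub> x = x" using x by (simp add: f(3)[symmetric] fD(2)[symmetric])
    have "f (\<ominus>\<^bsub>V\<^esub> x') \<oplus>\<^bsub>W\<^esub> x = \<zero>\<^bsub>W\<^esub>"
      using x by (simp add: f(3)[symmetric] fD(2)[symmetric] V.M.l_neg)
    then show "\<exists>y\<in>carrier W. y \<oplus>\<^bsub>W\<^esub> x = \<zero>\<^bsub>W\<^esub>" using fD(1) x(1) by blast
    fix y assume "y \<in> carrier W"
    then obtain y' where y: "y' \<in> carrier V" "y = f y'" using pre by blast
    show "x \<oplus>\<^bsub>W\<^esub> y \<in> carrier W" using x y by (simp add: fD(2)[symmetric] fD(1))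
    show "x \<oplus>\<^bsub>W\<^esub> y = y \<oplus>\<^bsub>W\<^esub> x" using x y by (simp add: fD(2)[symmetric] V.M.a_comm)
    fix z assume "z \<in> carrier W"
    then obtain z' where z: "z' \<in> carrier V" "z = f z'" using pre by blast
    show "x \<oplus>\<^bsub>W\<^esub> y \<oplus>\<^bsub>W\<^esub> z = x \<oplus>\<^bsub>W\<^esub> (y \<oplus>\<^bsub>W\<^esub> z)"
      using x y z by (simp add: fD(2)[symmetric] V.M.a_assoc)
  qed
  show ?thesis
  proof (rule moduleI[OF V.R.is_cring ag])
    fix a x assume a: "a \<in> carrier k" and "x \<in> carrier W"
    then obtain x' where x: "x' \<in> carrier V" "x = f x'" using pre by blast
    show "a \<odot>\<^bsub>W\<^esub> x \<in> carrier W" using a x by (simp add: fD(3)[symmetric] fD(1))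
    fix b assume b: "b \<in> carrier k"
    show "(a \<oplus>\<^bsub>k\<^esub> b) \<odot>\<^bsub>W\<^esub> x = a \<odot>\<^bsub>W\<^esub> x \<oplus>\<^bsub>W\<^esub> b \<odot>\<^bsub>W\<^esub> x"
      using a b x by (simp add: fD(2,3)[symmetric] V.smult_l_distr)
    show "(a \<otimes>\<^bsub>k\<^esub> b) \<odot>\<^bsub>W\<^esub> x = a \<odot>\<^bsub>W\<^esub> (b \<odot>\<^bsub>W\<^esub> x)"
      using a b x by (simp add: fD(3)[symmetric] V.smult_assoc1)
  next
    fix a x y assume a: "a \<in> carrier k" and "x \<in> carrier W" "y \<in> carrier W"
    then obtain x' y' where x: "x' \<in> carrier V" "x = f x'" "y' \<in> carrier V" "y = f y'" using pre by blast
    show "a \<odot>\<^bsub>W\<^esub> (x \<oplus>\<^bsub>W\<^esub> y) = a \<odot>\<^bsub>W\<^esub> x \<oplus>\<^bsub>W\<^esub> a \<odot>\<^bsub>W\<^esub> y"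
      using a x by (simp add: fD(2,3)[symmetric] V.smult_r_distr)
  next
    fix x assume "x \<in> carrier W"
    then obtain x' where x: "x' \<in> carrier V" "x = f x'" using pre by blast
    show "\<one>\<^bsub>k\<^esub> \<odot>\<^bsub>W\<^esub> x = x" using x by (simp add: fD(3)[symmetric])
  qed
qed

text \<open>The linear combinations of B form a set closed under sums and multiples, so closure
  arguments suffice for finite dimension. Elements of a spanning set such as
  \<open>{i\<^sub>1, i\<^sub>2}\<close> may then coincide without a case distinction.\<close>

lemma findim_spaceI:
  assumes k: "field k" and V: "module k V" and B: "finite B" "B \<subseteq> carrier V"
    and gen: "\<And>S. B \<subseteq> S \<Longrightarrow> S \<subseteq> carrier V \<Longrightarrow> \<zero>\<^bsub>V\<^esub> \<in> S \<Longrightarrow>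
      (\<And>u v. u \<in> S \<Longrightarrow> v \<in> S \<Longrightarrow> u \<oplus>\<^bsub>V\<^esub> v \<in> S) \<Longrightarrow>
      (\<And>a v. a \<in> carrier k \<Longrightarrow> v \<in> S \<Longrightarrow> a \<odot>\<^bsub>V\<^esub> v \<in> S) \<Longrightarrow> carrier V \<subseteq> S"
  shows "findim_space k V"
proof -
  interpret V: module k V by fact
  define S where "S = {(\<Oplus>\<^bsub>V\<^esub>b\<in>B. a b \<odot>\<^bsub>V\<^esub> b) | a. a \<in> B \<rightarrow> carrier k}"
  have "carrier V \<subseteq> S"
  proof (rule gen)
    show "S \<subseteq> carrier V" using B(2) by (auto simp: S_def Pi_iff intro!: V.M.finsum_closed_Pi)
    have "(\<Oplus>\<^bsub>V\<^esub>b\<in>B. \<zero>\<^bsub>k\<^esub> \<odot>\<^bsub>V\<^esub> b) = (\<Oplus>\<^bsub>V\<^esub>b\<in>B. \<zero>\<^bsub>V\<^esub>)"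
      using B(2) by (intro V.M.finsum_cong') (auto simp: V.smult_l_null subset_iff)
    then show "\<zero>\<^bsub>V\<^esub> \<in> S"
      unfolding S_def by (intro CollectI exI[of _ "\<lambda>_. \<zero>\<^bsub>k\<^esub>"]) auto
    show "B \<subseteq> S"
    proof
      fix b assume b: "b \<in> B"
      define a where "a b' = (if b' = b then \<one>\<^bsub>k\<^esub> else \<zero>\<^bsub>k\<^esub>)" for b'
      have "(\<Oplus>\<^bsub>V\<^esub>b'\<in>B. a b' \<odot>\<^bsub>V\<^esub> b') = (\<Oplus>\<^bsub>V\<^esub>b'\<in>B. if b' = b then b' else \<zero>\<^bsub>V\<^esub>)"
        using B(2) by (intro V.M.finsum_cong') (auto simp: a_def V.smult_l_null subset_iff)
      also have "\<dots> = b" using b B by (intro V.M.add.finprod_singleton_swap) auto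
      finally show "b \<in> S" by (force simp: S_def a_def)
    qed
    fix u v assume "u \<in> S" "v \<in> S"
    then obtain a a' where a: "u = (\<Oplus>\<^bsub>V\<^esub>b\<in>B. a b \<odot>\<^bsub>V\<^esub> b)" "a \<in> B \<rightarrow> carrier k"
      and a': "v = (\<Oplus>\<^bsub>V\<^esub>b\<in>B. a' b \<odot>\<^bsub>V\<^esub> b)" "a' \<in> B \<rightarrow> carrier k" by (auto simp: S_def)
    have "u \<oplus>\<^bsub>V\<^esub> v = (\<Oplus>\<^bsub>V\<^esub>b\<in>B. a b \<odot>\<^bsub>V\<^esub> b \<oplus>\<^bsub>V\<^esub> a' b \<odot>\<^bsub>V\<^esub> b)"
      unfolding a(1) a'(1) using a(2) a'(2) B(2) by (intro V.M.finsum_addf[symmetric]) (auto simp: Pi_iff)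
    also have "\<dots> = (\<Oplus>\<^bsub>V\<^esub>b\<in>B. (a b \<oplus>\<^bsub>k\<^esub> a' b) \<odot>\<^bsub>V\<^esub> b)"
      using a(2) a'(2) B(2) by (intro V.M.finsum_cong') (auto simp: Pi_iff V.smult_l_distr subset_iff)
    finally show "u \<oplus>\<^bsub>V\<^esub> v \<in> S"
      unfolding S_def using a(2) a'(2) by (intro CollectI exI[of _ "\<lambda>b. a b \<oplus>\<^bsub>k\<^esub> a' b"]) auto
  next
    fix c v assume c: "c \<in> carrier k" and "v \<in> S"
    then obtain a where a: "v = (\<Oplus>\<^bsub>V\<^esub>b\<in>B. a b \<odot>\<^bsub>V\<^esub> b)" "a \<in> B \<rightarrow> carrier k" by (auto simp: S_def)
    have "c \<odot>\<^bsub>V\<^esub> v = (\<Oplus>\<^bsub>V\<^esub>b\<in>B. c \<odot>\<^bsub>V\<^esub> (a b \<odot>\<^bsub>V\<^esub> b))"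
      unfolding a(1) using a(2) B c by (intro V.finsum_smult_ldistr) (auto simp: Pi_iff)
    also have "\<dots> = (\<Oplus>\<^bsub>V\<^esub>b\<in>B. (c \<otimes>\<^bsub>k\<^esub> a b) \<odot>\<^bsub>V\<^esub> b)"
      using a(2) B(2) c by (intro V.M.finsum_cong') (auto simp: Pi_iff V.smult_assoc1 subset_iff)
    finally show "c \<odot>\<^bsub>V\<^esub> v \<in> S"
      unfolding S_def using a(2) c by (intro CollectI exI[of _ "\<lambda>b. c \<otimes>\<^bsub>k\<^esub> a b"]) auto
  qed
  with k V B show ?thesis unfolding findim_space_def S_def by blast
qed

lemma findim_space_transfer:
  assumes V: "findim_space k V" and f: "f \<in> linear_maps k V W" "f ` carrier V = carrier W" "f \<zero>\<^bsub>V\<^esub> = \<zero>\<^bsub>W\<^esub>"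
  shows "findim_space k W"
proof -
  from V obtain B where k: "field k" and Vm: "module k V" and B: "finite B" "B \<subseteq> carrier V"
    and span: "\<And>v. v \<in> carrier V \<Longrightarrow> \<exists>a\<in>B \<rightarrow> carrier k. v = (\<Oplus>\<^bsub>V\<^esub>b\<in>B. a b \<odot>\<^bsub>V\<^esub> b)"
    by (auto simp: findim_space_def)
  have Wm: "module k W" by (rule module_transfer[OF Vm f])
  interpret V: module k V by fact
  interpret W: module k W by fact
  note fD = linear_mapsD[OF f(1)]
  show ?thesis
  proof (rule findim_spaceI[OF k Wm, of "f ` B"])
    show "finite (f ` B)" "f ` B \<subseteq> carrier W" using B fD(1) by auto
    fix S assume S: "f ` B \<subseteq> S" "S \<subseteq> carrier W" "\<zero>\<^bsub>W\<^esub> \<in> S"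
      "\<And>u v. u \<in> S \<Longrightarrow> v \<in> S \<Longrightarrow> u \<oplus>\<^bsub>W\<^esub> v \<in> S"
      "\<And>a v. a \<in> carrier k \<Longrightarrow> v \<in> S \<Longrightarrow> a \<odot>\<^bsub>W\<^esub> v \<in> S"
    show "carrier W \<subseteq> S"
    proof
      fix w assume "w \<in> carrier W"
      then obtain v where v: "v \<in> carrier V" "w = f v" using f(2) by blast
      obtain a where a: "a \<in> B \<rightarrow> carrier k" "v = (\<Oplus>\<^bsub>V\<^esub>b\<in>B. a b \<odot>\<^bsub>V\<^esub> b)" using span[OF v(1)] by blast
      have *: "(\<Oplus>\<^bsub>W\<^esub>b\<in>B'. f (a b \<odot>\<^bsub>V\<^esub> b)) \<in> S" if "B' \<subseteq> B" for B'
        using finite_subset[OF that B(1)] that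
      proof (induction B')
        case empty
        show ?case using S(3) by simp
      next
        case (insert b B')
        then have "f (a b \<odot>\<^bsub>V\<^esub> b) \<in> S" using a(1) B(2) S(1,5) by (auto simp: fD(3) Pi_iff subset_iff)
        moreover have "(\<Oplus>\<^bsub>W\<^esub>b\<in>insert b B'. f (a b \<odot>\<^bsub>V\<^esub> b)) =
            f (a b \<odot>\<^bsub>V\<^esub> b) \<oplus>\<^bsub>W\<^esub> (\<Oplus>\<^bsub>W\<^esub>b\<in>B'. f (a b \<odot>\<^bsub>V\<^esub> b))"
          using insert a(1) B(2) by (intro W.M.finsum_insert) (auto simp: Pi_iff subset_iff intro!: fD(1))
        ultimately show ?case using insert S(4) by simp
      qed
      have "w = (\<Oplus>\<^bsub>W\<^esub>b\<in>B. f (a b \<odot>\<^bsub>V\<^esub> b))"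
        unfolding v(2) a(2) using a(1) B by (intro linear_map_finsum[OF Vm Wm f(1)]) (auto simp: Pi_iff subset_iff)
      with *[of B] show "w \<in> S" by simp
    qed
  qed
qed

text \<open>An intertwining bijection carries the cocycle over unchanged. The representation on T is
  obtained in this way from R, so that the cancellation of the cocycle of V against that of its dual
  is never computed.\<close>

lemma c_rep_transfer:
  assumes V: "c_rep G k V \<rho> c"
    and f: "f \<in> linear_maps k V W" "bij_betw f (carrier V) (carrier W)" "f \<zero>\<^bsub>V\<^esub> = \<zero>\<^bsub>W\<^esub>"
    and eq: "\<And>\<sigma> v. \<sigma> \<in> carrier G \<Longrightarrow> v \<in> carrier V \<Longrightarrow> f (\<rho> \<sigma> v) = \<rho>' \<sigma> (f v)"
  shows "c_rep G k W \<rho>' c"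
proof -
  have img: "f ` carrier V = carrier W" using f(2) by (simp add: bij_betw_def)
  have V': "group G" "finite (carrier G)" "findim_space k V"
    "\<And>\<sigma>. \<sigma> \<in> carrier G \<Longrightarrow> \<rho> \<sigma> \<in> linear_maps k V V"
    "\<And>\<sigma>. \<sigma> \<in> carrier G \<Longrightarrow> bij_betw (\<rho> \<sigma>) (carrier V) (carrier V)"
    "\<And>v. v \<in> carrier V \<Longrightarrow> \<rho> \<one>\<^bsub>G\<^esub> v = v"
    "\<And>\<sigma> \<tau>. \<sigma> \<in> carrier G \<Longrightarrow> \<tau> \<in> carrier G \<Longrightarrow> c \<sigma> \<tau> \<in> carrier k - {\<zero>\<^bsub>k\<^esub>}"
    "\<And>\<sigma> \<tau> v. \<sigma> \<in> carrier G \<Longrightarrow> \<tau> \<in> carrier G \<Longrightarrow> v \<in> carrier V \<Longrightarrow>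
       \<rho> \<sigma> (\<rho> \<tau> v) = c \<sigma> \<tau> \<odot>\<^bsub>V\<^esub> \<rho> (\<sigma> \<otimes>\<^bsub>G\<^esub> \<tau>) v"
    using V by (simp_all add: c_rep_def)
  interpret G: group G by (rule V'(1))
  interpret V: module k V using V'(3) by (simp add: findim_space_def)
  note fD = linear_mapsD[OF f(1)]
  note \<rho>D = linear_mapsD[OF V'(4)]
  have pre: "\<exists>v\<in>carrier V. w = f v" if "w \<in> carrier W" for w using img that by blast
  have lin: "\<rho>' \<sigma> \<in> linear_maps k W W" if \<sigma>: "\<sigma> \<in> carrier G" for \<sigma>
    unfolding linear_maps_def
  proof (intro CollectI conjI ballI Pi_I)
    fix x assume "x \<in> carrier W"
    then obtain x' where x: "x' \<in> carrier V" "x = f x'" using pre by blast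
    show "\<rho>' \<sigma> x \<in> carrier W" using x \<sigma> by (simp add: eq[symmetric] fD(1) \<rho>D(1))
    fix y assume "y \<in> carrier W"
    then obtain y' where y: "y' \<in> carrier V" "y = f y'" using pre by blast
    show "\<rho>' \<sigma> (x \<oplus>\<^bsub>W\<^esub> y) = \<rho>' \<sigma> x \<oplus>\<^bsub>W\<^esub> \<rho>' \<sigma> y"
      using x y \<sigma> by (simp add: fD(2)[symmetric] eq[symmetric] \<rho>D(1)) (simp add: \<rho>D(2))
  next
    fix a x assume a: "a \<in> carrier k" and "x \<in> carrier W"
    then obtain x' where x: "x' \<in> carrier V" "x = f x'" using pre by blast
    show "\<rho>' \<sigma> (a \<odot>\<^bsub>W\<^esub> x) = a \<odot>\<^bsub>W\<^esub> \<rho>' \<sigma> x"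
      using x a \<sigma> by (simp add: fD(3)[symmetric] eq[symmetric] \<rho>D(1)) (simp add: \<rho>D(3))
  qed
  have bij: "bij_betw (\<rho>' \<sigma>) (carrier W) (carrier W)" if \<sigma>: "\<sigma> \<in> carrier G" for \<sigma>
  proof -
    \<comment> \<open>Bijectivity of \<open>\<rho>' \<sigma>\<close> is read off from
      \<open>\<rho>' \<sigma> \<circ> f = f \<circ> \<rho> \<sigma>\<close> on V.\<close>
    have "bij_betw (\<rho>' \<sigma> \<circ> f) (carrier V) (carrier W)"
    proof -
      have "bij_betw (f \<circ> \<rho> \<sigma>) (carrier V) (carrier W)" by (rule bij_betw_trans[OF V'(5)[OF \<sigma>] f(2)])
      then show ?thesis using eq[OF \<sigma>] by (subst bij_betw_cong[of _ _ "f \<circ> \<rho> \<sigma>"]) auto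
    qed
    then show ?thesis using bij_betw_comp_iff[OF f(2)] by blast
  qed
  have one: "\<rho>' \<one>\<^bsub>G\<^esub> w = w" if "w \<in> carrier W" for w
  proof -
    from pre[OF that] obtain v where "v \<in> carrier V" "w = f v" by blast
    then show ?thesis by (simp add: eq[symmetric] V'(6))
  qed
  have mult: "\<rho>' \<sigma> (\<rho>' \<tau> w) = c \<sigma> \<tau> \<odot>\<^bsub>W\<^esub> \<rho>' (\<sigma> \<otimes>\<^bsub>G\<^esub> \<tau>) w"
    if "\<sigma> \<in> carrier G" "\<tau> \<in> carrier G" "w \<in> carrier W" for \<sigma> \<tau> w
  proof -
    from pre[OF that(3)] obtain v where v: "v \<in> carrier V" "w = f v" by blast
    have "\<rho>' \<sigma> (\<rho>' \<tau> w) = f (\<rho> \<sigma> (\<rho> \<tau> v))" using that v by (simp add: eq \<rho>D(1))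
    also have "\<dots> = c \<sigma> \<tau> \<odot>\<^bsub>W\<^esub> f (\<rho> (\<sigma> \<otimes>\<^bsub>G\<^esub> \<tau>) v)"
      using that v V'(7)[OF that(1,2)] by (simp add: V'(8) fD(3) \<rho>D(1))
    finally show ?thesis using that v by (simp add: eq)
  qed
  show ?thesis
    unfolding c_rep_def
    using V'(1,2,7) findim_space_transfer[OF V'(3) f(1) img f(3)] lin bij one mult by blast
qed


section \<open>Modules over the group algebra\<close>

locale finite_group_over_cring = k: cring k + G: group G
  for k :: "('k, 'a) ring_scheme" and G :: "('g, 'b) monoid_scheme" +
  assumes finite_carrier: "finite (carrier G)"
begin

lemma group_algebra_simps:
  "carrier (group_algebra k G) = carrier G \<rightarrow>\<^sub>E carrier k"
  "a \<otimes>\<^bsub>group_algebra k G\<^esub> b =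
     (\<lambda>\<sigma>\<in>carrier G. \<Oplus>\<^bsub>k\<^esub>\<tau>\<in>carrier G. a \<tau> \<otimes>\<^bsub>k\<^esub> b (inv\<^bsub>G\<^esub> \<tau> \<otimes>\<^bsub>G\<^esub> \<sigma>))"
  "a \<oplus>\<^bsub>group_algebra k G\<^esub> b = (\<lambda>\<sigma>\<in>carrier G. a \<sigma> \<oplus>\<^bsub>k\<^esub> b \<sigma>)"
  "\<one>\<^bsub>group_algebra k G\<^esub> = (\<lambda>\<sigma>\<in>carrier G. if \<sigma> = \<one>\<^bsub>G\<^esub> then \<one>\<^bsub>k\<^esub> else \<zero>\<^bsub>k\<^esub>)"
  "\<zero>\<^bsub>group_algebra k G\<^esub> = (\<lambda>\<sigma>\<in>carrier G. \<zero>\<^bsub>k\<^esub>)"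
  by (simp_all add: group_algebra_def)

lemma coeff_closed: "a \<in> carrier G \<rightarrow>\<^sub>E carrier k \<Longrightarrow> \<sigma> \<in> carrier G \<Longrightarrow> a \<sigma> \<in> carrier k"
  by auto

text \<open>Convolution is associative because both triple products are the sum over all
  factorizations of \<sigma> into three group elements.\<close>

lemma ring_group_algebra: "ring (group_algebra k G)"
proof (rule ringI)
  note [simp] = group_algebra_simps coeff_closed
  note [intro!] = k.finsum_closed_Pi
  show "abelian_group (group_algebra k G)"
  proof (rule abelian_groupI)
    fix a assume a: "a \<in> carrier (group_algebra k G)"
    have "(\<lambda>\<sigma>\<in>carrier G. \<ominus>\<^bsub>k\<^esub> a \<sigma>) \<in> carrier (group_algebra k G)"
      "(\<lambda>\<sigma>\<in>carrier G. \<ominus>\<^bsub>k\<^esub> a \<sigma>) \<oplus>\<^bsub>group_algebra k G\<^esub> a = \<zero>\<^bsub>group_algebra k G\<^esub>"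
      using a by (auto simp: fun_eq_iff k.l_neg)
    then show "\<exists>b\<in>carrier (group_algebra k G). b \<oplus>\<^bsub>group_algebra k G\<^esub> a = \<zero>\<^bsub>group_algebra k G\<^esub>" by blast
  qed (auto simp: fun_eq_iff k.add.m_ac PiE_def extensional_def)
  show "monoid (group_algebra k G)"
  proof (rule monoidI)
    fix a b assume ab: "a \<in> carrier (group_algebra k G)" "b \<in> carrier (group_algebra k G)"
    then show "a \<otimes>\<^bsub>group_algebra k G\<^esub> b \<in> carrier (group_algebra k G)" by auto
    fix c assume c: "c \<in> carrier (group_algebra k G)"
    show "a \<otimes>\<^bsub>group_algebra k G\<^esub> b \<otimes>\<^bsub>group_algebra k G\<^esub> c =
        a \<otimes>\<^bsub>group_algebra k G\<^esub> (b \<otimes>\<^bsub>group_algebra k G\<^esub> c)"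
      unfolding group_algebra_simps(2)
    proof (rule restrict_ext)
      fix \<sigma> assume \<sigma>: "\<sigma> \<in> carrier G"
      let ?t = "\<lambda>\<tau> \<upsilon>. a \<upsilon> \<otimes>\<^bsub>k\<^esub> b (inv\<^bsub>G\<^esub> \<upsilon> \<otimes>\<^bsub>G\<^esub> \<tau>) \<otimes>\<^bsub>k\<^esub> c (inv\<^bsub>G\<^esub> \<tau> \<otimes>\<^bsub>G\<^esub> \<sigma>)"
      have cl: "?t \<tau> \<upsilon> \<in> carrier k" if "\<tau> \<in> carrier G" "\<upsilon> \<in> carrier G" for \<tau> \<upsilon>
        using that ab c \<sigma> by simp
      have "(\<Oplus>\<^bsub>k\<^esub>\<tau>\<in>carrier G. (\<lambda>\<sigma>\<in>carrier G. \<Oplus>\<^bsub>k\<^esub>\<upsilon>\<in>carrier G. a \<upsilon> \<otimes>\<^bsub>k\<^esub> b (inv\<^bsub>G\<^esub> \<upsilon> \<otimes>\<^bsub>G\<^esub> \<sigma>)) \<tau>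
            \<otimes>\<^bsub>k\<^esub> c (inv\<^bsub>G\<^esub> \<tau> \<otimes>\<^bsub>G\<^esub> \<sigma>)) = (\<Oplus>\<^bsub>k\<^esub>\<tau>\<in>carrier G. \<Oplus>\<^bsub>k\<^esub>\<upsilon>\<in>carrier G. ?t \<tau> \<upsilon>)"
        using ab c \<sigma> cl by (intro k.finsum_cong') (auto simp: k.finsum_ldistr[OF finite_carrier] Pi_iff)
      also have "\<dots> = (\<Oplus>\<^bsub>k\<^esub>\<upsilon>\<in>carrier G. \<Oplus>\<^bsub>k\<^esub>\<tau>\<in>carrier G. ?t \<tau> \<upsilon>)"
        using cl by (intro k.finsum_swap finite_carrier)
      \<comment> \<open>Substitution of \<upsilon> times \<omega> for \<tau>: the argument of
        \<open>b\<close> becomes \<omega>, which gives the inner sum the form of the product of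
        \<open>b\<close> and \<open>c\<close>.\<close>
      also have "\<dots> = (\<Oplus>\<^bsub>k\<^esub>\<upsilon>\<in>carrier G. \<Oplus>\<^bsub>k\<^esub>\<omega>\<in>carrier G. ?t (\<upsilon> \<otimes>\<^bsub>G\<^esub> \<omega>) \<upsilon>)"
        using cl by (intro k.finsum_cong' refl k.finsum_translate[OF G.group_axioms]) auto
      also have "\<dots> = (\<Oplus>\<^bsub>k\<^esub>\<upsilon>\<in>carrier G. \<Oplus>\<^bsub>k\<^esub>\<omega>\<in>carrier G.
           a \<upsilon> \<otimes>\<^bsub>k\<^esub> (b \<omega> \<otimes>\<^bsub>k\<^esub> c (inv\<^bsub>G\<^esub> \<omega> \<otimes>\<^bsub>G\<^esub> (inv\<^bsub>G\<^esub> \<upsilon> \<otimes>\<^bsub>G\<^esub> \<sigma>))))"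
      proof (intro k.finsum_cong' refl)
        fix \<upsilon> \<omega> assume u: "\<upsilon> \<in> carrier G" and w: "\<omega> \<in> carrier G"
        have "inv\<^bsub>G\<^esub> \<upsilon> \<otimes>\<^bsub>G\<^esub> (\<upsilon> \<otimes>\<^bsub>G\<^esub> \<omega>) = \<omega>"
          using u w by (simp add: G.m_assoc[symmetric])
        moreover have "inv\<^bsub>G\<^esub> (\<upsilon> \<otimes>\<^bsub>G\<^esub> \<omega>) \<otimes>\<^bsub>G\<^esub> \<sigma> = inv\<^bsub>G\<^esub> \<omega> \<otimes>\<^bsub>G\<^esub> (inv\<^bsub>G\<^esub> \<upsilon> \<otimes>\<^bsub>G\<^esub> \<sigma>)"
          using u w \<sigma> by (simp add: G.inv_mult_group G.m_assoc)
        ultimately show "?t (\<upsilon> \<otimes>\<^bsub>G\<^esub> \<omega>) \<upsilon> =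
            a \<upsilon> \<otimes>\<^bsub>k\<^esub> (b \<omega> \<otimes>\<^bsub>k\<^esub> c (inv\<^bsub>G\<^esub> \<omega> \<otimes>\<^bsub>G\<^esub> (inv\<^bsub>G\<^esub> \<upsilon> \<otimes>\<^bsub>G\<^esub> \<sigma>)))"
          using u w \<sigma> ab c by (simp add: k.m_assoc)
      qed (use ab c \<sigma> in auto)
      also have "\<dots> = (\<Oplus>\<^bsub>k\<^esub>\<upsilon>\<in>carrier G. a \<upsilon> \<otimes>\<^bsub>k\<^esub>
           (\<lambda>\<sigma>\<in>carrier G. \<Oplus>\<^bsub>k\<^esub>\<omega>\<in>carrier G. b \<omega> \<otimes>\<^bsub>k\<^esub> c (inv\<^bsub>G\<^esub> \<omega> \<otimes>\<^bsub>G\<^esub> \<sigma>)) (inv\<^bsub>G\<^esub> \<upsilon> \<otimes>\<^bsub>G\<^esub> \<sigma>))"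
        using ab c \<sigma> by (intro k.finsum_cong') (auto simp: k.finsum_rdistr[OF finite_carrier] Pi_iff)
      finally show "(\<Oplus>\<^bsub>k\<^esub>\<tau>\<in>carrier G. (\<lambda>\<sigma>\<in>carrier G. \<Oplus>\<^bsub>k\<^esub>\<upsilon>\<in>carrier G. a \<upsilon> \<otimes>\<^bsub>k\<^esub> b (inv\<^bsub>G\<^esub> \<upsilon> \<otimes>\<^bsub>G\<^esub> \<sigma>)) \<tau>
            \<otimes>\<^bsub>k\<^esub> c (inv\<^bsub>G\<^esub> \<tau> \<otimes>\<^bsub>G\<^esub> \<sigma>)) = \<dots>" .
    qed
  next
    fix a assume a: "a \<in> carrier (group_algebra k G)"
    have "\<one>\<^bsub>group_algebra k G\<^esub> \<otimes>\<^bsub>group_algebra k G\<^esub> a = (\<lambda>\<sigma>\<in>carrier G. a \<sigma>)"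
      unfolding group_algebra_simps(2)
    proof (rule restrict_ext)
      fix \<sigma> assume \<sigma>: "\<sigma> \<in> carrier G"
      have "(\<Oplus>\<^bsub>k\<^esub>\<tau>\<in>carrier G. \<one>\<^bsub>group_algebra k G\<^esub> \<tau> \<otimes>\<^bsub>k\<^esub> a (inv\<^bsub>G\<^esub> \<tau> \<otimes>\<^bsub>G\<^esub> \<sigma>)) =
          (\<Oplus>\<^bsub>k\<^esub>\<tau>\<in>carrier G. if \<tau> = \<one>\<^bsub>G\<^esub> then a (inv\<^bsub>G\<^esub> \<tau> \<otimes>\<^bsub>G\<^esub> \<sigma>) else \<zero>\<^bsub>k\<^esub>)"
        using a \<sigma> by (intro k.finsum_cong') auto
      also have "\<dots> = a (inv\<^bsub>G\<^esub> \<one>\<^bsub>G\<^esub> \<otimes>\<^bsub>G\<^esub> \<sigma>)"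
        using a \<sigma> by (intro k.add.finprod_singleton_swap finite_carrier) auto
      finally show "(\<Oplus>\<^bsub>k\<^esub>\<tau>\<in>carrier G. \<one>\<^bsub>group_algebra k G\<^esub> \<tau> \<otimes>\<^bsub>k\<^esub> a (inv\<^bsub>G\<^esub> \<tau> \<otimes>\<^bsub>G\<^esub> \<sigma>)) = a \<sigma>"
        using \<sigma> by simp
    qed
    also have "\<dots> = a" using a by (simp add: PiE_restrict)
    finally show "\<one>\<^bsub>group_algebra k G\<^esub> \<otimes>\<^bsub>group_algebra k G\<^esub> a = a" .
    have "a \<otimes>\<^bsub>group_algebra k G\<^esub> \<one>\<^bsub>group_algebra k G\<^esub> = (\<lambda>\<sigma>\<in>carrier G. a \<sigma>)"
      unfolding group_algebra_simps(2)
    proof (rule restrict_ext)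
      fix \<sigma> assume \<sigma>: "\<sigma> \<in> carrier G"
      have "inv\<^bsub>G\<^esub> \<tau> \<otimes>\<^bsub>G\<^esub> \<sigma> = \<one>\<^bsub>G\<^esub> \<longleftrightarrow> \<tau> = \<sigma>" if "\<tau> \<in> carrier G" for \<tau>
        using that \<sigma> by (metis G.inv_equality G.inv_inv G.inv_closed G.l_inv)
      then have "(\<Oplus>\<^bsub>k\<^esub>\<tau>\<in>carrier G. a \<tau> \<otimes>\<^bsub>k\<^esub> \<one>\<^bsub>group_algebra k G\<^esub> (inv\<^bsub>G\<^esub> \<tau> \<otimes>\<^bsub>G\<^esub> \<sigma>)) =
          (\<Oplus>\<^bsub>k\<^esub>\<tau>\<in>carrier G. if \<tau> = \<sigma> then a \<tau> else \<zero>\<^bsub>k\<^esub>)"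
        using a \<sigma> by (intro k.finsum_cong') auto
      also have "\<dots> = a \<sigma>"
        using a \<sigma> by (intro k.add.finprod_singleton_swap finite_carrier) auto
      finally show "(\<Oplus>\<^bsub>k\<^esub>\<tau>\<in>carrier G. a \<tau> \<otimes>\<^bsub>k\<^esub> \<one>\<^bsub>group_algebra k G\<^esub> (inv\<^bsub>G\<^esub> \<tau> \<otimes>\<^bsub>G\<^esub> \<sigma>)) = a \<sigma>" .
    qed
    also have "\<dots> = a" using a by (simp add: PiE_restrict)
    finally show "a \<otimes>\<^bsub>group_algebra k G\<^esub> \<one>\<^bsub>group_algebra k G\<^esub> = a" .
  qed auto
  fix a b c assume abc: "a \<in> carrier (group_algebra k G)" "b \<in> carrier (group_algebra k G)"
    "c \<in> carrier (group_algebra k G)"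
  show "(a \<oplus>\<^bsub>group_algebra k G\<^esub> b) \<otimes>\<^bsub>group_algebra k G\<^esub> c =
      a \<otimes>\<^bsub>group_algebra k G\<^esub> c \<oplus>\<^bsub>group_algebra k G\<^esub> b \<otimes>\<^bsub>group_algebra k G\<^esub> c"
    unfolding group_algebra_simps(2,3)
  proof (rule restrict_ext)
    fix \<sigma> assume \<sigma>: "\<sigma> \<in> carrier G"
    have "(\<Oplus>\<^bsub>k\<^esub>\<tau>\<in>carrier G. (\<lambda>\<sigma>\<in>carrier G. a \<sigma> \<oplus>\<^bsub>k\<^esub> b \<sigma>) \<tau> \<otimes>\<^bsub>k\<^esub> c (inv\<^bsub>G\<^esub> \<tau> \<otimes>\<^bsub>G\<^esub> \<sigma>)) =
        (\<Oplus>\<^bsub>k\<^esub>\<tau>\<in>carrier G. a \<tau> \<otimes>\<^bsub>k\<^esub> c (inv\<^bsub>G\<^esub> \<tau> \<otimes>\<^bsub>G\<^esub> \<sigma>)) \<oplus>\<^bsub>k\<^esub>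
        (\<Oplus>\<^bsub>k\<^esub>\<tau>\<in>carrier G. b \<tau> \<otimes>\<^bsub>k\<^esub> c (inv\<^bsub>G\<^esub> \<tau> \<otimes>\<^bsub>G\<^esub> \<sigma>))"
      by (rule trans[OF k.finsum_cong' k.finsum_addf]) (use abc \<sigma> in \<open>auto simp: k.l_distr\<close>)
    then show "(\<Oplus>\<^bsub>k\<^esub>\<tau>\<in>carrier G. (\<lambda>\<sigma>\<in>carrier G. a \<sigma> \<oplus>\<^bsub>k\<^esub> b \<sigma>) \<tau> \<otimes>\<^bsub>k\<^esub> c (inv\<^bsub>G\<^esub> \<tau> \<otimes>\<^bsub>G\<^esub> \<sigma>)) =
        (\<lambda>\<sigma>\<in>carrier G. \<Oplus>\<^bsub>k\<^esub>\<tau>\<in>carrier G. a \<tau> \<otimes>\<^bsub>k\<^esub> c (inv\<^bsub>G\<^esub> \<tau> \<otimes>\<^bsub>G\<^esub> \<sigma>)) \<sigma> \<oplus>\<^bsub>k\<^esub>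
        (\<lambda>\<sigma>\<in>carrier G. \<Oplus>\<^bsub>k\<^esub>\<tau>\<in>carrier G. b \<tau> \<otimes>\<^bsub>k\<^esub> c (inv\<^bsub>G\<^esub> \<tau> \<otimes>\<^bsub>G\<^esub> \<sigma>)) \<sigma>"
      unfolding restrict_apply'[OF \<sigma>] .
  qed
  show "c \<otimes>\<^bsub>group_algebra k G\<^esub> (a \<oplus>\<^bsub>group_algebra k G\<^esub> b) =
      c \<otimes>\<^bsub>group_algebra k G\<^esub> a \<oplus>\<^bsub>group_algebra k G\<^esub> c \<otimes>\<^bsub>group_algebra k G\<^esub> b"
    unfolding group_algebra_simps(2,3)
  proof (rule restrict_ext)
    fix \<sigma> assume \<sigma>: "\<sigma> \<in> carrier G"
    have "(\<Oplus>\<^bsub>k\<^esub>\<tau>\<in>carrier G. c \<tau> \<otimes>\<^bsub>k\<^esub> (\<lambda>\<sigma>\<in>carrier G. a \<sigma> \<oplus>\<^bsub>k\<^esub> b \<sigma>) (inv\<^bsub>G\<^esub> \<tau> \<otimes>\<^bsub>G\<^esub> \<sigma>)) =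
        (\<Oplus>\<^bsub>k\<^esub>\<tau>\<in>carrier G. c \<tau> \<otimes>\<^bsub>k\<^esub> a (inv\<^bsub>G\<^esub> \<tau> \<otimes>\<^bsub>G\<^esub> \<sigma>)) \<oplus>\<^bsub>k\<^esub>
        (\<Oplus>\<^bsub>k\<^esub>\<tau>\<in>carrier G. c \<tau> \<otimes>\<^bsub>k\<^esub> b (inv\<^bsub>G\<^esub> \<tau> \<otimes>\<^bsub>G\<^esub> \<sigma>))"
      by (rule trans[OF k.finsum_cong' k.finsum_addf]) (use abc \<sigma> in \<open>auto simp: k.r_distr\<close>)
    then show "(\<Oplus>\<^bsub>k\<^esub>\<tau>\<in>carrier G. c \<tau> \<otimes>\<^bsub>k\<^esub> (\<lambda>\<sigma>\<in>carrier G. a \<sigma> \<oplus>\<^bsub>k\<^esub> b \<sigma>) (inv\<^bsub>G\<^esub> \<tau> \<otimes>\<^bsub>G\<^esub> \<sigma>)) =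
        (\<lambda>\<sigma>\<in>carrier G. \<Oplus>\<^bsub>k\<^esub>\<tau>\<in>carrier G. c \<tau> \<otimes>\<^bsub>k\<^esub> a (inv\<^bsub>G\<^esub> \<tau> \<otimes>\<^bsub>G\<^esub> \<sigma>)) \<sigma> \<oplus>\<^bsub>k\<^esub>
        (\<lambda>\<sigma>\<in>carrier G. \<Oplus>\<^bsub>k\<^esub>\<tau>\<in>carrier G. c \<tau> \<otimes>\<^bsub>k\<^esub> b (inv\<^bsub>G\<^esub> \<tau> \<otimes>\<^bsub>G\<^esub> \<sigma>)) \<sigma>"
      unfolding restrict_apply'[OF \<sigma>] .
  qed
qed

end

lemma rep_module_simps:
  "carrier (rep_module G V \<rho>) = carrier V" "x \<oplus>\<^bsub>rep_module G V \<rho>\<^esub> y = x \<oplus>\<^bsub>V\<^esub> y"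
  "\<zero>\<^bsub>rep_module G V \<rho>\<^esub> = \<zero>\<^bsub>V\<^esub>"
  "a \<odot>\<^bsub>rep_module G V \<rho>\<^esub> v = (\<Oplus>\<^bsub>V\<^esub>\<sigma>\<in>carrier G. a \<sigma> \<odot>\<^bsub>V\<^esub> \<rho> \<sigma> v)"
  by (simp_all add: rep_module_def)

lemma abelian_group_rep_module:
  assumes "abelian_group V"
  shows "abelian_group (rep_module G V \<rho>)"
proof -
  interpret abelian_group V by fact
  show ?thesis
  proof (rule abelian_groupI)
    fix x assume "x \<in> carrier (rep_module G V \<rho>)"
    then show "\<exists>y\<in>carrier (rep_module G V \<rho>). y \<oplus>\<^bsub>rep_module G V \<rho>\<^esub> x = \<zero>\<^bsub>rep_module G V \<rho>\<^esub>"
      by (intro bexI[of _ "\<ominus>\<^bsub>V\<^esub> x"]) (simp_all add: rep_module_simps l_neg)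
  qed (simp_all add: rep_module_simps a_ac)
qed

text \<open>With trivial cocycle \<rho> is multiplicative, and the convolution product acts as the
  composite: collecting the terms of the composite in which \<tau> times \<omega> is \<sigma> gives
  the coefficient at \<sigma>.\<close>

lemma c_rep_left_module:
  assumes V: "c_rep G k V \<rho> (\<lambda>\<sigma> \<tau>. \<one>\<^bsub>k\<^esub>)"
  shows "left_module (group_algebra k G) (rep_module G V \<rho>)"
proof -
  have V': "group G" "finite (carrier G)" "field k" "module k V"
    "\<And>\<sigma>. \<sigma> \<in> carrier G \<Longrightarrow> \<rho> \<sigma> \<in> linear_maps k V V" "\<And>v. v \<in> carrier V \<Longrightarrow> \<rho> \<one>\<^bsub>G\<^esub> v = v"
    "\<And>\<sigma> \<tau> v. \<sigma> \<in> carrier G \<Longrightarrow> \<tau> \<in> carrier G \<Longrightarrow> v \<in> carrier V \<Longrightarrow>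
       \<rho> \<sigma> (\<rho> \<tau> v) = \<one>\<^bsub>k\<^esub> \<odot>\<^bsub>V\<^esub> \<rho> (\<sigma> \<otimes>\<^bsub>G\<^esub> \<tau>) v"
    using V by (simp_all add: c_rep_def findim_space_def)
  interpret G: group G by (rule V'(1))
  interpret V: module k V by (rule V'(4))
  interpret FG: finite_group_over_cring k G
    by unfold_locales (rule V'(2))
  note \<rho>D = linear_mapsD[OF V'(5)]
  have \<rho>_mult: "\<rho> \<sigma> (\<rho> \<tau> v) = \<rho> (\<sigma> \<otimes>\<^bsub>G\<^esub> \<tau>) v"
    if "\<sigma> \<in> carrier G" "\<tau> \<in> carrier G" "v \<in> carrier V" for \<sigma> \<tau> v
    using V'(7)[OF that] \<rho>D(1) that by simp
  note [simp] = FG.group_algebra_simps rep_module_simps FG.coeff_closed \<rho>D(1)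
  note [intro!] = V.M.finsum_closed_Pi
  show ?thesis
    unfolding left_module_def
  proof (intro conjI ballI)
    show "ring (group_algebra k G)" by (rule FG.ring_group_algebra)
    show "abelian_group (rep_module G V \<rho>)" by (rule abelian_group_rep_module) (rule V.M.abelian_group_axioms)
    fix v assume v: "v \<in> carrier (rep_module G V \<rho>)"
    have "\<one>\<^bsub>group_algebra k G\<^esub> \<odot>\<^bsub>rep_module G V \<rho>\<^esub> v = (\<Oplus>\<^bsub>V\<^esub>\<sigma>\<in>carrier G. if \<sigma> = \<one>\<^bsub>G\<^esub> then \<rho> \<sigma> v else \<zero>\<^bsub>V\<^esub>)"
      unfolding rep_module_simps(4) using v by (intro V.M.finsum_cong') (auto simp: V.smult_l_null)
    also have "\<dots> = \<rho> \<one>\<^bsub>G\<^esub> v" using v by (intro V.M.add.finprod_singleton_swap V'(2)) auto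
    finally show "\<one>\<^bsub>group_algebra k G\<^esub> \<odot>\<^bsub>rep_module G V \<rho>\<^esub> v = v" using v V'(6) by simp
  next
    fix a v assume a: "a \<in> carrier (group_algebra k G)" and v: "v \<in> carrier (rep_module G V \<rho>)"
    then show "a \<odot>\<^bsub>rep_module G V \<rho>\<^esub> v \<in> carrier (rep_module G V \<rho>)" by auto
  next
    fix a b v assume ab: "a \<in> carrier (group_algebra k G)" "b \<in> carrier (group_algebra k G)"
      and v: "v \<in> carrier (rep_module G V \<rho>)"
    show "(a \<oplus>\<^bsub>group_algebra k G\<^esub> b) \<odot>\<^bsub>rep_module G V \<rho>\<^esub> v =
        a \<odot>\<^bsub>rep_module G V \<rho>\<^esub> v \<oplus>\<^bsub>rep_module G V \<rho>\<^esub> b \<odot>\<^bsub>rep_module G V \<rho>\<^esub> v"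
      unfolding rep_module_simps
      by (rule trans[OF V.M.finsum_cong' V.M.finsum_addf]) (use ab v in \<open>auto simp: V.smult_l_distr\<close>)
    let ?t = "\<lambda>\<sigma> \<tau>. (a \<tau> \<otimes>\<^bsub>k\<^esub> b (inv\<^bsub>G\<^esub> \<tau> \<otimes>\<^bsub>G\<^esub> \<sigma>)) \<odot>\<^bsub>V\<^esub> \<rho> \<sigma> v"
    have cl: "?t \<sigma> \<tau> \<in> carrier V" if "\<sigma> \<in> carrier G" "\<tau> \<in> carrier G" for \<sigma> \<tau>
      using that ab v by simp
    have "(a \<otimes>\<^bsub>group_algebra k G\<^esub> b) \<odot>\<^bsub>rep_module G V \<rho>\<^esub> v =
        (\<Oplus>\<^bsub>V\<^esub>\<sigma>\<in>carrier G. \<Oplus>\<^bsub>V\<^esub>\<tau>\<in>carrier G. ?t \<sigma> \<tau>)"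
      unfolding rep_module_simps(4)
      using ab v cl by (intro V.M.finsum_cong') (auto simp: V.smult_finsum_l[OF V'(2)])
    also have "\<dots> = (\<Oplus>\<^bsub>V\<^esub>\<tau>\<in>carrier G. \<Oplus>\<^bsub>V\<^esub>\<sigma>\<in>carrier G. ?t \<sigma> \<tau>)"
      using cl by (intro V.M.finsum_swap V'(2))
    also have "\<dots> = (\<Oplus>\<^bsub>V\<^esub>\<tau>\<in>carrier G. \<Oplus>\<^bsub>V\<^esub>\<omega>\<in>carrier G. ?t (\<tau> \<otimes>\<^bsub>G\<^esub> \<omega>) \<tau>)"
      using cl by (intro V.M.finsum_cong' refl V.M.finsum_translate[OF V'(1)]) auto
    also have "\<dots> = (\<Oplus>\<^bsub>V\<^esub>\<tau>\<in>carrier G. \<Oplus>\<^bsub>V\<^esub>\<omega>\<in>carrier G. a \<tau> \<odot>\<^bsub>V\<^esub> (\<rho> \<tau> (b \<omega> \<odot>\<^bsub>V\<^esub> \<rho> \<omega> v)))"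
      using ab v by (intro V.M.finsum_cong' refl)
        (auto simp: G.m_assoc[symmetric] V.smult_assoc1 \<rho>D(3) \<rho>_mult)
    also have "\<dots> = (\<Oplus>\<^bsub>V\<^esub>\<tau>\<in>carrier G. a \<tau> \<odot>\<^bsub>V\<^esub> \<rho> \<tau> (\<Oplus>\<^bsub>V\<^esub>\<omega>\<in>carrier G. b \<omega> \<odot>\<^bsub>V\<^esub> \<rho> \<omega> v))"
      using ab v by (intro V.M.finsum_cong')
        (auto simp: linear_map_finsum[OF V'(4,4,5,2)] V.finsum_smult_ldistr[OF V'(2)])
    finally show "(a \<otimes>\<^bsub>group_algebra k G\<^esub> b) \<odot>\<^bsub>rep_module G V \<rho>\<^esub> v =
        a \<odot>\<^bsub>rep_module G V \<rho>\<^esub> (b \<odot>\<^bsub>rep_module G V \<rho>\<^esub> v)" by simp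
  next
    fix a u v assume a: "a \<in> carrier (group_algebra k G)"
      and uv: "u \<in> carrier (rep_module G V \<rho>)" "v \<in> carrier (rep_module G V \<rho>)"
    show "a \<odot>\<^bsub>rep_module G V \<rho>\<^esub> (u \<oplus>\<^bsub>rep_module G V \<rho>\<^esub> v) =
        a \<odot>\<^bsub>rep_module G V \<rho>\<^esub> u \<oplus>\<^bsub>rep_module G V \<rho>\<^esub> a \<odot>\<^bsub>rep_module G V \<rho>\<^esub> v"
      unfolding rep_module_simps
      by (rule trans[OF V.M.finsum_cong' V.M.finsum_addf]) (use a uv in \<open>auto simp: V.smult_r_distr \<rho>D(2)\<close>)
  qed
qed

lemma equivariant_left_module_iso:
  assumes V: "c_rep G k V \<rho> (\<lambda>\<sigma> \<tau>. \<one>\<^bsub>k\<^esub>)" and W: "c_rep G k W \<rho>' (\<lambda>\<sigma> \<tau>. \<one>\<^bsub>k\<^esub>)"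
    and f: "f \<in> linear_maps k V W" "bij_betw f (carrier V) (carrier W)"
    and eq: "\<And>\<sigma> v. \<sigma> \<in> carrier G \<Longrightarrow> v \<in> carrier V \<Longrightarrow> f (\<rho> \<sigma> v) = \<rho>' \<sigma> (f v)"
  shows "left_module_iso (group_algebra k G) (rep_module G V \<rho>) (rep_module G W \<rho>') f"
proof -
  have V': "finite (carrier G)" "module k V" "\<And>\<sigma>. \<sigma> \<in> carrier G \<Longrightarrow> \<rho> \<sigma> \<in> linear_maps k V V"
    using V by (simp_all add: c_rep_def findim_space_def)
  have W': "module k W" "\<And>\<sigma>. \<sigma> \<in> carrier G \<Longrightarrow> \<rho>' \<sigma> \<in> linear_maps k W W"
    using W by (simp_all add: c_rep_def findim_space_def)
  interpret V: module k V by fact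
  interpret W: module k W by fact
  note fD = linear_mapsD[OF f(1)] and \<rho>D = linear_mapsD[OF V'(3)] and \<rho>'D = linear_mapsD[OF W'(2)]
  have "f \<in> linear_maps (group_algebra k G) (rep_module G V \<rho>) (rep_module G W \<rho>')"
    unfolding linear_maps_def rep_module_simps
  proof (intro CollectI conjI ballI)
    fix a v assume "a \<in> carrier (group_algebra k G)" and v: "v \<in> carrier V"
    then have a: "a \<sigma> \<in> carrier k" if "\<sigma> \<in> carrier G" for \<sigma> using that by (auto simp: group_algebra_def)
    have "f (\<Oplus>\<^bsub>V\<^esub>\<sigma>\<in>carrier G. a \<sigma> \<odot>\<^bsub>V\<^esub> \<rho> \<sigma> v) = (\<Oplus>\<^bsub>W\<^esub>\<sigma>\<in>carrier G. f (a \<sigma> \<odot>\<^bsub>V\<^esub> \<rho> \<sigma> v))"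
      using a v \<rho>D(1) by (intro linear_map_finsum[OF V'(2) W'(1) f(1) V'(1)]) auto
    also have "\<dots> = (\<Oplus>\<^bsub>W\<^esub>\<sigma>\<in>carrier G. a \<sigma> \<odot>\<^bsub>W\<^esub> \<rho>' \<sigma> (f v))"
      using a v \<rho>D(1) \<rho>'D(1) fD by (intro W.M.finsum_cong') (auto simp: eq)
    finally show "f (\<Oplus>\<^bsub>V\<^esub>\<sigma>\<in>carrier G. a \<sigma> \<odot>\<^bsub>V\<^esub> \<rho> \<sigma> v) = (\<Oplus>\<^bsub>W\<^esub>\<sigma>\<in>carrier G. a \<sigma> \<odot>\<^bsub>W\<^esub> \<rho>' \<sigma> (f v))" .
  qed (use fD in auto)
  with c_rep_left_module[OF V] c_rep_left_module[OF W] f(2) show ?thesis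
    by (simp add: left_module_iso_def rep_module_simps)
qed


section \<open>Products and endomorphism algebras\<close>

lemma av_prod_simps:
  "carrier (av_prod A B) = variety_prod (carrier A) (carrier B)"
  "\<one>\<^bsub>av_prod A B\<^esub> = \<one>\<^bsub>A\<^esub> @ \<one>\<^bsub>B\<^esub>"
  by (simp_all add: av_prod_def)

lemma av_prod_mult:
  assumes "projective_group A" "x \<in> carrier A" "x' \<in> carrier A"
  shows "(x @ y) \<otimes>\<^bsub>av_prod A B\<^esub> (x' @ y') = (x \<otimes>\<^bsub>A\<^esub> x') @ (y \<otimes>\<^bsub>B\<^esub> y')"
  using projective_group_length[OF assms(1,2)] projective_group_length[OF assms(1,3)]
  by (simp add: av_prod_def)

lemma av_prod_cases:
  assumes "z \<in> carrier (av_prod A B)"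
  obtains x y where "z = x @ y" "x \<in> carrier A" "y \<in> carrier B"
  using assms by (auto simp: av_prod_simps variety_prod_def)

lemma av_prod_memI: "x \<in> carrier A \<Longrightarrow> y \<in> carrier B \<Longrightarrow> x @ y \<in> carrier (av_prod A B)"
  by (auto simp: av_prod_simps variety_prod_def)

lemma av_prod_projective:
  assumes A: "projective_group A" and B: "projective_group B"
  shows "projective_group (av_prod A B)"
  unfolding projective_group_def
proof
  interpret A: comm_group A using A by auto
  interpret B: comm_group B using B by auto
  note mult = av_prod_mult[OF A]
  show "comm_group (av_prod A B)"
  proof (rule comm_groupI)
    show "\<one>\<^bsub>av_prod A B\<^esub> \<in> carrier (av_prod A B)"
      unfolding av_prod_simps(2) by (intro av_prod_memI) auto
    fix z assume "z \<in> carrier (av_prod A B)"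
    then obtain x y where z: "z = x @ y" "x \<in> carrier A" "y \<in> carrier B" by (rule av_prod_cases)
    show "\<one>\<^bsub>av_prod A B\<^esub> \<otimes>\<^bsub>av_prod A B\<^esub> z = z" using z by (simp add: av_prod_simps(2) mult)
    have "(inv\<^bsub>A\<^esub> x @ inv\<^bsub>B\<^esub> y) \<otimes>\<^bsub>av_prod A B\<^esub> z = \<one>\<^bsub>av_prod A B\<^esub>"
      using z by (simp add: av_prod_simps(2) mult)
    then show "\<exists>w\<in>carrier (av_prod A B). w \<otimes>\<^bsub>av_prod A B\<^esub> z = \<one>\<^bsub>av_prod A B\<^esub>"
      using z(2,3) av_prod_memI[of "inv\<^bsub>A\<^esub> x" A "inv\<^bsub>B\<^esub> y" B] by auto
    fix z' assume "z' \<in> carrier (av_prod A B)"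
    then obtain x' y' where z': "z' = x' @ y'" "x' \<in> carrier A" "y' \<in> carrier B" by (rule av_prod_cases)
    show "z \<otimes>\<^bsub>av_prod A B\<^esub> z' \<in> carrier (av_prod A B)" using z z' by (simp add: mult av_prod_memI)
    show "z \<otimes>\<^bsub>av_prod A B\<^esub> z' = z' \<otimes>\<^bsub>av_prod A B\<^esub> z"
      using z z' by (simp add: mult A.m_comm B.m_comm)
    fix z'' assume "z'' \<in> carrier (av_prod A B)"
    then obtain x'' y'' where z'': "z'' = x'' @ y''" "x'' \<in> carrier A" "y'' \<in> carrier B"
      by (rule av_prod_cases)
    show "z \<otimes>\<^bsub>av_prod A B\<^esub> z' \<otimes>\<^bsub>av_prod A B\<^esub> z'' = z \<otimes>\<^bsub>av_prod A B\<^esub> (z' \<otimes>\<^bsub>av_prod A B\<^esub> z'')"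
      using z z' z'' by (simp add: mult A.m_assoc B.m_assoc)
  qed
  obtain ns where ns: "carrier A \<subseteq> multiproj_space ns" using A by (rule projective_groupE)
  obtain ms where ms: "carrier B \<subseteq> multiproj_space ms" using B by (rule projective_groupE)
  show "\<exists>ns. carrier (av_prod A B) \<subseteq> multiproj_space ns"
    using variety_prod_multiproj[OF ns ms] unfolding av_prod_simps by blast
qed

lemma av_hom_fst:
  assumes A: "projective_group A" and B: "projective_group B"
  shows "take (length \<one>\<^bsub>A\<^esub>) \<in> av_hom F (av_prod A B) A"
proof (rule av_homI)
  have take: "take (length \<one>\<^bsub>A\<^esub>) (x @ y) = x" if "x \<in> carrier A" for x y
    using projective_group_length[OF A that] by simp
  interpret A: comm_group A using A by auto
  show "take (length \<one>\<^bsub>A\<^esub>) \<in> hom (av_prod A B) A"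
    unfolding hom_def by (auto simp: take av_prod_mult[OF A] simp del: take_append elim!: av_prod_cases)
  obtain ns where ns: "carrier (av_prod A B) \<subseteq> multiproj_space ns"
    using av_prod_projective[OF A B] by (rule projective_groupE)
  show "regular F (carrier (av_prod A B)) (carrier A) (take (length \<one>\<^bsub>A\<^esub>))"
  proof (rule regular_select[OF _ ns, where \<pi> = "\<lambda>l. l"])
    show "take (length \<one>\<^bsub>A\<^esub>) \<in> carrier (av_prod A B) \<rightarrow> carrier A"
      by (auto simp: take simp del: take_append elim!: av_prod_cases)
    fix z assume z: "z \<in> carrier (av_prod A B)"
    have len: "length z = length ns" using z ns multiproj_space_length by blast
    show "l < length ns \<and> take (length \<one>\<^bsub>A\<^esub>) z ! l = z ! l" if "l < length (take (length \<one>\<^bsub>A\<^esub>) z)" for l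
      using that len by simp
    fix z' assume "z' \<in> carrier (av_prod A B)"
    then have "length z' = length ns" using ns multiproj_space_length by blast
    with len show "length (take (length \<one>\<^bsub>A\<^esub>) z) = length (take (length \<one>\<^bsub>A\<^esub>) z')" by simp
  qed
qed

lemma av_hom_snd:
  assumes A: "projective_group A" and B: "projective_group B"
  shows "drop (length \<one>\<^bsub>A\<^esub>) \<in> av_hom F (av_prod A B) B"
proof (rule av_homI)
  have drop: "drop (length \<one>\<^bsub>A\<^esub>) (x @ y) = y" if "x \<in> carrier A" for x y
    using projective_group_length[OF A that] by simp
  interpret A: comm_group A using A by auto
  show "drop (length \<one>\<^bsub>A\<^esub>) \<in> hom (av_prod A B) B"
    unfolding hom_def by (auto simp: drop av_prod_mult[OF A] simp del: drop_append elim!: av_prod_cases)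
  obtain ns where ns: "carrier (av_prod A B) \<subseteq> multiproj_space ns"
    using av_prod_projective[OF A B] by (rule projective_groupE)
  show "regular F (carrier (av_prod A B)) (carrier B) (drop (length \<one>\<^bsub>A\<^esub>))"
  proof (rule regular_select[OF _ ns, where \<pi> = "\<lambda>l. length \<one>\<^bsub>A\<^esub> + l"])
    show "drop (length \<one>\<^bsub>A\<^esub>) \<in> carrier (av_prod A B) \<rightarrow> carrier B"
      by (auto simp: drop simp del: drop_append elim!: av_prod_cases)
    fix z assume z: "z \<in> carrier (av_prod A B)"
    have len: "length z = length ns" using z ns multiproj_space_length by blast
    show "length \<one>\<^bsub>A\<^esub> + l < length ns \<and> drop (length \<one>\<^bsub>A\<^esub>) z ! l = z ! (length \<one>\<^bsub>A\<^esub> + l)"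
      if "l < length (drop (length \<one>\<^bsub>A\<^esub>) z)" for l
      using that len by simp
    fix z' assume "z' \<in> carrier (av_prod A B)"
    then have "length z' = length ns" using ns multiproj_space_length by blast
    with len show "length (drop (length \<one>\<^bsub>A\<^esub>) z) = length (drop (length \<one>\<^bsub>A\<^esub>) z')" by simp
  qed
qed

lemma av_hom_pair:
  assumes f: "f \<in> av_hom F C A" and g: "g \<in> av_hom F C B"
    and C: "projective_group C" and A: "projective_group A"
  shows "(\<lambda>x. f x @ g x) \<in> av_hom F C (av_prod A B)"
proof (rule av_homI)
  obtain ns where ns: "carrier C \<subseteq> multiproj_space ns" using C by (rule projective_groupE)
  obtain ms where ms: "carrier A \<subseteq> multiproj_space ms" using A by (rule projective_groupE)
  show "regular F (carrier C) (carrier (av_prod A B)) (\<lambda>x. f x @ g x)"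
    unfolding av_prod_simps by (rule regular_append[OF av_homD(2)[OF f] av_homD(2)[OF g] ns ms])
  show "(\<lambda>x. f x @ g x) \<in> hom C (av_prod A B)"
    using av_homD(3,4)[OF f] av_homD(3,4)[OF g]
    by (auto simp: hom_def av_prod_mult[OF A] intro: av_prod_memI)
qed

text \<open>With \<open>\<psi>\<close> inverse to \<open>\<phi>\<close>, the maps are
  \<open>\<psi>\<close> after the inclusions of the two factors and the projections after
  \<open>\<phi>\<close>. They add up to the identity because each point \<open>y @ z\<close> of the
  product is the sum of \<open>y @ \<one>\<close> and \<open>\<one> @ z\<close>.\<close>

lemma isogenous_square_decomposition:
  assumes iso: "isogenous F A (av_prod E E)" and A: "group_variety F A" and E: "group_variety F E"
  obtains i\<^sub>1 i\<^sub>2 p\<^sub>1 p\<^sub>2 where "i\<^sub>1 \<in> qhom F E A" "i\<^sub>2 \<in> qhom F E A" "p\<^sub>1 \<in> qhom F A E" "p\<^sub>2 \<in> qhom F A E"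
    "qadd A A (qcomp A A i\<^sub>1 p\<^sub>1) (qcomp A A i\<^sub>2 p\<^sub>2) = qid A"
proof -
  have pA: "projective_group A" and pE: "projective_group E" using A E by auto
  define P where "P = av_prod E E"
  have pP: "projective_group P" unfolding P_def by (rule av_prod_projective[OF pE pE])
  obtain \<phi> \<psi> where \<phi>: "\<phi> \<in> qhom F A P" and \<psi>: "\<psi> \<in> qhom F P A" and \<psi>\<phi>: "qcomp A A \<psi> \<phi> = qid A"
    using iso by (auto simp: isogenous_def isogeny_def P_def)
  obtain w m where w: "\<phi> = qfrac A P w m" "w \<in> av_hom F A P" "w \<in> av_hom UNIV A P" "m > 0"
    using \<phi> by (rule qhomE)
  obtain u n where u: "\<psi> = qfrac P A u n" "u \<in> av_hom F P A" "u \<in> av_hom UNIV P A" "n > 0"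
    using \<psi> by (rule qhomE)
  define in1 in2 where "in1 = (\<lambda>x. x @ \<one>\<^bsub>E\<^esub>)" and "in2 = (\<lambda>x. \<one>\<^bsub>E\<^esub> @ x)"
  define pr1 pr2 :: "point \<Rightarrow> point" where "pr1 = take (length \<one>\<^bsub>E\<^esub>)" and "pr2 = drop (length \<one>\<^bsub>E\<^esub>)"
  have in12: "in1 \<in> av_hom F E P" "in2 \<in> av_hom F E P"
    unfolding in1_def in2_def P_def
    by (intro av_hom_pair av_hom_id av_hom_one pE E)+
  have pr12: "pr1 \<in> av_hom F P E" "pr2 \<in> av_hom F P E"
    unfolding pr1_def pr2_def P_def by (intro av_hom_fst av_hom_snd pE)+
  define a b where "a = (u \<circ> in1) \<circ> (pr1 \<circ> w)" and "b = (u \<circ> in2) \<circ> (pr2 \<circ> w)"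
  have i: "u \<circ> in1 \<in> av_hom F E A" "u \<circ> in2 \<in> av_hom F E A"
    and p: "pr1 \<circ> w \<in> av_hom F A E" "pr2 \<circ> w \<in> av_hom F A E"
    using in12 pr12 u(2) w(2) by (auto intro: av_hom_comp pA pE pP)
  then have ab: "a \<in> av_hom UNIV A A" "b \<in> av_hom UNIV A A"
    unfolding a_def b_def by (auto intro!: av_hom_UNIV av_hom_comp[of _ F A E] pA pE)
  interpret A: comm_group A using pA by auto
  interpret E: comm_group E using pE by auto
  have sum: "a x \<otimes>\<^bsub>A\<^esub> b x = u (w x)" if x: "x \<in> carrier A" for x
  proof -
    obtain y z where wx: "w x = y @ z" "y \<in> carrier E" "z \<in> carrier E"
      using av_homD(3)[OF w(2) x] unfolding P_def by (rule av_prod_cases)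
    have "pr1 (w x) = y" "pr2 (w x) = z"
      using projective_group_length[OF pE wx(2)] by (simp_all add: wx(1) pr1_def pr2_def)
    then have "a x \<otimes>\<^bsub>A\<^esub> b x = u ((y @ \<one>\<^bsub>E\<^esub>) \<otimes>\<^bsub>P\<^esub> (\<one>\<^bsub>E\<^esub> @ z))"
      using wx(2,3) unfolding a_def b_def comp_apply in1_def in2_def
      by (subst av_homD(4)[OF u(2)]) (auto simp: P_def intro: av_prod_memI)
    then show ?thesis using wx by (simp add: P_def av_prod_mult[OF pE])
  qed
  show thesis
  proof (rule that)
    show "qfrac E A (u \<circ> in1) n \<in> qhom F E A" "qfrac E A (u \<circ> in2) n \<in> qhom F E A"
      "qfrac A E (pr1 \<circ> w) m \<in> qhom F A E" "qfrac A E (pr2 \<circ> w) m \<in> qhom F A E"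
      using i p u(4) w(4) by (auto intro: qhomI)
    have "qcomp A A (qfrac E A (u \<circ> in1) n) (qfrac A E (pr1 \<circ> w) m) = qfrac A A a (n * m)"
      "qcomp A A (qfrac E A (u \<circ> in2) n) (qfrac A E (pr2 \<circ> w) m) = qfrac A A b (n * m)"
      unfolding a_def b_def
      by (rule qcomp_qfrac[OF av_hom_UNIV[OF i(1)] av_hom_UNIV[OF p(1)] u(4) w(4) pA pE pA]
          qcomp_qfrac[OF av_hom_UNIV[OF i(2)] av_hom_UNIV[OF p(2)] u(4) w(4) pA pE pA])+
    then have "qadd A A (qcomp A A (qfrac E A (u \<circ> in1) n) (qfrac A E (pr1 \<circ> w) m))
        (qcomp A A (qfrac E A (u \<circ> in2) n) (qfrac A E (pr2 \<circ> w) m)) =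
        qfrac A A (\<lambda>x. a x [^]\<^bsub>A\<^esub> (n * m) \<otimes>\<^bsub>A\<^esub> b x [^]\<^bsub>A\<^esub> (n * m)) ((n * m) * (n * m))"
      using ab u(4) w(4) by (simp add: qadd_qfrac A.comm_group_axioms)
    \<comment> \<open>\<open>\<psi>\<close> and \<open>\<phi>\<close> have denominators
      \<open>n\<close> and \<open>m\<close>. Addition over a common denominator squares
      \<open>n * m\<close>; one factor is cancelled here.\<close>
    also have "\<dots> = qfrac A A (u \<circ> w) (n * m)"
    proof (rule qfrac_eqI[where k = 1])
      fix x assume x: "x \<in> carrier A"
      have cl: "a x \<in> carrier A" "b x \<in> carrier A" using av_homD(3)[OF ab(1) x] av_homD(3)[OF ab(2) x] by auto
      have "(a x [^]\<^bsub>A\<^esub> (n * m) \<otimes>\<^bsub>A\<^esub> b x [^]\<^bsub>A\<^esub> (n * m)) [^]\<^bsub>A\<^esub> (n * m) =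
          ((a x \<otimes>\<^bsub>A\<^esub> b x) [^]\<^bsub>A\<^esub> (n * m)) [^]\<^bsub>A\<^esub> (n * m)"
        using cl by (simp add: A.nat_pow_distrib)
      also have "\<dots> = (u \<circ> w) x [^]\<^bsub>A\<^esub> ((n * m) * (n * m))"
        unfolding sum[OF x] comp_apply
        using av_homD(3)[OF u(2) av_homD(3)[OF w(2) x]] by (rule A.nat_pow_pow)
      finally show "(a x [^]\<^bsub>A\<^esub> (n * m) \<otimes>\<^bsub>A\<^esub> b x [^]\<^bsub>A\<^esub> (n * m)) [^]\<^bsub>A\<^esub> (1 * (n * m)) =
          (u \<circ> w) x [^]\<^bsub>A\<^esub> (1 * ((n * m) * (n * m)))" by simp
    qed (use av_homD(3)[OF ab(1)] av_homD(3)[OF ab(2)] av_homD(3)[OF u(2)] av_homD(3)[OF w(2)] u(4) w(4)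
        A.comm_group_axioms in auto)
    also have "\<dots> = qid A" using \<psi>\<phi> u w pA pP by (simp add: qcomp_qfrac)
    finally show "qadd A A (qcomp A A (qfrac E A (u \<circ> in1) n) (qfrac A E (pr1 \<circ> w) m))
        (qcomp A A (qfrac E A (u \<circ> in2) n) (qfrac A E (pr2 \<circ> w) m)) = qid A" .
  qed
qed

section \<open>Endomorphism algebras and complex multiplication\<close>

lemma fld_simps [simp]:
  "carrier (fld F) = F" "x \<otimes>\<^bsub>fld F\<^esub> y = x * y" "x \<oplus>\<^bsub>fld F\<^esub> y = x + y" "\<one>\<^bsub>fld F\<^esub> = 1" "\<zero>\<^bsub>fld F\<^esub> = 0"
  using Qbar_simps by (simp_all add: fld_def)

lemma qend_simps:
  "carrier (qend F A) = qhom F A A" "x \<otimes>\<^bsub>qend F A\<^esub> y = qcomp A A x y" "x \<oplus>\<^bsub>qend F A\<^esub> y = qadd A A x y"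
  "\<one>\<^bsub>qend F A\<^esub> = qid A"
  by (simp_all add: qend_def)

lemma ring_iso_qendD:
  assumes "h \<in> ring_iso (fld M) (qend F E)"
  shows "x \<in> M \<Longrightarrow> h x \<in> qhom F E E" "x \<in> M \<Longrightarrow> y \<in> M \<Longrightarrow> h (x * y) = qcomp E E (h x) (h y)"
    "x \<in> M \<Longrightarrow> y \<in> M \<Longrightarrow> h (x + y) = qadd E E (h x) (h y)" "h 1 = qid E"
    "bij_betw h M (qhom F E E)"
  using assms by (auto simp: ring_iso_def ring_hom_def qend_simps)

text \<open>\<open>h\<close> identifies M with the geometric endomorphisms of E, and transport along
  \<theta> identifies those of E and E'. Thus \<iota> becomes a ring endomorphism \<open>g\<close>
  of M, whose surjectivity says that every geometric endomorphism of E' comes from \<iota> and so is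
  defined over N.\<close>

lemma CM_endomorphisms_defined:
  assumes M: "imaginary_quadratic M" "subfield M Qbar" and CM: "has_CM E M"
    and iso: "isogeny UNIV E' E \<theta>" and gE: "group_variety UNIV E" and E': "group_variety UNIV E'"
    and \<iota>: "\<iota> \<in> ring_iso (fld M) (qend N E')"
  shows "qhom N E' E' = qhom UNIV E' E'"
proof
  show "qhom N E' E' \<subseteq> qhom UNIV E' E'" by (rule qhom_mono) simp
  obtain h where h: "h \<in> ring_iso (fld M) (qend UNIV E)"
    using CM by (auto simp: has_CM_def is_ring_iso_def)
  note hD = ring_iso_qendD[OF h] and \<iota>D = ring_iso_qendD[OF \<iota>]
  have pE': "projective_group E'" and E: "projective_group E" using E' gE by auto
  define \<eta> where "\<eta> = qinv E' E \<theta>"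
  have \<theta>: "\<theta> \<in> qhom UNIV E' E" using iso by (simp add: isogeny_def)
  have \<eta>: "\<eta> \<in> qhom UNIV E E'" "qcomp E' E' \<eta> \<theta> = qid E'" "qcomp E E \<theta> \<eta> = qid E"
    using qinv_isogeny[OF iso pE' E] by (simp_all add: \<eta>_def)
  define c where "c \<phi> = qcomp E E (qcomp E' E \<theta> \<phi>) \<eta>" for \<phi>
  have cl: "qcomp E' E \<theta> \<phi> \<in> qhom UNIV E' E" "qcomp E E' \<phi> \<eta> \<in> qhom UNIV E E'" "c \<phi> \<in> qhom UNIV E E"
    if "\<phi> \<in> qhom UNIV E' E'" for \<phi>
    using that \<theta> \<eta>(1) E pE' by (auto simp: c_def intro!: qcomp_closed)
  have c_back: "qcomp E' E' (qcomp E E' \<eta> (c \<phi>)) \<theta> = \<phi>" if \<phi>: "\<phi> \<in> qhom UNIV E' E'" for \<phi>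
  proof -
    have "qcomp E E' \<eta> (c \<phi>) = qcomp E E' (qcomp E' E' \<eta> (qcomp E' E \<theta> \<phi>)) \<eta>"
      unfolding c_def by (rule qcomp_assoc[symmetric, OF \<eta>(1) cl(1)[OF \<phi>] \<eta>(1) E pE' E pE'])
    also have "qcomp E' E' \<eta> (qcomp E' E \<theta> \<phi>) = \<phi>"
      using qcomp_assoc[OF \<eta>(1) \<theta> \<phi> pE' pE' E pE'] \<eta>(2) qcomp_qid(2)[OF \<phi> pE' pE'] by simp
    finally show ?thesis
      using qcomp_assoc[OF \<phi> \<eta>(1) \<theta> pE' E pE' pE'] \<eta>(2) qcomp_qid(1)[OF \<phi> pE' pE'] by simp
  qed
  have c_mult: "c (qcomp E' E' \<phi> \<psi>) = qcomp E E (c \<phi>) (c \<psi>)"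
    if \<phi>: "\<phi> \<in> qhom UNIV E' E'" and \<psi>: "\<psi> \<in> qhom UNIV E' E'" for \<phi> \<psi>
  proof -
    have "qcomp E E (c \<phi>) (c \<psi>) = qcomp E E (qcomp E' E (c \<phi>) (qcomp E' E \<theta> \<psi>)) \<eta>"
      unfolding c_def[of \<psi>] by (rule qcomp_assoc[symmetric, OF cl(3)[OF \<phi>] cl(1)[OF \<psi>] \<eta>(1) E pE' E E])
    also have "qcomp E' E (c \<phi>) (qcomp E' E \<theta> \<psi>) = qcomp E' E (qcomp E' E (c \<phi>) \<theta>) \<psi>"
      by (rule qcomp_assoc[symmetric, OF cl(3)[OF \<phi>] \<theta> \<psi> pE' pE' E E])
    also have "qcomp E' E (c \<phi>) \<theta> = qcomp E' E \<theta> \<phi>"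
      unfolding c_def using qcomp_assoc[OF cl(1)[OF \<phi>] \<eta>(1) \<theta> pE' E pE' E] \<eta>(2)
        qcomp_qid(1)[OF cl(1)[OF \<phi>] pE' E] by simp
    also have "qcomp E' E (qcomp E' E \<theta> \<phi>) \<psi> = qcomp E' E \<theta> (qcomp E' E' \<phi> \<psi>)"
      by (rule qcomp_assoc[OF \<theta> \<phi> \<psi> pE' pE' pE' E])
    finally show ?thesis by (simp add: c_def)
  qed
  have c_add: "c (qadd E' E' \<phi> \<psi>) = qadd E E (c \<phi>) (c \<psi>)"
    if \<phi>: "\<phi> \<in> qhom UNIV E' E'" and \<psi>: "\<psi> \<in> qhom UNIV E' E'" for \<phi> \<psi>
    unfolding c_def qcomp_qadd_right[OF \<phi> \<psi> \<theta> pE' E' E]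
    by (rule qcomp_qadd_left[OF cl(1)[OF \<phi>] cl(1)[OF \<psi>] \<eta>(1) E pE' gE])
  have c_one: "c (qid E') = qid E"
    unfolding c_def using qcomp_qid(1)[OF \<theta> pE' E] \<eta>(3) by simp
  have h_inv: "h (inv_into M h \<phi>) = \<phi>" "inv_into M h \<phi> \<in> M" if "\<phi> \<in> qhom UNIV E E" for \<phi>
    using that hD(5) by (auto simp: bij_betw_def f_inv_into_f inv_into_into)
  have h_eq: "inv_into M h (h x) = x" if "x \<in> M" for x
    using that hD(5) by (simp add: bij_betw_def)
  define g where "g x = inv_into M h (c (\<iota> x))" for x
  have c\<iota>: "c (\<iota> x) \<in> qhom UNIV E E" "\<iota> x \<in> qhom UNIV E' E'" if "x \<in> M" for x
    using cl(3) \<iota>D(1)[OF that] qhom_UNIV by auto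
  have hg: "h (g x) = c (\<iota> x)" "g x \<in> M" if "x \<in> M" for x
    using h_inv[OF c\<iota>(1)[OF that]] by (simp_all add: g_def)
  have "M \<subseteq> g ` M"
  proof (rule imaginary_quadratic_endo_surj[OF M])
    show "g 1 = 1"
      unfolding g_def \<iota>D(4) c_one hD(4)[symmetric] by (rule h_eq) (rule subfield_Qbar_closed(2)[OF M(2)])
    fix x y assume xy: "x \<in> M" "y \<in> M"
    have "c (\<iota> (x + y)) = h (g x + g y)"
      using xy by (simp add: \<iota>D(3) c_add c\<iota>(2) hD(3) hg)
    then show "g (x + y) = g x + g y"
      using h_eq[of "g x + g y"] subfield_Qbar_closed(3)[OF M(2) hg(2)[OF xy(1)] hg(2)[OF xy(2)]]
      by (simp add: g_def)
    have "c (\<iota> (x * y)) = h (g x * g y)"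
      using xy by (simp add: \<iota>D(2) c_mult c\<iota>(2) hD(2) hg)
    then show "g (x * y) = g x * g y"
      using h_eq[of "g x * g y"] subfield_Qbar_closed(4)[OF M(2) hg(2)[OF xy(1)] hg(2)[OF xy(2)]]
      by (simp add: g_def)
  qed
  then have "\<exists>x\<in>M. \<phi> = \<iota> x" if \<phi>: "\<phi> \<in> qhom UNIV E' E'" for \<phi>
  proof -
    obtain x where x: "x \<in> M" "inv_into M h (c \<phi>) = g x"
      using \<open>M \<subseteq> g ` M\<close> h_inv(2)[OF cl(3)[OF \<phi>]] by blast
    then have "c \<phi> = c (\<iota> x)" using hg(1) h_inv(1)[OF cl(3)[OF \<phi>]] by metis
    then show ?thesis using c_back[OF \<phi>] c_back[OF c\<iota>(2)[OF x(1)]] x(1) by metis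
  qed
  then show "qhom UNIV E' E' \<subseteq> qhom N E' E'" using \<iota>D(1) by blast
qed

lemma qcomp_qzero_left:
  assumes \<phi>: "\<phi> \<in> qhom UNIV A B" and A: "projective_group A" and B: "projective_group B"
    and C: "group_variety UNIV C"
  shows "qcomp A C (qzero B C) \<phi> = qzero A C"
proof -
  have pC: "projective_group C" using C by auto
  interpret C: comm_group C using pC by auto
  obtain f n where f: "\<phi> = qfrac A B f n" "f \<in> av_hom UNIV A B" "n > 0" using \<phi> by (rule qhomE)
  have "qcomp A C (qzero B C) \<phi> = qfrac A C ((\<lambda>x. \<one>\<^bsub>C\<^esub>) \<circ> f) (1 * n)"
    unfolding qzero_def f(1) by (rule qcomp_qfrac[OF av_hom_one[OF B C] f(2) _ f(3) A B pC]) simp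
  also have "\<dots> = qzero A C"
    unfolding qzero_def using f(3) by (intro qfrac_eqI[where k = 1] C.comm_group_axioms) auto
  finally show ?thesis .
qed

lemma same_group_gal:
  assumes "\<tau> \<in> absGal F" "same_group A B"
  shows "same_group (gal_av \<tau> A) (gal_av \<tau> B)"
  using assms(2) by (auto simp: same_group_def gal_av_simps[OF assms(1)])

text \<open>The two automorphisms differ by one that fixes L, and this leaves objects and morphisms
  over L unchanged. It makes the constructions with \<open>gal_lift\<close> independent of the
  lift.\<close>

lemma gal_agree:
  assumes \<alpha>: "\<alpha> \<in> absGal F" and \<beta>: "\<beta> \<in> absGal F" and eq: "\<And>x. x \<in> L \<Longrightarrow> \<alpha> x = \<beta> x"
    and A: "abelian_variety L A"
  shows "same_group (gal_av \<alpha> A) (gal_av \<beta> A)"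
    and "abelian_variety L B \<Longrightarrow> \<phi> \<in> qhom L A B \<Longrightarrow> gal_qmor \<alpha> \<phi> = gal_qmor \<beta> \<phi>"
proof -
  define \<rho> where "\<rho> = inv_into UNIV \<beta> \<circ> \<alpha>"
  have "\<rho> \<in> absGal F" unfolding \<rho>_def by (intro absGal_comp absGal_inv \<alpha> \<beta>)
  then have \<rho>: "\<rho> \<in> absGal L"
    using eq absGalD(8)[OF \<beta>] by (auto simp: absGal_iff \<rho>_def)
  have \<alpha>_eq: "\<alpha> = \<beta> \<circ> \<rho>" using absGalD(7)[OF \<beta>] by (auto simp: \<rho>_def)
  show "same_group (gal_av \<alpha> A) (gal_av \<beta> A)"
    unfolding \<alpha>_eq gal_av_comp[OF \<beta> \<rho>, symmetric]
    by (rule same_group_gal[OF \<beta> gal_av_same_group[OF A \<rho>]])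
  show "gal_qmor \<alpha> \<phi> = gal_qmor \<beta> \<phi>" if "abelian_variety L B" "\<phi> \<in> qhom L A B"
    unfolding \<alpha>_eq gal_qmor_comp[OF \<beta> \<rho>, symmetric] gal_qmor_fixed[OF A that(1) \<rho> that(2)] ..
qed


section \<open>The representations on \<open>V\<close>, \<open>R\<close> and \<open>T\<close>\<close>

lemma abelian_group_qhom:
  assumes "projective_group B" "group_variety F C"
    and "carrier W = qhom F B C" "\<And>f g. f \<oplus>\<^bsub>W\<^esub> g = qadd B C f g" "\<zero>\<^bsub>W\<^esub> = qzero B C"
  shows "abelian_group W"
proof (rule abelian_groupI)
  have C: "comm_group C" "group_variety UNIV C" using assms(2) group_variety_mono by auto
  fix x assume x: "x \<in> carrier W"
  show "\<zero>\<^bsub>W\<^esub> \<oplus>\<^bsub>W\<^esub> x = x"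
    using x assms C(2) qadd_qzero[OF qhom_UNIV, of x F B C] by simp
  show "\<exists>y\<in>carrier W. y \<oplus>\<^bsub>W\<^esub> x = \<zero>\<^bsub>W\<^esub>"
    using x assms qadd_inverse[of x F B C] by simp
  fix y assume y: "y \<in> carrier W"
  show "x \<oplus>\<^bsub>W\<^esub> y \<in> carrier W" using x y assms qadd_closed by simp
  show "x \<oplus>\<^bsub>W\<^esub> y = y \<oplus>\<^bsub>W\<^esub> x"
    using x y assms C(1) qadd_commute[OF qhom_UNIV qhom_UNIV, of x F B C y F] by simp
  fix z assume z: "z \<in> carrier W"
  show "x \<oplus>\<^bsub>W\<^esub> y \<oplus>\<^bsub>W\<^esub> z = x \<oplus>\<^bsub>W\<^esub> (y \<oplus>\<^bsub>W\<^esub> z)"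
    using x y z assms C(2) qadd_assoc[OF qhom_UNIV qhom_UNIV qhom_UNIV, of x F B C y F z F] by simp
qed (use assms qzero_closed in simp)

text \<open>The situation over L alone. E has been eliminated: its decomposition of A is moved to
  \<open>Es\<close>, the isogenies \<open>\<mu> \<sigma>\<close> and the image of \<iota> are
  regarded over L, and \<iota> is already onto the geometric endomorphisms of
  \<open>Es\<close>.\<close>

locale ribet_representation =
  fixes M K L :: "qbar set" and A Es :: "point monoid" and \<iota> j :: "qbar \<Rightarrow> qmor"
    and \<mu> :: "(qbar \<Rightarrow> qbar) \<Rightarrow> qmor" and i\<^sub>1 i\<^sub>2 p\<^sub>1 p\<^sub>2 :: qmor
  assumes M_subfield: "subfield M Qbar" and M_L: "M \<subseteq> L" and K_L: "K \<subseteq> L" and K_subfield: "subfield K Qbar"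
    and L_finite: "finite_extension \<rat> L"
    and A_variety: "abelian_variety \<rat> A" and Es_variety: "abelian_variety L Es"
    and K_end: "qhom K A A = qhom UNIV A A"
    and \<iota>_iso: "\<iota> \<in> ring_iso (fld M) (qend UNIV Es)" and \<iota>_L: "\<iota> ` M \<subseteq> qhom L Es Es"
    and \<mu>_isogeny: "\<And>\<sigma>. \<sigma> \<in> carrier (Gal L M) \<Longrightarrow> isogeny L (gal_av (gal_lift L \<sigma>) Es) Es (\<mu> \<sigma>)"
    and \<mu>_compatible: "\<And>\<sigma> \<phi>. \<sigma> \<in> carrier (Gal L M) \<Longrightarrow> \<phi> \<in> qhom UNIV Es Es \<Longrightarrow>
      qcomp (gal_av (gal_lift L \<sigma>) Es) Es (\<mu> \<sigma>) (gal_qmor (gal_lift L \<sigma>) \<phi>) =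
      qcomp (gal_av (gal_lift L \<sigma>) Es) Es \<phi> (\<mu> \<sigma>)"
    and \<mu>_one: "\<mu> \<one>\<^bsub>Gal L M\<^esub> = qid Es"
    and j_iso: "j \<in> ring_iso (fld M) (qend_center K A)"
    and j_compat: "\<And>m f. m \<in> M \<Longrightarrow> f \<in> qhom L Es A \<Longrightarrow> qcomp Es A (j m) f = qcomp Es A f (\<iota> m)"
    and decomposition: "i\<^sub>1 \<in> qhom L Es A" "i\<^sub>2 \<in> qhom L Es A" "p\<^sub>1 \<in> qhom L A Es" "p\<^sub>2 \<in> qhom L A Es"
      "qadd A A (qcomp A A i\<^sub>1 p\<^sub>1) (qcomp A A i\<^sub>2 p\<^sub>2) = qid A"
begin

abbreviation "G \<equiv> Gal L M"
abbreviation "V \<equiv> V_module L Es A \<iota>"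
abbreviation "R \<equiv> R_module K A j"
abbreviation "T \<equiv> hom_module (fld M) V V"
abbreviation "\<rho>\<^sub>V \<equiv> V_rep L Es A \<mu>"
abbreviation "\<Phi> \<equiv> Phi L Es A"
abbreviation "lift \<equiv> gal_lift L"
abbreviation "twist \<sigma> \<equiv> gal_av (lift \<sigma>) Es"
abbreviation "\<nu> \<sigma> \<equiv> qinv (twist \<sigma>) Es (\<mu> \<sigma>)"

lemma L_subfield: "subfield L Qbar"
  using L_finite by (simp add: finite_extension_def)

lemma field_M: "field (fld M)"
  using ring.subfield_iff(2)[OF Qbar_ring M_subfield] by (simp add: fld_def)

lemma cring_M: "cring (fld M)"
  using field_M by (simp add: field_def domain_def)

lemmas M_closed = subfield_Qbar_closed[OF M_subfield]

lemma gvA: "group_variety F A" if "\<rat> \<subseteq> F"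
  using group_variety_mono[OF abelian_variety_group_variety[OF A_variety] that] .

lemma gvA' [simp]: "group_variety UNIV A" "group_variety L A" "group_variety K A"
  using gvA subfield_Rats[OF L_subfield] subfield_Rats[OF K_subfield] by auto

lemma gvEs [simp]: "group_variety L Es" "group_variety UNIV Es"
  using abelian_variety_group_variety[OF Es_variety] group_variety_mono[of L Es UNIV] by auto

lemma pgA [simp]: "projective_group A" and pgEs [simp]: "projective_group Es"
  using gvA'(1) gvEs(1) group_variety_projective by blast+

lemma A_L: "abelian_variety L A"
  using abelian_variety_mono[OF A_variety subfield_Rats[OF L_subfield]] .

lemma A_K: "abelian_variety K A"
  using abelian_variety_mono[OF A_variety subfield_Rats[OF K_subfield]] .

lemma end_A: "qhom L A A = qhom UNIV A A" "qhom K A A = qhom UNIV A A"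
  using K_end qhom_mono[OF K_L, of A A] qhom_mono[of L UNIV A A] by auto

lemmas \<iota>D = ring_iso_qendD[OF \<iota>_iso]

lemma \<iota>_surj: "\<phi> \<in> qhom UNIV Es Es \<Longrightarrow> \<exists>m\<in>M. \<phi> = \<iota> m"
  using \<iota>D(5) by (auto simp: bij_betw_def)

lemma \<iota>_closed: "m \<in> M \<Longrightarrow> \<iota> m \<in> qhom L Es Es"
  using \<iota>_L by blast

lemma jD:
  shows "m \<in> M \<Longrightarrow> j m \<in> qhom UNIV A A" "m \<in> M \<Longrightarrow> n \<in> M \<Longrightarrow> j (m * n) = qcomp A A (j m) (j n)"
    "m \<in> M \<Longrightarrow> n \<in> M \<Longrightarrow> j (m + n) = qadd A A (j m) (j n)" "j 1 = qid A" "inj_on j M"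
  using j_iso unfolding K_end[symmetric]
  by (auto simp: ring_iso_def ring_hom_def qend_center_def qend_simps bij_betw_def)

section \<open>The vector spaces V, R and T\<close>

lemma V_simps:
  "carrier V = qhom L Es A" "f \<oplus>\<^bsub>V\<^esub> g = qadd Es A f g" "\<zero>\<^bsub>V\<^esub> = qzero Es A"
  "m \<odot>\<^bsub>V\<^esub> f = qcomp Es A f (\<iota> m)"
  by (simp_all add: V_module_def)

lemma R_simps:
  "carrier R = qhom UNIV A A" "f \<oplus>\<^bsub>R\<^esub> g = qadd A A f g" "\<zero>\<^bsub>R\<^esub> = qzero A A"
  "m \<odot>\<^bsub>R\<^esub> f = qcomp A A (j m) f"
  by (simp_all add: R_module_def K_end)

lemma T_simps:
  "carrier T = linear_maps (fld M) V V \<inter> extensional (carrier V)"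
  "f \<oplus>\<^bsub>T\<^esub> g = (\<lambda>v\<in>carrier V. f v \<oplus>\<^bsub>V\<^esub> g v)" "\<zero>\<^bsub>T\<^esub> = (\<lambda>v\<in>carrier V. \<zero>\<^bsub>V\<^esub>)"
  "m \<odot>\<^bsub>T\<^esub> f = (\<lambda>v\<in>carrier V. m \<odot>\<^bsub>V\<^esub> f v)"
  by (simp_all add: hom_module_def)

text \<open>All endomorphisms of A are defined over K and hence over L, so V is stable under
  them.\<close>

lemma comp_V: "\<psi> \<in> qhom UNIV A A \<Longrightarrow> f \<in> qhom L Es A \<Longrightarrow> qcomp Es A \<psi> f \<in> qhom L Es A"
  using qcomp_closed[of \<psi> L A A f Es] end_A by simp

lemma smult_V: "m \<in> M \<Longrightarrow> f \<in> qhom L Es A \<Longrightarrow> qcomp Es A f (\<iota> m) \<in> qhom L Es A"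
  using qcomp_closed[OF _ \<iota>_closed, of f A m] by simp

lemma module_V: "module (fld M) V"
proof (rule moduleI)
  show "cring (fld M)" by (rule cring_M)
  show "abelian_group V" by (rule abelian_group_qhom[of Es L A]) (simp_all add: V_simps)
  fix a x assume "a \<in> carrier (fld M)" "x \<in> carrier V"
  then have a: "a \<in> M" "\<iota> a \<in> qhom UNIV Es Es" and x: "x \<in> qhom L Es A" "x \<in> qhom UNIV Es A"
    using \<iota>D(1) qhom_UNIV by (auto simp: V_simps)
  show "a \<odot>\<^bsub>V\<^esub> x \<in> carrier V" using smult_V[OF a(1) x(1)] by (simp add: V_simps)
  {
    fix b assume "b \<in> carrier (fld M)"
    then have b: "b \<in> M" "\<iota> b \<in> qhom UNIV Es Es" using \<iota>D(1) by auto
    show "(a \<oplus>\<^bsub>fld M\<^esub> b) \<odot>\<^bsub>V\<^esub> x = a \<odot>\<^bsub>V\<^esub> x \<oplus>\<^bsub>V\<^esub> b \<odot>\<^bsub>V\<^esub> x"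
      using a b x by (simp add: V_simps \<iota>D(3) qcomp_qadd_right)
    \<comment> \<open>Scalars act by precomposition, which reverses their order; M is
      commutative.\<close>
    have "qcomp Es A x (\<iota> (b * a)) = qcomp Es A (qcomp Es A x (\<iota> b)) (\<iota> a)"
      using a b x by (simp add: \<iota>D(2) qcomp_assoc)
    then show "(a \<otimes>\<^bsub>fld M\<^esub> b) \<odot>\<^bsub>V\<^esub> x = a \<odot>\<^bsub>V\<^esub> (b \<odot>\<^bsub>V\<^esub> x)"
      by (simp add: V_simps mult.commute)
  next
    fix y assume "y \<in> carrier V"
    then have y: "y \<in> qhom UNIV Es A" using qhom_UNIV by (auto simp: V_simps)
    show "a \<odot>\<^bsub>V\<^esub> (x \<oplus>\<^bsub>V\<^esub> y) = a \<odot>\<^bsub>V\<^esub> x \<oplus>\<^bsub>V\<^esub> a \<odot>\<^bsub>V\<^esub> y"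
      using a x y by (simp add: V_simps qcomp_qadd_left)
  }
next
  fix x assume "x \<in> carrier V"
  then show "\<one>\<^bsub>fld M\<^esub> \<odot>\<^bsub>V\<^esub> x = x" using qhom_UNIV by (simp add: V_simps \<iota>D(4) qcomp_qid(1))
qed

lemma module_R: "module (fld M) R"
proof (rule moduleI)
  show "cring (fld M)" by (rule cring_M)
  show "abelian_group R" by (rule abelian_group_qhom[of A UNIV A]) (simp_all add: R_simps)
  fix a x assume "a \<in> carrier (fld M)" "x \<in> carrier R"
  then have a: "a \<in> M" "j a \<in> qhom UNIV A A" and x: "x \<in> qhom UNIV A A"
    using jD(1) by (auto simp: R_simps)
  show "a \<odot>\<^bsub>R\<^esub> x \<in> carrier R" using a x by (simp add: R_simps qcomp_closed)
  {
    fix b assume "b \<in> carrier (fld M)"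
    then have b: "b \<in> M" "j b \<in> qhom UNIV A A" using jD(1) by auto
    show "(a \<oplus>\<^bsub>fld M\<^esub> b) \<odot>\<^bsub>R\<^esub> x = a \<odot>\<^bsub>R\<^esub> x \<oplus>\<^bsub>R\<^esub> b \<odot>\<^bsub>R\<^esub> x"
      using a b x by (simp add: R_simps jD(3) qcomp_qadd_left)
    show "(a \<otimes>\<^bsub>fld M\<^esub> b) \<odot>\<^bsub>R\<^esub> x = a \<odot>\<^bsub>R\<^esub> (b \<odot>\<^bsub>R\<^esub> x)"
      using a b x by (simp add: R_simps jD(2) qcomp_assoc)
  next
    fix y assume "y \<in> carrier R"
    then have y: "y \<in> qhom UNIV A A" by (simp add: R_simps)
    show "a \<odot>\<^bsub>R\<^esub> (x \<oplus>\<^bsub>R\<^esub> y) = a \<odot>\<^bsub>R\<^esub> x \<oplus>\<^bsub>R\<^esub> a \<odot>\<^bsub>R\<^esub> y"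
      using a x y by (simp add: R_simps qcomp_qadd_right)
  }
next
  fix x assume "x \<in> carrier R"
  then show "\<one>\<^bsub>fld M\<^esub> \<odot>\<^bsub>R\<^esub> x = x" by (simp add: R_simps jD(4) qcomp_qid(2))
qed

lemmas decomposition_UNIV = decomposition(1-4)[THEN qhom_UNIV]

text \<open>Used with source \<open>Es\<close> for coordinates on V and with source A for spanning
  R.\<close>

lemma decompose_left:
  assumes f: "f \<in> qhom UNIV B A" and B: "projective_group B"
  shows "f = qadd B A (qcomp B A i\<^sub>1 (qcomp B Es p\<^sub>1 f)) (qcomp B A i\<^sub>2 (qcomp B Es p\<^sub>2 f))"
proof -
  have cl: "qcomp A A i\<^sub>1 p\<^sub>1 \<in> qhom UNIV A A" "qcomp A A i\<^sub>2 p\<^sub>2 \<in> qhom UNIV A A"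
    using decomposition_UNIV by (simp_all add: qcomp_closed)
  have "f = qcomp B A (qadd A A (qcomp A A i\<^sub>1 p\<^sub>1) (qcomp A A i\<^sub>2 p\<^sub>2)) f"
    using decomposition(5) f B by (simp add: qcomp_qid(2))
  also have "\<dots> = qadd B A (qcomp B A (qcomp A A i\<^sub>1 p\<^sub>1) f) (qcomp B A (qcomp A A i\<^sub>2 p\<^sub>2) f)"
    using cl f B by (simp add: qcomp_qadd_left)
  finally show ?thesis using decomposition_UNIV f B by (simp add: qcomp_assoc)
qed

lemma decompose_right:
  assumes f: "\<psi> \<in> qhom UNIV A A"
  shows "\<psi> = qadd A A (qcomp A A (qcomp Es A \<psi> i\<^sub>1) p\<^sub>1) (qcomp A A (qcomp Es A \<psi> i\<^sub>2) p\<^sub>2)"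
proof -
  have cl: "qcomp A A i\<^sub>1 p\<^sub>1 \<in> qhom UNIV A A" "qcomp A A i\<^sub>2 p\<^sub>2 \<in> qhom UNIV A A"
    using decomposition_UNIV by (simp_all add: qcomp_closed)
  have "\<psi> = qcomp A A \<psi> (qadd A A (qcomp A A i\<^sub>1 p\<^sub>1) (qcomp A A i\<^sub>2 p\<^sub>2))"
    using decomposition(5) f by (simp add: qcomp_qid(1))
  also have "\<dots> = qadd A A (qcomp A A \<psi> (qcomp A A i\<^sub>1 p\<^sub>1)) (qcomp A A \<psi> (qcomp A A i\<^sub>2 p\<^sub>2))"
    using cl f by (simp add: qcomp_qadd_right)
  finally show ?thesis using decomposition_UNIV f by (simp add: qcomp_assoc)
qed

text \<open>The scalars are identified as composites with \<open>p\<^sub>1\<close> and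
  \<open>p\<^sub>2\<close>, because the proof that \<open>\<Phi>\<close> is onto has to recognise
  them.\<close>

lemma V_combination:
  assumes f: "f \<in> qhom L Es A"
  obtains m\<^sub>1 m\<^sub>2 where "m\<^sub>1 \<in> M" "m\<^sub>2 \<in> M" "qcomp Es Es p\<^sub>1 f = \<iota> m\<^sub>1" "qcomp Es Es p\<^sub>2 f = \<iota> m\<^sub>2"
    "f = m\<^sub>1 \<odot>\<^bsub>V\<^esub> i\<^sub>1 \<oplus>\<^bsub>V\<^esub> m\<^sub>2 \<odot>\<^bsub>V\<^esub> i\<^sub>2"
proof -
  have f': "f \<in> qhom UNIV Es A" using f by (rule qhom_UNIV)
  have "qcomp Es Es p\<^sub>1 f \<in> qhom UNIV Es Es" "qcomp Es Es p\<^sub>2 f \<in> qhom UNIV Es Es"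
    using decomposition_UNIV f' by (simp_all add: qcomp_closed)
  then obtain m\<^sub>1 m\<^sub>2 where "m\<^sub>1 \<in> M" "m\<^sub>2 \<in> M" "qcomp Es Es p\<^sub>1 f = \<iota> m\<^sub>1" "qcomp Es Es p\<^sub>2 f = \<iota> m\<^sub>2"
    using \<iota>_surj by metis
  with decompose_left[OF f' pgEs] that show thesis by (simp add: V_simps)
qed

lemma findim_V: "findim_space (fld M) V"
proof (rule findim_spaceI[OF field_M module_V, of "{i\<^sub>1, i\<^sub>2}"])
  show "{i\<^sub>1, i\<^sub>2} \<subseteq> carrier V" using decomposition by (simp add: V_simps)
  fix S assume S: "{i\<^sub>1, i\<^sub>2} \<subseteq> S" "\<And>u v. u \<in> S \<Longrightarrow> v \<in> S \<Longrightarrow> u \<oplus>\<^bsub>V\<^esub> v \<in> S"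
    "\<And>a v. a \<in> carrier (fld M) \<Longrightarrow> v \<in> S \<Longrightarrow> a \<odot>\<^bsub>V\<^esub> v \<in> S"
  show "carrier V \<subseteq> S"
  proof
    fix f assume "f \<in> carrier V"
    then obtain m\<^sub>1 m\<^sub>2 where "m\<^sub>1 \<in> M" "m\<^sub>2 \<in> M" "f = m\<^sub>1 \<odot>\<^bsub>V\<^esub> i\<^sub>1 \<oplus>\<^bsub>V\<^esub> m\<^sub>2 \<odot>\<^bsub>V\<^esub> i\<^sub>2"
      unfolding V_simps(1) by (rule V_combination)
    then show "f \<in> S" using S by simp
  qed
qed simp

text \<open>The inner part, \<open>i'\<close> followed by \<open>\<psi>\<close> and
  \<open>p\<close>, is an endomorphism of \<open>Es\<close>, hence a scalar of M. By
  \<open>j_compat\<close> this scalar, which acts by precomposition on \<open>i\<close>, equals the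
  central action on R and can be taken out.\<close>

lemma R_corner:
  assumes "i \<in> qhom L Es A" "p \<in> qhom L A Es" "i' \<in> qhom L Es A" "p' \<in> qhom L A Es" "\<psi> \<in> qhom UNIV A A"
  shows "\<exists>m\<in>M. qcomp A A (qcomp A A i (qcomp A Es p \<psi>)) (qcomp A A i' p') = m \<odot>\<^bsub>R\<^esub> qcomp A A i p'"
proof -
  note h = assms(1-4)[THEN qhom_UNIV] assms(5)
  have 1: "qcomp A Es p \<psi> \<in> qhom UNIV A Es" by (rule qcomp_closed[OF h(2,5)]) simp_all
  have "qcomp Es Es (qcomp A Es p \<psi>) i' \<in> qhom UNIV Es Es" by (rule qcomp_closed[OF 1 h(3)]) simp_all
  then obtain m where m: "m \<in> M" "qcomp Es Es (qcomp A Es p \<psi>) i' = \<iota> m" using \<iota>_surj by blast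
  have \<iota>m: "\<iota> m \<in> qhom UNIV Es Es" using m(1) by (rule \<iota>D(1))
  have "qcomp A A (qcomp A A i (qcomp A Es p \<psi>)) (qcomp A A i' p') =
      qcomp A A i (qcomp A Es (qcomp A Es p \<psi>) (qcomp A A i' p'))"
    using h 1 by (simp add: qcomp_assoc qcomp_closed)
  also have "qcomp A Es (qcomp A Es p \<psi>) (qcomp A A i' p') = qcomp A Es (\<iota> m) p'"
    unfolding m(2)[symmetric] using h 1 by (intro qcomp_assoc[symmetric]) simp_all
  also have "qcomp A A i (qcomp A Es (\<iota> m) p') = qcomp A A (qcomp Es A i (\<iota> m)) p'"
    using h \<iota>m by (intro qcomp_assoc[symmetric]) simp_all
  also have "\<dots> = qcomp A A (qcomp Es A (j m) i) p'" using j_compat[OF m(1) assms(1)] by simp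
  also have "\<dots> = qcomp A A (j m) (qcomp A A i p')"
    using h jD(1)[OF m(1)] by (intro qcomp_assoc) simp_all
  finally show ?thesis using m(1) by (auto simp: R_simps)
qed

text \<open>Inserting the decomposed identity on both sides of an endomorphism writes it as a
  combination of the four products of an \<open>i\<close> with a \<open>p\<close>, in the manner of
  matrix units.\<close>

lemma findim_R: "findim_space (fld M) R"
proof (rule findim_spaceI[OF field_M module_R])
  let ?B = "{qcomp A A i\<^sub>1 p\<^sub>1, qcomp A A i\<^sub>1 p\<^sub>2, qcomp A A i\<^sub>2 p\<^sub>1, qcomp A A i\<^sub>2 p\<^sub>2}"
  show "finite ?B" by simp
  show "?B \<subseteq> carrier R" using decomposition_UNIV by (simp add: R_simps qcomp_closed)
  fix S assume S: "?B \<subseteq> S" "\<And>u v. u \<in> S \<Longrightarrow> v \<in> S \<Longrightarrow> u \<oplus>\<^bsub>R\<^esub> v \<in> S"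
    "\<And>a v. a \<in> carrier (fld M) \<Longrightarrow> v \<in> S \<Longrightarrow> a \<odot>\<^bsub>R\<^esub> v \<in> S"
  note d = decomposition_UNIV
  have e: "qcomp A A i\<^sub>1 p\<^sub>1 \<in> qhom UNIV A A" "qcomp A A i\<^sub>2 p\<^sub>2 \<in> qhom UNIV A A"
    using d by (simp_all add: qcomp_closed)
  \<comment> \<open>Insertion of the identity on the right; \<open>decompose_left\<close> does the
    same on the left.\<close>
  have split: "qcomp A A \<chi> (qcomp A A i\<^sub>1 p\<^sub>1) \<in> S \<Longrightarrow> qcomp A A \<chi> (qcomp A A i\<^sub>2 p\<^sub>2) \<in> S \<Longrightarrow> \<chi> \<in> S"
    if "\<chi> \<in> qhom UNIV A A" for \<chi>
    using S(2) decomposition(5) qcomp_qadd_right[OF e that] qcomp_qid(1)[OF that]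
    by (simp add: R_simps) metis
  have corner: "qcomp A A (qcomp A A i (qcomp A Es p \<psi>)) (qcomp A A i' p') \<in> S"
    if "i \<in> qhom L Es A" "p \<in> qhom L A Es" "i' \<in> qhom L Es A" "p' \<in> qhom L A Es" "\<psi> \<in> qhom UNIV A A"
      "qcomp A A i p' \<in> S" for i p i' p' \<psi>
    using R_corner[OF that(1-5)] S(3) that(6) by auto
  show "carrier R \<subseteq> S"
  proof
    fix \<psi> assume "\<psi> \<in> carrier R"
    then have \<psi>: "\<psi> \<in> qhom UNIV A A" by (simp add: R_simps)
    have cl: "qcomp A A i\<^sub>1 (qcomp A Es p\<^sub>1 \<psi>) \<in> qhom UNIV A A" "qcomp A A i\<^sub>2 (qcomp A Es p\<^sub>2 \<psi>) \<in> qhom UNIV A A"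
      by (rule qcomp_closed[OF d(1) qcomp_closed[OF d(3) \<psi>]] qcomp_closed[OF d(2) qcomp_closed[OF d(4) \<psi>]];
          simp)+
    have "qcomp A A i\<^sub>1 (qcomp A Es p\<^sub>1 \<psi>) \<in> S"
      by (rule split[OF cl(1) corner[OF decomposition(1,3,1,3) \<psi>] corner[OF decomposition(1,3,2,4) \<psi>]])
         (use S(1) in simp_all)
    moreover have "qcomp A A i\<^sub>2 (qcomp A Es p\<^sub>2 \<psi>) \<in> S"
      by (rule split[OF cl(2) corner[OF decomposition(2,4,1,3) \<psi>] corner[OF decomposition(2,4,2,4) \<psi>]])
         (use S(1) in simp_all)
    ultimately have "qadd A A (qcomp A A i\<^sub>1 (qcomp A Es p\<^sub>1 \<psi>)) (qcomp A A i\<^sub>2 (qcomp A Es p\<^sub>2 \<psi>)) \<in> S"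
      using S(2) by (simp add: R_simps)
    then show "\<psi> \<in> S" by (simp only: decompose_left[OF \<psi> pgA, symmetric])
  qed
qed

section \<open>The linear bijection Phi\<close>

lemma Phi_apply: "f \<in> qhom L Es A \<Longrightarrow> \<Phi> \<psi> f = qcomp Es A \<psi> f"
  by (simp add: Phi_def)

lemma Phi_closed:
  assumes "\<psi> \<in> carrier R"
  shows "\<Phi> \<psi> \<in> carrier T"
proof -
  have \<psi>: "\<psi> \<in> qhom UNIV A A" using assms by (simp add: R_simps)
  have "\<Phi> \<psi> \<in> linear_maps (fld M) V V"
    unfolding linear_maps_def V_simps
  proof (intro CollectI conjI ballI Pi_I)
    fix f assume f: "f \<in> qhom L Es A"
    show "\<Phi> \<psi> f \<in> qhom L Es A" using f \<psi> by (simp add: Phi_apply comp_V)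
    fix g assume g: "g \<in> qhom L Es A"
    have "qadd Es A f g \<in> qhom L Es A" using f g by (simp add: qadd_closed)
    then show "\<Phi> \<psi> (qadd Es A f g) = qadd Es A (\<Phi> \<psi> f) (\<Phi> \<psi> g)"
      using \<psi> f g qhom_UNIV by (simp add: Phi_apply qcomp_qadd_right)
  next
    fix a f assume a: "a \<in> carrier (fld M)" and f: "f \<in> qhom L Es A"
    then have "qcomp Es A f (\<iota> a) \<in> qhom L Es A" using smult_V by simp
    then show "\<Phi> \<psi> (qcomp Es A f (\<iota> a)) = qcomp Es A (\<Phi> \<psi> f) (\<iota> a)"
      using \<psi> f a qhom_UNIV \<iota>D(1) by (simp add: Phi_apply qcomp_assoc)
  qed
  then show ?thesis by (simp add: T_simps V_simps Phi_def)
qed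

lemma Phi_linear: "\<Phi> \<in> linear_maps (fld M) R T"
  unfolding linear_maps_def
proof (intro CollectI conjI ballI Pi_I)
  fix x assume x: "x \<in> carrier R"
  show "\<Phi> x \<in> carrier T" by (rule Phi_closed[OF x])
  fix y assume y: "y \<in> carrier R"
  show "\<Phi> (x \<oplus>\<^bsub>R\<^esub> y) = \<Phi> x \<oplus>\<^bsub>T\<^esub> \<Phi> y"
    unfolding T_simps V_simps R_simps Phi_def
    using x y qhom_UNIV by (intro restrict_ext) (simp add: R_simps qcomp_qadd_left)
next
  fix a x assume a: "a \<in> carrier (fld M)" and x: "x \<in> carrier R"
  show "\<Phi> (a \<odot>\<^bsub>R\<^esub> x) = a \<odot>\<^bsub>T\<^esub> \<Phi> x"
    unfolding T_simps V_simps R_simps Phi_def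
  proof (rule restrict_ext)
    fix f assume f: "f \<in> qhom L Es A"
    have x': "x \<in> qhom UNIV A A" using x by (simp add: R_simps)
    have "qcomp Es A (qcomp A A (j a) x) f = qcomp Es A (j a) (qcomp Es A x f)"
      using x' a qhom_UNIV[OF f] jD(1) by (intro qcomp_assoc) simp_all
    \<comment> \<open>The composite of \<open>x\<close> and \<open>f\<close> lies in V again, so the
      central action on it can be replaced by precomposition.\<close>
    also have "\<dots> = qcomp Es A (qcomp Es A x f) (\<iota> a)"
      using a comp_V[OF x' f] by (intro j_compat) simp_all
    finally show "qcomp Es A (qcomp A A (j a) x) f = qcomp Es A ((\<lambda>f\<in>qhom L Es A. qcomp Es A x f) f) (\<iota> a)"
      using f by simp
  qed
qed

lemma Phi_inj: "inj_on \<Phi> (carrier R)"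
proof (rule inj_onI)
  fix \<psi> \<psi>' assume \<psi>: "\<psi> \<in> carrier R" "\<psi>' \<in> carrier R" and eq: "\<Phi> \<psi> = \<Phi> \<psi>'"
  have "qcomp Es A \<psi> f = qcomp Es A \<psi>' f" if "f \<in> qhom L Es A" for f
    using eq Phi_apply[OF that] by metis
  then show "\<psi> = \<psi>'"
    using decompose_right[of \<psi>] decompose_right[of \<psi>'] \<psi> decomposition(1,2) by (simp add: R_simps)
qed

lemma Phi_surj: "\<Phi> ` carrier R = carrier T"
proof
  show "\<Phi> ` carrier R \<subseteq> carrier T" using Phi_closed by blast
  show "carrier T \<subseteq> \<Phi> ` carrier R"
  proof
    fix g assume g: "g \<in> carrier T"
    then have gl: "g \<in> linear_maps (fld M) V V" and ge: "g \<in> extensional (qhom L Es A)"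
      by (auto simp: T_simps V_simps)
    note gD = linear_mapsD[OF gl]
    have gi: "g i\<^sub>1 \<in> qhom L Es A" "g i\<^sub>2 \<in> qhom L Es A"
      using gD(1) decomposition by (auto simp: V_simps)
    define \<psi> where "\<psi> = qadd A A (qcomp A A (g i\<^sub>1) p\<^sub>1) (qcomp A A (g i\<^sub>2) p\<^sub>2)"
    note h = gi[THEN qhom_UNIV] decomposition_UNIV
    have cl: "qcomp A A (g i\<^sub>1) p\<^sub>1 \<in> qhom UNIV A A" "qcomp A A (g i\<^sub>2) p\<^sub>2 \<in> qhom UNIV A A"
      using h by (simp_all add: qcomp_closed)
    have \<psi>: "\<psi> \<in> carrier R" using cl by (simp add: \<psi>_def R_simps qadd_closed)
    have "\<Phi> \<psi> = g"
    proof (rule extensionalityI[of _ "qhom L Es A"])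
      fix f assume f: "f \<in> qhom L Es A"
      note f' = qhom_UNIV[OF f]
      obtain m\<^sub>1 m\<^sub>2 where m: "m\<^sub>1 \<in> M" "m\<^sub>2 \<in> M" "qcomp Es Es p\<^sub>1 f = \<iota> m\<^sub>1" "qcomp Es Es p\<^sub>2 f = \<iota> m\<^sub>2"
        "f = m\<^sub>1 \<odot>\<^bsub>V\<^esub> i\<^sub>1 \<oplus>\<^bsub>V\<^esub> m\<^sub>2 \<odot>\<^bsub>V\<^esub> i\<^sub>2" using f by (rule V_combination)
      have "\<Phi> \<psi> f = qadd Es A (qcomp Es A (g i\<^sub>1) (\<iota> m\<^sub>1)) (qcomp Es A (g i\<^sub>2) (\<iota> m\<^sub>2))"
        using f f' h cl by (simp add: Phi_apply \<psi>_def qcomp_qadd_left qcomp_assoc m(3,4))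
      also have "\<dots> = g f"
      proof -
        have "m\<^sub>1 \<odot>\<^bsub>V\<^esub> i\<^sub>1 \<in> carrier V" "m\<^sub>2 \<odot>\<^bsub>V\<^esub> i\<^sub>2 \<in> carrier V"
          using smult_V m(1,2) decomposition by (simp_all add: V_simps)
        then have "g f = g (m\<^sub>1 \<odot>\<^bsub>V\<^esub> i\<^sub>1) \<oplus>\<^bsub>V\<^esub> g (m\<^sub>2 \<odot>\<^bsub>V\<^esub> i\<^sub>2)"
          unfolding m(5) by (rule gD(2))
        also have "\<dots> = m\<^sub>1 \<odot>\<^bsub>V\<^esub> g i\<^sub>1 \<oplus>\<^bsub>V\<^esub> m\<^sub>2 \<odot>\<^bsub>V\<^esub> g i\<^sub>2"
          using gD(3) m(1,2) decomposition by (simp add: V_simps(1))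
        finally show ?thesis by (simp add: V_simps)
      qed
      finally show "\<Phi> \<psi> f = g f" .
    qed (use ge in \<open>simp_all add: Phi_def\<close>)
    with \<psi> show "g \<in> \<Phi> ` carrier R" by blast
  qed
qed

lemma Phi_bij: "bij_betw \<Phi> (carrier R) (carrier T)"
  using Phi_inj Phi_surj by (simp add: bij_betw_def)

lemma Phi_zero: "\<Phi> \<zero>\<^bsub>R\<^esub> = \<zero>\<^bsub>T\<^esub>"
  unfolding Phi_def T_simps V_simps R_simps
  using qhom_UNIV by (intro restrict_ext qcomp_qzero_left) simp_all

text \<open>If V were zero, so would be T, and injectivity of \<open>\<Phi>\<close> would force
  \<open>j 1 = j 0\<close>, although \<open>j\<close> is injective on M. This keeps the values of
  the cocycle away from zero.\<close>

lemma V_nontrivial: "carrier V \<noteq> {\<zero>\<^bsub>V\<^esub>}"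
proof
  assume V: "carrier V = {\<zero>\<^bsub>V\<^esub>}"
  have "\<Phi> (j 1) = \<Phi> (j 0)"
  proof (rule extensionalityI[of _ "carrier V"])
    have j: "j 1 \<in> carrier R" "j 0 \<in> carrier R" using jD(1) M_closed by (simp_all add: R_simps)
    show "\<Phi> (j 1) \<in> extensional (carrier V)" "\<Phi> (j 0) \<in> extensional (carrier V)"
      by (simp_all add: Phi_def V_simps)
    fix f assume f: "f \<in> carrier V"
    have "\<Phi> (j 1) f \<in> carrier V" "\<Phi> (j 0) f \<in> carrier V"
      using f linear_mapsD(1)[of _ "fld M" V V f] Phi_closed[OF j(1)] Phi_closed[OF j(2)]
      by (auto simp: T_simps(1))
    then show "\<Phi> (j 1) f = \<Phi> (j 0) f" using V by simp
  qed
  then have "j 1 = j 0" using Phi_inj jD(1) M_closed by (auto simp: inj_on_def R_simps)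
  from inj_onD[OF jD(5) this] show False using M_closed(1,2) by simp
qed

section \<open>Conjugation and the twisting isogenies\<close>

lemmas lift_M = gal_lift(1)[OF L_subfield M_subfield M_L]
lemmas lift_eq = gal_lift(2)[OF L_subfield M_subfield M_L]
lemmas lift_L = gal_lift(3)[OF L_subfield M_subfield M_L]

lemma lift_Rats: "\<sigma> \<in> carrier G \<Longrightarrow> lift \<sigma> \<in> absGal \<rat>"
  using absGal_mono[OF lift_M subfield_Rats[OF M_subfield]] .

lemma twist_projective [simp]: "\<sigma> \<in> carrier G \<Longrightarrow> projective_group (twist \<sigma>)"
  using gal_av_projective[OF lift_M pgEs] .

lemma \<mu>_closed: "\<sigma> \<in> carrier G \<Longrightarrow> \<mu> \<sigma> \<in> qhom L (twist \<sigma>) Es"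
  using \<mu>_isogeny by (simp add: isogeny_def)

lemma \<nu>:
  assumes "\<sigma> \<in> carrier G"
  shows "\<nu> \<sigma> \<in> qhom L Es (twist \<sigma>)" "qcomp (twist \<sigma>) (twist \<sigma>) (\<nu> \<sigma>) (\<mu> \<sigma>) = qid (twist \<sigma>)"
    "qcomp Es Es (\<mu> \<sigma>) (\<nu> \<sigma>) = qid Es"
  using qinv_isogeny[OF \<mu>_isogeny[OF assms]] assms by simp_all

lemmas \<mu>\<nu>_UNIV = \<mu>_closed[THEN qhom_UNIV] \<nu>(1)[THEN qhom_UNIV]

text \<open>The compatibility of \<open>\<mu> \<sigma>\<close> with endomorphisms, multiplied by its
  inverse on both sides. In this form it makes \<open>\<rho>\<^sub>V\<close> linear rather than
  semilinear.\<close>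

lemma \<nu>_compatible:
  assumes \<sigma>: "\<sigma> \<in> carrier G" and \<phi>: "\<phi> \<in> qhom UNIV Es Es"
  shows "qcomp Es (twist \<sigma>) (gal_qmor (lift \<sigma>) \<phi>) (\<nu> \<sigma>) = qcomp Es (twist \<sigma>) (\<nu> \<sigma>) \<phi>"
proof -
  note h = \<mu>\<nu>_UNIV[OF \<sigma>]
  have g: "gal_qmor (lift \<sigma>) \<phi> \<in> qhom UNIV (twist \<sigma>) (twist \<sigma>)"
    by (rule gal_qmor_closed_UNIV[OF lift_M[OF \<sigma>] \<phi> pgEs pgEs])
  have \<nu>\<phi>: "qcomp Es (twist \<sigma>) (\<nu> \<sigma>) \<phi> \<in> qhom UNIV Es (twist \<sigma>)"
    using \<sigma> by (intro qcomp_closed[OF h(2) \<phi>]) simp_all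
  have \<phi>\<mu>: "qcomp (twist \<sigma>) Es \<phi> (\<mu> \<sigma>) \<in> qhom UNIV (twist \<sigma>) Es"
    using \<sigma> by (intro qcomp_closed[OF \<phi> h(1)]) simp_all
  have "qcomp Es (twist \<sigma>) (\<nu> \<sigma>) \<phi> = qcomp Es (twist \<sigma>) (qcomp Es (twist \<sigma>) (\<nu> \<sigma>) \<phi>) (qcomp Es Es (\<mu> \<sigma>) (\<nu> \<sigma>))"
    using \<sigma> \<nu>\<phi> by (simp add: \<nu>(3) qcomp_qid(1))
  also have "\<dots> = qcomp Es (twist \<sigma>) (qcomp (twist \<sigma>) (twist \<sigma>) (qcomp Es (twist \<sigma>) (\<nu> \<sigma>) \<phi>) (\<mu> \<sigma>)) (\<nu> \<sigma>)"
    using \<sigma> by (intro qcomp_assoc[symmetric, OF \<nu>\<phi> h]) simp_all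
  also have "qcomp (twist \<sigma>) (twist \<sigma>) (qcomp Es (twist \<sigma>) (\<nu> \<sigma>) \<phi>) (\<mu> \<sigma>) =
      qcomp (twist \<sigma>) (twist \<sigma>) (\<nu> \<sigma>) (qcomp (twist \<sigma>) Es \<phi> (\<mu> \<sigma>))"
    using \<sigma> by (intro qcomp_assoc[OF h(2) \<phi> h(1)]) simp_all
  also have "\<dots> = qcomp (twist \<sigma>) (twist \<sigma>) (\<nu> \<sigma>) (qcomp (twist \<sigma>) Es (\<mu> \<sigma>) (gal_qmor (lift \<sigma>) \<phi>))"
    by (simp only: \<mu>_compatible[OF \<sigma> \<phi>])
  also have "\<dots> = qcomp (twist \<sigma>) (twist \<sigma>) (qcomp (twist \<sigma>) (twist \<sigma>) (\<nu> \<sigma>) (\<mu> \<sigma>)) (gal_qmor (lift \<sigma>) \<phi>)"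
    using \<sigma> by (intro qcomp_assoc[symmetric, OF h(2,1) g]) simp_all
  also have "\<dots> = gal_qmor (lift \<sigma>) \<phi>"
    using \<sigma> g by (simp add: \<nu>(2) qcomp_qid(2))
  finally show ?thesis ..
qed

text \<open>As A is defined over the rationals, its conjugate is the same group on points, whereas
  \<open>twist \<sigma>\<close> is in general a different curve. Below, conjugation is therefore
  suppressed at the target A and kept at the source.\<close>

lemma same_A: "\<sigma> \<in> carrier G \<Longrightarrow> same_group (gal_av (lift \<sigma>) A) A"
  by (rule gal_av_same_group[OF A_variety lift_Rats])

lemma gal_A_projective [simp]: "\<sigma> \<in> carrier G \<Longrightarrow> projective_group (gal_av (lift \<sigma>) A)"
  by (rule gal_av_projective[OF lift_M pgA])

lemma qhom_gal_A:
  assumes "\<sigma> \<in> carrier G"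
  shows "qhom F B (gal_av (lift \<sigma>) A) = qhom F B A"
  by (rule same_group_qhom[OF same_group_refl same_A[OF assms]]) (use assms in auto)

text \<open>The lift maps L onto itself, so the conjugate of a morphism over L is again defined over
  L.\<close>

lemma gal_V:
  assumes \<sigma>: "\<sigma> \<in> carrier G" and f: "f \<in> qhom L B A" and B: "projective_group B"
  shows "gal_qmor (lift \<sigma>) f \<in> qhom L (gal_av (lift \<sigma>) B) A"
  using gal_qmor_closed[OF lift_M[OF \<sigma>] f B pgA] by (simp add: lift_L[OF \<sigma>] qhom_gal_A[OF \<sigma>])

lemma gal_R:
  assumes \<sigma>: "\<sigma> \<in> carrier G" and \<psi>: "\<psi> \<in> qhom UNIV A A"
  shows "gal_qmor (lift \<sigma>) \<psi> \<in> qhom UNIV A A"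
proof -
  have "qhom UNIV (gal_av (lift \<sigma>) A) (gal_av (lift \<sigma>) A) = qhom UNIV A A"
    by (rule same_group_qhom[OF same_A[OF \<sigma>] same_A[OF \<sigma>]]) (use \<sigma> in auto)
  then show ?thesis using gal_qmor_closed_UNIV[OF lift_M[OF \<sigma>] \<psi> pgA pgA] by simp
qed

lemma gal_comp_A:
  assumes \<sigma>: "\<sigma> \<in> carrier G" and \<phi>: "\<phi> \<in> qhom UNIV C A" and \<psi>: "\<psi> \<in> qhom UNIV B C"
    and B: "projective_group B" and C: "projective_group C"
  shows "gal_qmor (lift \<sigma>) (qcomp B A \<phi> \<psi>) =
    qcomp (gal_av (lift \<sigma>) B) A (gal_qmor (lift \<sigma>) \<phi>) (gal_qmor (lift \<sigma>) \<psi>)"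
proof -
  note \<tau> = lift_M[OF \<sigma>]
  have "gal_qmor (lift \<sigma>) (qcomp B A \<phi> \<psi>) =
      qcomp (gal_av (lift \<sigma>) B) (gal_av (lift \<sigma>) A) (gal_qmor (lift \<sigma>) \<phi>) (gal_qmor (lift \<sigma>) \<psi>)"
    by (rule gal_qmor_qcomp[OF \<tau> \<phi> \<psi> B C pgA])
  also have "\<dots> = qcomp (gal_av (lift \<sigma>) B) A (gal_qmor (lift \<sigma>) \<phi>) (gal_qmor (lift \<sigma>) \<psi>)"
    by (rule same_group_qcomp[OF same_group_refl same_A[OF \<sigma>] _
          gal_qmor_closed_UNIV[OF \<tau> \<phi> C pgA] gal_qmor_closed_UNIV[OF \<tau> \<psi> B C]]) (use \<sigma> in auto)
  finally show ?thesis .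
qed

lemma gal_add_A:
  assumes \<sigma>: "\<sigma> \<in> carrier G" and \<phi>: "\<phi> \<in> qhom UNIV B A" and \<psi>: "\<psi> \<in> qhom UNIV B A"
    and B: "projective_group B"
  shows "gal_qmor (lift \<sigma>) (qadd B A \<phi> \<psi>) =
    qadd (gal_av (lift \<sigma>) B) A (gal_qmor (lift \<sigma>) \<phi>) (gal_qmor (lift \<sigma>) \<psi>)"
proof -
  note \<tau> = lift_M[OF \<sigma>]
  have "gal_qmor (lift \<sigma>) (qadd B A \<phi> \<psi>) =
      qadd (gal_av (lift \<sigma>) B) (gal_av (lift \<sigma>) A) (gal_qmor (lift \<sigma>) \<phi>) (gal_qmor (lift \<sigma>) \<psi>)"
    by (rule gal_qmor_qadd[OF \<tau> \<phi> \<psi> B pgA])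
  also have "\<dots> = qadd (gal_av (lift \<sigma>) B) A (gal_qmor (lift \<sigma>) \<phi>) (gal_qmor (lift \<sigma>) \<psi>)"
    by (rule same_group_qadd[OF same_group_refl same_A[OF \<sigma>] _
          gal_qmor_closed_UNIV[OF \<tau> \<phi> B pgA] gal_qmor_closed_UNIV[OF \<tau> \<psi> B pgA]]) (use \<sigma> in auto)
  finally show ?thesis .
qed

section \<open>The c-representation on V\<close>

lemma rep_V_def: "\<rho>\<^sub>V \<sigma> f = qcomp Es A (gal_qmor (lift \<sigma>) f) (\<nu> \<sigma>)"
  by (simp add: V_rep_def)

lemma rep_V_closed:
  assumes "\<sigma> \<in> carrier G" "f \<in> qhom L Es A"
  shows "\<rho>\<^sub>V \<sigma> f \<in> qhom L Es A"
  unfolding rep_V_def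
  using assms by (intro qcomp_closed[OF gal_V[OF assms pgEs] \<nu>(1)]) simp_all

text \<open>The conjugate of \<open>f\<close> is recovered from
  \<open>\<rho>\<^sub>V \<sigma> f\<close>. This gives injectivity of the action, and it brings in
  the isogeny of the product in the cocycle formula.\<close>

lemma rep_V_\<mu>:
  assumes \<sigma>: "\<sigma> \<in> carrier G" and f: "f \<in> qhom L Es A"
  shows "qcomp (twist \<sigma>) A (\<rho>\<^sub>V \<sigma> f) (\<mu> \<sigma>) = gal_qmor (lift \<sigma>) f"
proof -
  note g = qhom_UNIV[OF gal_V[OF \<sigma> f pgEs]] and h = \<mu>\<nu>_UNIV[OF \<sigma>]
  have "qcomp (twist \<sigma>) A (\<rho>\<^sub>V \<sigma> f) (\<mu> \<sigma>) =
      qcomp (twist \<sigma>) A (gal_qmor (lift \<sigma>) f) (qcomp (twist \<sigma>) (twist \<sigma>) (\<nu> \<sigma>) (\<mu> \<sigma>))"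
    unfolding rep_V_def using \<sigma> by (intro qcomp_assoc[OF g h(2,1)]) simp_all
  then show ?thesis using \<sigma> g by (simp add: \<nu>(2) qcomp_qid(1))
qed

lemma rep_V_linear:
  assumes \<sigma>: "\<sigma> \<in> carrier G"
  shows "\<rho>\<^sub>V \<sigma> \<in> linear_maps (fld M) V V"
  unfolding linear_maps_def V_simps
proof (intro CollectI conjI ballI Pi_I)
  fix f assume f: "f \<in> qhom L Es A"
  show "\<rho>\<^sub>V \<sigma> f \<in> qhom L Es A" by (rule rep_V_closed[OF \<sigma> f])
  fix g assume g: "g \<in> qhom L Es A"
  show "\<rho>\<^sub>V \<sigma> (qadd Es A f g) = qadd Es A (\<rho>\<^sub>V \<sigma> f) (\<rho>\<^sub>V \<sigma> g)"
    unfolding rep_V_def gal_add_A[OF \<sigma> qhom_UNIV[OF f] qhom_UNIV[OF g] pgEs]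
    using \<sigma> by (intro qcomp_qadd_left[OF qhom_UNIV[OF gal_V[OF \<sigma> f pgEs]] qhom_UNIV[OF gal_V[OF \<sigma> g pgEs]]
        \<mu>\<nu>_UNIV(2)[OF \<sigma>]]) simp_all
next
  fix a f assume a: "a \<in> carrier (fld M)" and f: "f \<in> qhom L Es A"
  then have \<iota>a: "\<iota> a \<in> qhom UNIV Es Es" using \<iota>D(1) by simp
  note g = qhom_UNIV[OF gal_V[OF \<sigma> f pgEs]] and h = \<mu>\<nu>_UNIV(2)[OF \<sigma>]
  have ga: "gal_qmor (lift \<sigma>) (\<iota> a) \<in> qhom UNIV (twist \<sigma>) (twist \<sigma>)"
    by (rule gal_qmor_closed_UNIV[OF lift_M[OF \<sigma>] \<iota>a pgEs pgEs])
  have "\<rho>\<^sub>V \<sigma> (qcomp Es A f (\<iota> a)) =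
      qcomp Es A (qcomp (twist \<sigma>) A (gal_qmor (lift \<sigma>) f) (gal_qmor (lift \<sigma>) (\<iota> a))) (\<nu> \<sigma>)"
    unfolding rep_V_def gal_comp_A[OF \<sigma> qhom_UNIV[OF f] \<iota>a pgEs pgEs] ..
  also have "\<dots> = qcomp Es A (gal_qmor (lift \<sigma>) f) (qcomp Es (twist \<sigma>) (gal_qmor (lift \<sigma>) (\<iota> a)) (\<nu> \<sigma>))"
    using \<sigma> by (intro qcomp_assoc[OF g ga h]) simp_all
  \<comment> \<open>The conjugated endomorphism passes through the inverse isogeny and comes out
    unconjugated; here semilinearity disappears.\<close>
  also have "\<dots> = qcomp Es A (gal_qmor (lift \<sigma>) f) (qcomp Es (twist \<sigma>) (\<nu> \<sigma>) (\<iota> a))"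
    unfolding \<nu>_compatible[OF \<sigma> \<iota>a] ..
  also have "\<dots> = qcomp Es A (\<rho>\<^sub>V \<sigma> f) (\<iota> a)"
    unfolding rep_V_def using \<sigma> by (intro qcomp_assoc[symmetric, OF g h \<iota>a]) simp_all
  finally show "\<rho>\<^sub>V \<sigma> (qcomp Es A f (\<iota> a)) = qcomp Es A (\<rho>\<^sub>V \<sigma> f) (\<iota> a)" .
qed

lemma lift_inv_L: "\<sigma> \<in> carrier G \<Longrightarrow> inv_into UNIV (lift \<sigma>) ` L = L"
  using lift_L[of \<sigma>] absGalD(8)[OF lift_M[of \<sigma>]] by (metis (no_types, lifting) image_cong image_ident image_image)

lemma rep_V_bij:
  assumes \<sigma>: "\<sigma> \<in> carrier G"
  shows "bij_betw (\<rho>\<^sub>V \<sigma>) (carrier V) (carrier V)"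
  unfolding bij_betw_def V_simps
proof
  note \<tau> = lift_M[OF \<sigma>]
  show "inj_on (\<rho>\<^sub>V \<sigma>) (qhom L Es A)"
    using rep_V_\<mu>[OF \<sigma>] gal_qmor_inv(1)[OF \<tau>] by (intro inj_onI) metis
  have "g \<in> \<rho>\<^sub>V \<sigma> ` qhom L Es A" if g: "g \<in> qhom L Es A" for g
  proof -
    have gm: "qcomp (twist \<sigma>) A g (\<mu> \<sigma>) \<in> qhom L (twist \<sigma>) A"
      using \<sigma> by (intro qcomp_closed[OF g \<mu>_closed]) simp_all
    \<comment> \<open>Solving \<open>\<rho>\<^sub>V \<sigma> f = g\<close> shows that the conjugate
      of \<open>f\<close> must be \<open>g\<close> composed with \<open>\<mu> \<sigma>\<close>.
      Conjugating back leads to a conjugate of A, which has the same points and sums as A.\<close>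
    define f where "f = gal_qmor (inv_into UNIV (lift \<sigma>)) (qcomp (twist \<sigma>) A g (\<mu> \<sigma>))"
    have "f \<in> qhom L Es (gal_av (inv_into UNIV (lift \<sigma>)) A)"
      using gal_qmor_closed[OF absGal_inv[OF \<tau>] gm twist_projective[OF \<sigma>] pgA]
      unfolding f_def gal_av_inv[OF \<tau>] lift_inv_L[OF \<sigma>] .
    also have "qhom L Es (gal_av (inv_into UNIV (lift \<sigma>)) A) = qhom L Es A"
      by (rule same_group_qhom[OF same_group_refl gal_av_same_group[OF A_variety absGal_inv[OF lift_Rats[OF \<sigma>]]]])
         (use gal_av_projective[OF absGal_inv[OF \<tau>] pgA] in auto)
    finally have f: "f \<in> qhom L Es A" .
    have "\<rho>\<^sub>V \<sigma> f = qcomp Es A (qcomp (twist \<sigma>) A g (\<mu> \<sigma>)) (\<nu> \<sigma>)"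
      unfolding rep_V_def f_def gal_qmor_inv(2)[OF \<tau>] ..
    also have "\<dots> = qcomp Es A g (qcomp Es Es (\<mu> \<sigma>) (\<nu> \<sigma>))"
      using \<sigma> by (intro qcomp_assoc[OF qhom_UNIV[OF g] \<mu>\<nu>_UNIV[OF \<sigma>]]) simp_all
    also have "\<dots> = g" using qhom_UNIV[OF g] by (simp add: \<nu>(3)[OF \<sigma>] qcomp_qid(1))
    finally show ?thesis using f by blast
  qed
  then show "\<rho>\<^sub>V \<sigma> ` qhom L Es A = qhom L Es A" using rep_V_closed[OF \<sigma>] by blast
qed

lemma group_G: "group G"
  by (rule group_Gal[OF L_subfield M_L])

lemma finite_G: "finite (carrier G)"
  by (rule finite_Gal[OF L_finite M_subfield M_L])

lemma one_G: "\<one>\<^bsub>G\<^esub> = (\<lambda>x\<in>L. x)" and one_closed: "\<one>\<^bsub>G\<^esub> \<in> carrier G"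
proof -
  show "\<one>\<^bsub>G\<^esub> \<in> carrier G" using group_G by (simp add: group.is_monoid monoid.one_closed)
  from Gal_simps(2)[OF this this] show "\<one>\<^bsub>G\<^esub> = (\<lambda>x\<in>L. x)" .
qed

text \<open>The chosen lift of the neutral element need not be the identity, but fixing L is enough
  for objects over L.\<close>

lemma lift_one: "lift \<one>\<^bsub>G\<^esub> \<in> absGal L"
  using lift_M[OF one_closed] lift_eq[OF one_closed] one_G by (auto simp: absGal_iff)

lemma rep_V_one:
  assumes f: "f \<in> qhom L Es A"
  shows "\<rho>\<^sub>V \<one>\<^bsub>G\<^esub> f = f"
proof -
  note e = one_closed
  \<comment> \<open>\<open>\<mu>\<close> at the neutral element is given as \<open>qid Es\<close>,
    although formally its source is the twist; the two groups agree on points, so their sets of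
    morphisms coincide.\<close>
  have "same_group (twist \<one>\<^bsub>G\<^esub>) Es" by (rule gal_av_same_group[OF Es_variety lift_one])
  then have "qhom UNIV Es (twist \<one>\<^bsub>G\<^esub>) = qhom UNIV Es Es"
    by (intro same_group_qhom same_group_refl) (use e twist_projective in auto)
  then have "\<nu> \<one>\<^bsub>G\<^esub> \<in> qhom UNIV Es Es" using \<mu>\<nu>_UNIV(2)[OF e] by simp
  then have "\<nu> \<one>\<^bsub>G\<^esub> = qid Es"
    using \<nu>(3)[OF e] unfolding \<mu>_one by (simp add: qcomp_qid(2))
  then show ?thesis
    using qhom_UNIV[OF f] by (simp add: rep_V_def gal_qmor_fixed[OF Es_variety A_L lift_one f] qcomp_qid(1))
qed

lemma mult_G: "\<sigma> \<in> carrier G \<Longrightarrow> \<tau> \<in> carrier G \<Longrightarrow> \<sigma> \<otimes>\<^bsub>G\<^esub> \<tau> \<in> carrier G"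
  using group_G by (simp add: group.is_monoid monoid.m_closed)

text \<open>Lifts are chosen separately for each automorphism, so multiplicativity is available on L
  only; for morphisms over L this suffices.\<close>

lemma lift_mult:
  assumes \<sigma>: "\<sigma> \<in> carrier G" and \<tau>: "\<tau> \<in> carrier G" and x: "x \<in> L"
  shows "(lift \<sigma> \<circ> lift \<tau>) x = lift (\<sigma> \<otimes>\<^bsub>G\<^esub> \<tau>) x"
proof -
  have "\<tau> x \<in> L" using \<tau> x by (auto simp: Gal_iff Bij_def bij_betw_def)
  then show ?thesis
    using lift_eq[OF \<sigma>] lift_eq[OF \<tau> x] lift_eq[OF mult_G[OF \<sigma> \<tau>] x] x
    by (simp add: Gal_simps(1)[OF \<sigma> \<tau>] compose_eq)
qed

lemma gal_mult:
  assumes \<sigma>: "\<sigma> \<in> carrier G" and \<tau>: "\<tau> \<in> carrier G"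
    and "abelian_variety L B" "abelian_variety L C" "\<phi> \<in> qhom L B C"
  shows "gal_qmor (lift \<sigma>) (gal_qmor (lift \<tau>) \<phi>) = gal_qmor (lift (\<sigma> \<otimes>\<^bsub>G\<^esub> \<tau>)) \<phi>"
  unfolding gal_qmor_comp[OF lift_M[OF \<sigma>] lift_M[OF \<tau>]]
  by (rule gal_agree(2)[OF absGal_comp[OF lift_M[OF \<sigma>] lift_M[OF \<tau>]] lift_M[OF mult_G[OF \<sigma> \<tau>]]
        lift_mult[OF \<sigma> \<tau>] assms(3-5)])

text \<open>The isogeny of the product, composed with the inverses of the two others, is an
  endomorphism of \<open>Es\<close>, hence the scalar \<open>c_curve\<close>. It appears once the
  conjugate of \<open>f\<close> by the product is written as
  \<open>\<rho>\<^sub>V (\<sigma> \<otimes> \<tau>) f\<close> composed with that isogeny.\<close>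

lemma rep_V_mult:
  assumes \<sigma>: "\<sigma> \<in> carrier G" and \<tau>: "\<tau> \<in> carrier G"
  defines "c \<equiv> c_curve L M Es \<iota> \<mu> \<sigma> \<tau>"
  shows "c \<in> M" and "f \<in> carrier V \<Longrightarrow> \<rho>\<^sub>V \<sigma> (\<rho>\<^sub>V \<tau> f) = c \<odot>\<^bsub>V\<^esub> \<rho>\<^sub>V (\<sigma> \<otimes>\<^bsub>G\<^esub> \<tau>) f"
proof -
  define \<upsilon> where "\<upsilon> = \<sigma> \<otimes>\<^bsub>G\<^esub> \<tau>"
  have \<upsilon>: "\<upsilon> \<in> carrier G" unfolding \<upsilon>_def by (rule mult_G[OF \<sigma> \<tau>])
  define E2 where "E2 = gal_av (lift \<sigma>) (twist \<tau>)"
  have pE2: "projective_group E2"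
    unfolding E2_def by (rule gal_av_projective[OF lift_M[OF \<sigma>] twist_projective[OF \<tau>]])
  \<comment> \<open>The iterated twist and the twist by the product agree on points but may differ
    as records; this identifies the morphisms from or to them.\<close>
  have same: "same_group E2 (twist \<upsilon>)"
    unfolding E2_def \<upsilon>_def gal_av_comp[OF lift_M[OF \<sigma>] lift_M[OF \<tau>]]
    by (rule gal_agree(1)[OF absGal_comp[OF lift_M[OF \<sigma>] lift_M[OF \<tau>]] lift_M[OF mult_G[OF \<sigma> \<tau>]]
        lift_mult[OF \<sigma> \<tau>] Es_variety])
  define \<nu>' where "\<nu>' = gal_qmor (lift \<sigma>) (\<nu> \<tau>)"
  have \<nu>': "\<nu>' \<in> qhom UNIV (twist \<sigma>) E2"
    unfolding \<nu>'_def E2_def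
    by (rule gal_qmor_closed_UNIV[OF lift_M[OF \<sigma>] \<mu>\<nu>_UNIV(2)[OF \<tau>] pgEs twist_projective[OF \<tau>]])
  define y where "y = qcomp Es E2 \<nu>' (\<nu> \<sigma>)"
  have y: "y \<in> qhom UNIV Es E2"
    unfolding y_def using \<sigma> by (intro qcomp_closed[OF \<nu>' \<mu>\<nu>_UNIV(2)[OF \<sigma>]] pE2) simp_all
  have y': "y \<in> qhom UNIV Es (twist \<upsilon>)"
    using y same_group_qhom[OF same_group_refl same] pE2 by auto
  have x: "qcomp Es Es (\<mu> \<upsilon>) y \<in> qhom UNIV Es Es"
    using \<upsilon> by (intro qcomp_closed[OF \<mu>\<nu>_UNIV(1)[OF \<upsilon>] y']) simp_all
  have c: "c = inv_into M \<iota> (qcomp Es Es (\<mu> \<upsilon>) y)"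
    by (simp add: c_def c_curve_def y_def \<nu>'_def E2_def \<upsilon>_def)
  \<comment> \<open>As \<iota> is onto the endomorphisms of \<open>Es\<close>, the inverse in
    \<open>c_curve\<close> really picks a preimage.\<close>
  have \<iota>c: "\<iota> c = qcomp Es Es (\<mu> \<upsilon>) y" and cM: "c \<in> M"
    unfolding c using x \<iota>D(5) by (auto simp: bij_betw_def f_inv_into_f inv_into_into)
  show "c \<in> M" by (rule cM)
  show "\<rho>\<^sub>V \<sigma> (\<rho>\<^sub>V \<tau> f) = c \<odot>\<^bsub>V\<^esub> \<rho>\<^sub>V (\<sigma> \<otimes>\<^bsub>G\<^esub> \<tau>) f" if "f \<in> carrier V"
  proof -
    have f: "f \<in> qhom L Es A" using that by (simp add: V_simps)
    note gf = qhom_UNIV[OF gal_V[OF \<tau> f pgEs]]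
    define F where "F = gal_qmor (lift \<upsilon>) f"
    have F: "F \<in> qhom UNIV (twist \<upsilon>) A"
      unfolding F_def by (rule qhom_UNIV[OF gal_V[OF \<upsilon> f pgEs]])
    have F': "F \<in> qhom UNIV E2 A"
      using F same_group_qhom[OF same same_group_refl] by auto
    have "\<rho>\<^sub>V \<sigma> (\<rho>\<^sub>V \<tau> f) = qcomp Es A (qcomp (twist \<sigma>) A (gal_qmor (lift \<sigma>) (gal_qmor (lift \<tau>) f)) \<nu>') (\<nu> \<sigma>)"
      unfolding rep_V_def gal_comp_A[OF \<sigma> gf \<mu>\<nu>_UNIV(2)[OF \<tau>] pgEs twist_projective[OF \<tau>]] \<nu>'_def ..
    also have "\<dots> = qcomp Es A (qcomp (twist \<sigma>) A F \<nu>') (\<nu> \<sigma>)"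
      unfolding gal_mult[OF \<sigma> \<tau> Es_variety A_L f] F_def \<upsilon>_def ..
    also have "\<dots> = qcomp Es A F y"
      unfolding y_def using \<sigma> by (intro qcomp_assoc[OF F' \<nu>' \<mu>\<nu>_UNIV(2)[OF \<sigma>]] pE2) simp_all
    also have "\<dots> = qcomp Es A (qcomp (twist \<upsilon>) A (\<rho>\<^sub>V \<upsilon> f) (\<mu> \<upsilon>)) y"
      unfolding rep_V_\<mu>[OF \<upsilon> f] F_def ..
    also have "\<dots> = qcomp Es A (\<rho>\<^sub>V \<upsilon> f) (qcomp Es Es (\<mu> \<upsilon>) y)"
      using \<upsilon> by (intro qcomp_assoc[OF qhom_UNIV[OF rep_V_closed[OF \<upsilon> f]] \<mu>\<nu>_UNIV(1)[OF \<upsilon>] y']) simp_all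
    finally show ?thesis by (simp add: V_simps \<iota>c \<upsilon>_def)
  qed
qed

lemma c_rep_V: "c_rep G (fld M) V \<rho>\<^sub>V (c_curve L M Es \<iota> \<mu>)"
  unfolding c_rep_def
proof (intro conjI ballI)
  show "group G" "finite (carrier G)" "findim_space (fld M) V"
    by (rule group_G finite_G findim_V)+
  fix v assume "v \<in> carrier V"
  then show "\<rho>\<^sub>V \<one>\<^bsub>G\<^esub> v = v" by (simp add: V_simps rep_V_one)
next
  interpret V: module "fld M" V by (rule module_V)
  fix \<sigma> assume \<sigma>: "\<sigma> \<in> carrier G"
  show "\<rho>\<^sub>V \<sigma> \<in> linear_maps (fld M) V V" by (rule rep_V_linear[OF \<sigma>])
  show "bij_betw (\<rho>\<^sub>V \<sigma>) (carrier V) (carrier V)" by (rule rep_V_bij[OF \<sigma>])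
  fix \<tau> assume \<tau>: "\<tau> \<in> carrier G"
  note c = rep_V_mult[OF \<sigma> \<tau>]
  show "\<And>v. v \<in> carrier V \<Longrightarrow> \<rho>\<^sub>V \<sigma> (\<rho>\<^sub>V \<tau> v) = c_curve L M Es \<iota> \<mu> \<sigma> \<tau> \<odot>\<^bsub>V\<^esub> \<rho>\<^sub>V (\<sigma> \<otimes>\<^bsub>G\<^esub> \<tau>) v"
    by (rule c(2))
  \<comment> \<open>A zero value would make the composite of two injective maps zero, and so V
    itself.\<close>
  have "c_curve L M Es \<iota> \<mu> \<sigma> \<tau> \<noteq> 0"
  proof
    assume 0: "c_curve L M Es \<iota> \<mu> \<sigma> \<tau> = 0"
    have z: "\<rho>\<^sub>V \<sigma> \<zero>\<^bsub>V\<^esub> = \<zero>\<^bsub>V\<^esub>" "\<rho>\<^sub>V \<tau> \<zero>\<^bsub>V\<^esub> = \<zero>\<^bsub>V\<^esub>"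
      using linear_map_zero[OF module_V module_V] rep_V_linear \<sigma> \<tau> by blast+
    have "f = \<zero>\<^bsub>V\<^esub>" if f: "f \<in> carrier V" for f
    proof -
      have "\<rho>\<^sub>V (\<sigma> \<otimes>\<^bsub>G\<^esub> \<tau>) f \<in> carrier V"
        using f rep_V_closed[OF mult_G[OF \<sigma> \<tau>]] by (simp add: V_simps)
      then have "\<rho>\<^sub>V \<sigma> (\<rho>\<^sub>V \<tau> f) = \<zero>\<^bsub>V\<^esub>"
        using c(2)[OF f] V.smult_l_null unfolding 0 by simp
      moreover have "\<rho>\<^sub>V \<tau> f \<in> carrier V" using f rep_V_closed[OF \<tau>] by (simp add: V_simps)
      ultimately have "\<rho>\<^sub>V \<tau> f = \<zero>\<^bsub>V\<^esub>"
        using z(1) inj_onD[OF bij_betw_imp_inj_on[OF rep_V_bij[OF \<sigma>]], of "\<rho>\<^sub>V \<tau> f" "\<zero>\<^bsub>V\<^esub>"]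
          V.M.zero_closed by metis
      then show ?thesis
        using z(2) f inj_onD[OF bij_betw_imp_inj_on[OF rep_V_bij[OF \<tau>]], of f "\<zero>\<^bsub>V\<^esub>"]
          V.M.zero_closed by metis
    qed
    then have "carrier V = {\<zero>\<^bsub>V\<^esub>}" using V.M.zero_closed by auto
    with V_nontrivial show False by simp
  qed
  then show "c_curve L M Es \<iota> \<mu> \<sigma> \<tau> \<in> carrier (fld M) - {\<zero>\<^bsub>fld M\<^esub>}" using c(1) by simp
qed

section \<open>The representations on R and T and the equivariance of Phi\<close>

lemma rep_V_comp:
  assumes \<sigma>: "\<sigma> \<in> carrier G" and \<psi>: "\<psi> \<in> qhom UNIV A A" and f: "f \<in> qhom L Es A"
  shows "\<rho>\<^sub>V \<sigma> (qcomp Es A \<psi> f) = qcomp Es A (gal_qmor (lift \<sigma>) \<psi>) (\<rho>\<^sub>V \<sigma> f)"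
  unfolding rep_V_def gal_comp_A[OF \<sigma> \<psi> qhom_UNIV[OF f] pgEs pgA]
  using \<sigma> by (intro qcomp_assoc[OF gal_R[OF \<sigma> \<psi>] qhom_UNIV[OF gal_V[OF \<sigma> f pgEs]] \<mu>\<nu>_UNIV(2)[OF \<sigma>]]) simp_all

text \<open>Both \<open>j a\<close> and its conjugate act on V as the scalar \<open>a\<close>: every
  element of V has the form \<open>\<rho>\<^sub>V \<sigma> f'\<close>, and
  \<open>\<rho>\<^sub>V \<sigma>\<close> is M-linear.\<close>

lemma gal_j:
  assumes \<sigma>: "\<sigma> \<in> carrier G" and a: "a \<in> M"
  shows "gal_qmor (lift \<sigma>) (j a) = j a"
proof -
  have ja: "j a \<in> qhom UNIV A A" by (rule jD(1)[OF a])
  have "\<Phi> (gal_qmor (lift \<sigma>) (j a)) = \<Phi> (j a)"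
    unfolding Phi_def
  proof (rule restrict_ext)
    fix f assume "f \<in> qhom L Es A"
    then obtain f' where f': "f' \<in> qhom L Es A" "f = \<rho>\<^sub>V \<sigma> f'"
      using rep_V_bij[OF \<sigma>] unfolding bij_betw_def V_simps by blast
    have "qcomp Es A (gal_qmor (lift \<sigma>) (j a)) f = \<rho>\<^sub>V \<sigma> (qcomp Es A (j a) f')"
      unfolding f'(2) by (rule rep_V_comp[OF \<sigma> ja f'(1), symmetric])
    also have "\<dots> = \<rho>\<^sub>V \<sigma> (a \<odot>\<^bsub>V\<^esub> f')" using j_compat[OF a f'(1)] by (simp add: V_simps)
    also have "\<dots> = a \<odot>\<^bsub>V\<^esub> f"
      unfolding f'(2) using a f'(1) by (intro linear_mapsD(3)[OF rep_V_linear[OF \<sigma>]]) (simp_all add: V_simps)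
    also have "\<dots> = qcomp Es A (j a) f"
      using j_compat[OF a rep_V_closed[OF \<sigma> f'(1)]] by (simp add: V_simps f'(2))
    finally show "qcomp Es A (gal_qmor (lift \<sigma>) (j a)) f = qcomp Es A (j a) f" .
  qed
  then show ?thesis using Phi_inj gal_R[OF \<sigma> ja] ja by (auto simp: inj_on_def R_simps)
qed

lemma rep_R_linear:
  assumes \<sigma>: "\<sigma> \<in> carrier G"
  shows "R_rep L \<sigma> \<in> linear_maps (fld M) R R"
  unfolding linear_maps_def R_simps R_rep_def
proof (intro CollectI conjI ballI Pi_I)
  note gA = same_A[OF \<sigma>]
  fix x assume x: "x \<in> qhom UNIV A A"
  show "gal_qmor (lift \<sigma>) x \<in> qhom UNIV A A" by (rule gal_R[OF \<sigma> x])
  fix y assume y: "y \<in> qhom UNIV A A"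
  have "qadd (gal_av (lift \<sigma>) A) A (gal_qmor (lift \<sigma>) x) (gal_qmor (lift \<sigma>) y) =
      qadd A A (gal_qmor (lift \<sigma>) x) (gal_qmor (lift \<sigma>) y)"
    using same_group_qhom[OF gA same_group_refl, of A UNIV] gal_R[OF \<sigma> x] gal_R[OF \<sigma> y]
    by (intro same_group_qadd[OF gA same_group_refl]) auto
  then show "gal_qmor (lift \<sigma>) (qadd A A x y) = qadd A A (gal_qmor (lift \<sigma>) x) (gal_qmor (lift \<sigma>) y)"
    using gal_add_A[OF \<sigma> x y pgA] by simp
next
  note gA = same_A[OF \<sigma>]
  fix a x assume a: "a \<in> carrier (fld M)" and x: "x \<in> qhom UNIV A A"
  have ja: "j a \<in> qhom UNIV A A" using a jD(1) by simp
  have "qcomp (gal_av (lift \<sigma>) A) A (j a) (gal_qmor (lift \<sigma>) x) = qcomp A A (j a) (gal_qmor (lift \<sigma>) x)"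
    using same_group_qhom[OF gA same_group_refl, of A UNIV] gal_R[OF \<sigma> x]
    by (intro same_group_qcomp[OF gA same_group_refl _ ja]) auto
  then show "gal_qmor (lift \<sigma>) (qcomp A A (j a) x) = qcomp A A (j a) (gal_qmor (lift \<sigma>) x)"
    using gal_comp_A[OF \<sigma> ja x pgA pgA] gal_j[OF \<sigma>] a by simp
qed

lemma rep_R_bij:
  assumes \<sigma>: "\<sigma> \<in> carrier G"
  shows "bij_betw (R_rep L \<sigma>) (carrier R) (carrier R)"
proof (rule bij_betw_byWitness[where f' = "gal_qmor (inv_into UNIV (lift \<sigma>))"])
  note \<tau> = lift_M[OF \<sigma>]
  have \<rho>: "inv_into UNIV (lift \<sigma>) \<in> absGal \<rat>" by (rule absGal_inv[OF lift_Rats[OF \<sigma>]])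
  note gA = gal_av_same_group[OF A_variety \<rho>]
  show "\<forall>x\<in>carrier R. gal_qmor (inv_into UNIV (lift \<sigma>)) (R_rep L \<sigma> x) = x"
    "\<forall>x\<in>carrier R. R_rep L \<sigma> (gal_qmor (inv_into UNIV (lift \<sigma>)) x) = x"
    by (simp_all add: R_rep_def gal_qmor_inv[OF \<tau>])
  show "R_rep L \<sigma> ` carrier R \<subseteq> carrier R"
    using gal_R[OF \<sigma>] by (auto simp: R_rep_def R_simps)
  have "qhom UNIV (gal_av (inv_into UNIV (lift \<sigma>)) A) (gal_av (inv_into UNIV (lift \<sigma>)) A) = qhom UNIV A A"
    by (rule same_group_qhom[OF gA gA]) (use gal_av_projective[OF \<rho> pgA] in auto)
  then show "gal_qmor (inv_into UNIV (lift \<sigma>)) ` carrier R \<subseteq> carrier R"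
    using gal_qmor_closed_UNIV[OF \<rho> _ pgA pgA] by (auto simp: R_simps)
qed

lemma R_K: "\<psi> \<in> carrier R \<Longrightarrow> \<psi> \<in> qhom K A A"
  by (simp add: R_simps K_end)

lemma R_L: "\<psi> \<in> carrier R \<Longrightarrow> \<psi> \<in> qhom L A A"
  by (simp add: R_simps end_A)

text \<open>Endomorphisms of A are defined over K, so their conjugates depend only on the
  restriction of the lift to K.\<close>

lemma rep_R_factors:
  assumes "\<sigma> \<in> carrier G" "\<tau> \<in> carrier G" "\<And>x. x \<in> K \<Longrightarrow> \<sigma> x = \<tau> x" "\<psi> \<in> carrier R"
  shows "R_rep L \<sigma> \<psi> = R_rep L \<tau> \<psi>"
  unfolding R_rep_def
  using assms(3) lift_eq[OF assms(1)] lift_eq[OF assms(2)] K_L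
  by (intro gal_agree(2)[OF lift_M[OF assms(1)] lift_M[OF assms(2)] _ A_K A_K R_K[OF assms(4)]]) auto

lemma c_rep_R: "c_rep G (fld M) R (R_rep L) (\<lambda>\<sigma> \<tau>. 1)"
  unfolding c_rep_def
proof (intro conjI ballI)
  show "group G" "finite (carrier G)" "findim_space (fld M) R"
    by (rule group_G finite_G findim_R)+
  fix v assume v: "v \<in> carrier R"
  show "R_rep L \<one>\<^bsub>G\<^esub> v = v"
    unfolding R_rep_def by (rule gal_qmor_fixed[OF A_L A_L lift_one R_L[OF v]])
next
  interpret R: module "fld M" R by (rule module_R)
  fix \<sigma> assume \<sigma>: "\<sigma> \<in> carrier G"
  show "R_rep L \<sigma> \<in> linear_maps (fld M) R R" by (rule rep_R_linear[OF \<sigma>])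
  show "bij_betw (R_rep L \<sigma>) (carrier R) (carrier R)" by (rule rep_R_bij[OF \<sigma>])
  fix \<tau> assume \<tau>: "\<tau> \<in> carrier G"
  show "1 \<in> carrier (fld M) - {\<zero>\<^bsub>fld M\<^esub>}" using M_closed(2) by simp
  fix v assume v: "v \<in> carrier R"
  have "R_rep L (\<sigma> \<otimes>\<^bsub>G\<^esub> \<tau>) v \<in> carrier R"
    using v gal_R[OF mult_G[OF \<sigma> \<tau>]] by (simp add: R_rep_def R_simps)
  then have "1 \<odot>\<^bsub>R\<^esub> R_rep L (\<sigma> \<otimes>\<^bsub>G\<^esub> \<tau>) v = R_rep L (\<sigma> \<otimes>\<^bsub>G\<^esub> \<tau>) v"
    using R.smult_one by simp
  then show "R_rep L \<sigma> (R_rep L \<tau> v) = 1 \<odot>\<^bsub>R\<^esub> R_rep L (\<sigma> \<otimes>\<^bsub>G\<^esub> \<tau>) v"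
    by (simp add: R_rep_def gal_mult[OF \<sigma> \<tau> A_L A_L R_L[OF v]])
qed

lemma Phi_equivariant:
  assumes \<sigma>: "\<sigma> \<in> carrier G" and \<psi>: "\<psi> \<in> carrier R"
  shows "\<Phi> (R_rep L \<sigma> \<psi>) = end_rep V \<rho>\<^sub>V \<sigma> (\<Phi> \<psi>)"
  unfolding end_rep_def Phi_def V_simps(1) R_rep_def
proof (rule restrict_ext)
  fix f assume f: "f \<in> qhom L Es A"
  define f' where "f' = inv_into (qhom L Es A) (\<rho>\<^sub>V \<sigma>) f"
  have "f \<in> \<rho>\<^sub>V \<sigma> ` qhom L Es A"
    using f rep_V_bij[OF \<sigma>] by (simp add: bij_betw_def V_simps)
  then have f': "f' \<in> qhom L Es A" "\<rho>\<^sub>V \<sigma> f' = f"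
    unfolding f'_def by (rule inv_into_into, rule f_inv_into_f)
  have "qcomp Es A (gal_qmor (lift \<sigma>) \<psi>) f = \<rho>\<^sub>V \<sigma> (qcomp Es A \<psi> f')"
    using rep_V_comp[OF \<sigma> _ f'(1)] \<psi> f'(2) by (simp add: R_simps)
  then show "qcomp Es A (gal_qmor (lift \<sigma>) \<psi>) f =
      \<rho>\<^sub>V \<sigma> ((\<lambda>f\<in>qhom L Es A. qcomp Es A \<psi> f) (inv_into (qhom L Es A) (\<rho>\<^sub>V \<sigma>) f))"
    using f' by (simp add: f'_def)
qed

lemma c_rep_T: "c_rep G (fld M) T (end_rep V \<rho>\<^sub>V) (\<lambda>\<sigma> \<tau>. 1)"
  by (rule c_rep_transfer[OF c_rep_R Phi_linear Phi_bij Phi_zero Phi_equivariant])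

lemma c_rep_iso_Phi: "c_rep_iso G (fld M) R (R_rep L) T (end_rep V \<rho>\<^sub>V) \<Phi>"
  unfolding c_rep_iso_def c_rep_hom_def
proof (intro conjI ballI Phi_linear Phi_bij)
  fix \<sigma> \<psi> assume \<sigma>: "\<sigma> \<in> carrier G" and \<psi>: "\<psi> \<in> carrier R"
  \<comment> \<open>\<open>c_rep_hom\<close> is phrased with the inverse of the action on the
    source, so equivariance is applied to the preimage of \<psi>.\<close>
  have "\<psi> \<in> R_rep L \<sigma> ` carrier R" using \<psi> rep_R_bij[OF \<sigma>] by (simp add: bij_betw_def)
  then show "\<Phi> \<psi> = end_rep V \<rho>\<^sub>V \<sigma> (\<Phi> (inv_into (carrier R) (R_rep L \<sigma>) \<psi>))"
    using Phi_equivariant[OF \<sigma> inv_into_into] f_inv_into_f by metis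
qed

lemma left_module_iso_Phi:
  "left_module_iso (group_algebra (fld M) G) (rep_module G R (R_rep L)) (rep_module G T (end_rep V \<rho>\<^sub>V)) \<Phi>"
  using c_rep_R c_rep_T Phi_linear Phi_bij Phi_equivariant
  by (intro equivariant_left_module_iso) simp_all

end

section \<open>From the hypotheses of the theorem to data over L\<close>

theorem lemma2p16:
  fixes M K N L :: "qbar set"
    and A E Es :: "point monoid"
    and \<iota> j :: "qbar \<Rightarrow> qmor"
    and \<mu> :: "(qbar \<Rightarrow> qbar) \<Rightarrow> qmor"
  assumes M: "imaginary_quadratic M"
    and A: "abelian_surface \<rat> A"
    and K: "number_field K" "qhom K A A = qhom UNIV A A"
    and K_min: "\<And>F. subfield F Qbar \<Longrightarrow> qhom F A A = qhom UNIV A A \<Longrightarrow> K \<subseteq> F"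
    and K_galois: "galois_extension \<rat> K"
    and E: "elliptic_curve K E" "has_CM E M" "isogenous K A (av_prod E E)"
    and N: "M \<subseteq> N" "N \<subseteq> K" "galois_extension M N"
    and Es: "ribet_curve M N Es" "isogenous UNIV Es E"
    and L: "finite_extension K L" "isogenous L Es E"
    and L_min: "\<And>F. subfield F Qbar \<Longrightarrow> K \<subseteq> F \<Longrightarrow> isogenous F Es E \<Longrightarrow> L \<subseteq> F"
    and L_galois: "galois_extension \<rat> L"
    and \<iota>: "\<iota> \<in> ring_iso (fld M) (qend N Es)"
    and \<mu>: "\<And>\<sigma>. \<sigma> \<in> carrier (Gal L M) \<Longrightarrow> compatible_isogeny N Es (gal_lift L \<sigma>) (\<mu> \<sigma>)"
    and \<mu>_one: "\<mu> \<one>\<^bsub>Gal L M\<^esub> = qid Es"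
    and j: "j \<in> ring_iso (fld M) (qend_center K A)"
    and j_compat: "\<And>m f. m \<in> M \<Longrightarrow> f \<in> qhom L Es A \<Longrightarrow>
                     qcomp Es A (j m) f = qcomp Es A f (\<iota> m)"
    and V: "V = V_module L Es A \<iota>" "\<rho>\<^sub>V = V_rep L Es A \<mu>"
    and T: "T = hom_module (fld M) V V" "\<rho>\<^sub>T = end_rep V \<rho>\<^sub>V"
    and R: "R = R_module K A j" "\<rho>\<^sub>R = R_rep L"
  shows "c_rep (Gal L M) (fld M) V \<rho>\<^sub>V (c_curve L M Es \<iota> \<mu>) \<and>
    c_rep (Gal L M) (fld M) T \<rho>\<^sub>T (\<lambda>\<sigma> \<tau>. 1) \<and>
    c_rep (Gal L M) (fld M) R \<rho>\<^sub>R (\<lambda>\<sigma> \<tau>. 1) \<and>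
    (\<forall>\<sigma>\<in>carrier (Gal L M). \<forall>\<tau>\<in>carrier (Gal L M). (\<forall>x\<in>K. \<sigma> x = \<tau> x) \<longrightarrow>
       (\<forall>\<psi>\<in>carrier R. \<rho>\<^sub>R \<sigma> \<psi> = \<rho>\<^sub>R \<tau> \<psi>)) \<and>
    c_rep_iso (Gal L M) (fld M) R \<rho>\<^sub>R T \<rho>\<^sub>T (Phi L Es A) \<and>
    left_module_iso (group_algebra (fld M) (Gal L M))
      (rep_module (Gal L M) R \<rho>\<^sub>R) (rep_module (Gal L M) T \<rho>\<^sub>T) (Phi L Es A)"
proof -
  have MN: "subfield M Qbar" and KL: "subfield K Qbar" "K \<subseteq> L"
    using N(3) L(1) by (auto simp: galois_extension_def finite_extension_def)
  have NL: "N \<subseteq> L" "M \<subseteq> L" using N KL by auto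
  have L_fin: "finite_extension \<rat> L" using L_galois by (simp add: galois_extension_def)
  then have L_sub: "subfield L Qbar" by (simp add: finite_extension_def)
  have A_var: "abelian_variety \<rat> A" using A by (simp add: abelian_surface_def)
  have E_var: "abelian_variety L E"
    using E(1) abelian_variety_mono[OF _ KL(2)] by (simp add: elliptic_curve_def)
  have Es_var: "abelian_variety L Es"
    using Es(1) abelian_variety_mono[OF _ NL(1)] by (simp add: ribet_curve_def elliptic_curve_def)
  note gv = abelian_variety_group_variety
  have gvA: "group_variety L A" using group_variety_mono[OF gv[OF A_var] subfield_Rats[OF L_sub]] .
  have gvE: "group_variety L E" and gvEs: "group_variety L Es" using E_var Es_var gv by auto
  have pgA: "projective_group A" and pgE: "projective_group E" and pgEs: "projective_group Es"
    using gvA gvE gvEs by auto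
  obtain \<theta> where \<theta>: "isogeny UNIV Es E \<theta>" using Es(2) by (auto simp: isogenous_def)
  have end_Es: "qhom N Es Es = qhom UNIV Es Es"
    by (rule CM_endomorphisms_defined[OF M MN E(2) \<theta>])
       (use gvE gvEs group_variety_mono \<iota> in blast)+
  have "isogenous L A (av_prod E E)"
    using E(3) qhom_mono[OF KL(2)] unfolding isogenous_def isogeny_def by blast
  then obtain i\<^sub>1 i\<^sub>2 p\<^sub>1 p\<^sub>2 where d: "i\<^sub>1 \<in> qhom L E A" "i\<^sub>2 \<in> qhom L E A" "p\<^sub>1 \<in> qhom L A E"
    "p\<^sub>2 \<in> qhom L A E" "qadd A A (qcomp A A i\<^sub>1 p\<^sub>1) (qcomp A A i\<^sub>2 p\<^sub>2) = qid A"
    by (rule isogenous_square_decomposition[OF _ gvA gvE])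
  obtain \<alpha> where \<alpha>: "isogeny L Es E \<alpha>" using L(2) by (auto simp: isogenous_def)
  define \<beta> where "\<beta> = qinv Es E \<alpha>"
  have \<alpha>': "\<alpha> \<in> qhom L Es E" using \<alpha> by (simp add: isogeny_def)
  have \<beta>: "\<beta> \<in> qhom L E Es" "qcomp E E \<alpha> \<beta> = qid E"
    using qinv_isogeny[OF \<alpha> pgEs pgE] by (simp_all add: \<beta>_def)
  \<comment> \<open>Inserting \<open>\<alpha>\<close> after \<open>\<beta>\<close>, which is the
    identity of E, between \<open>p\<close> and \<open>i\<close> turns the decomposition through E
    into one through \<open>Es\<close>.\<close>
  have transport: "qcomp A A (qcomp Es A i \<alpha>) (qcomp A Es \<beta> p) = qcomp A A i p"
    if i: "i \<in> qhom L E A" and p: "p \<in> qhom L A E" for i p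
  proof -
    note U = qhom_UNIV[OF i] qhom_UNIV[OF p] qhom_UNIV[OF \<alpha>'] qhom_UNIV[OF \<beta>(1)]
    have \<beta>p: "qcomp A Es \<beta> p \<in> qhom UNIV A Es" by (rule qcomp_closed[OF U(4,2) pgA pgE pgEs])
    have "qcomp A A (qcomp Es A i \<alpha>) (qcomp A Es \<beta> p) = qcomp A A i (qcomp A E \<alpha> (qcomp A Es \<beta> p))"
      by (rule qcomp_assoc[OF U(1,3) \<beta>p pgA pgEs pgE pgA])
    also have "qcomp A E \<alpha> (qcomp A Es \<beta> p) = qcomp A E (qcomp E E \<alpha> \<beta>) p"
      by (rule qcomp_assoc[symmetric, OF U(3,4,2) pgA pgE pgEs pgE])
    also have "\<dots> = p" using qcomp_qid(2)[OF U(2) pgA pgE] by (simp add: \<beta>(2))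
    finally show ?thesis .
  qed
  interpret ribet_representation M K L A Es \<iota> j \<mu> "qcomp Es A i\<^sub>1 \<alpha>" "qcomp Es A i\<^sub>2 \<alpha>" "qcomp A Es \<beta> p\<^sub>1" "qcomp A Es \<beta> p\<^sub>2"
  proof (rule ribet_representation.intro)
    show "\<iota> \<in> ring_iso (fld M) (qend UNIV Es)"
      using \<iota> end_Es by (simp add: qend_def)
    show "\<iota> ` M \<subseteq> qhom L Es Es"
      using ring_iso_qendD(1)[OF \<iota>] qhom_mono[OF NL(1)] by blast
    fix \<sigma> assume \<sigma>: "\<sigma> \<in> carrier (Gal L M)"
    show "isogeny L (gal_av (gal_lift L \<sigma>) Es) Es (\<mu> \<sigma>)"
      using \<mu>[OF \<sigma>] qhom_mono[OF NL(1)] unfolding compatible_isogeny_def isogeny_def by blast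
    \<comment> \<open>Compatibility is given for endomorphisms over N; by \<open>end_Es\<close>
      these are all of them.\<close>
    fix \<phi> assume "\<phi> \<in> qhom UNIV Es Es"
    then show "qcomp (gal_av (gal_lift L \<sigma>) Es) Es (\<mu> \<sigma>) (gal_qmor (gal_lift L \<sigma>) \<phi>) =
        qcomp (gal_av (gal_lift L \<sigma>) Es) Es \<phi> (\<mu> \<sigma>)"
      using \<mu>[OF \<sigma>] end_Es by (simp add: compatible_isogeny_def)
  next
    show "qcomp Es A i\<^sub>1 \<alpha> \<in> qhom L Es A" "qcomp Es A i\<^sub>2 \<alpha> \<in> qhom L Es A"
      using d \<alpha>' pgA pgE pgEs by (auto intro: qcomp_closed)
    show "qcomp A Es \<beta> p\<^sub>1 \<in> qhom L A Es" "qcomp A Es \<beta> p\<^sub>2 \<in> qhom L A Es"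
      using d \<beta>(1) pgA pgE pgEs by (auto intro: qcomp_closed)
    show "qadd A A (qcomp A A (qcomp Es A i\<^sub>1 \<alpha>) (qcomp A Es \<beta> p\<^sub>1))
        (qcomp A A (qcomp Es A i\<^sub>2 \<alpha>) (qcomp A Es \<beta> p\<^sub>2)) = qid A"
      using d by (simp add: transport)
  qed (fact MN NL(2) KL L_fin A_var Es_var K(2) \<mu>_one j j_compat)+
  show ?thesis
    unfolding V T R
    using c_rep_V c_rep_T c_rep_R rep_R_factors c_rep_iso_Phi left_module_iso_Phi by blast
qed

end
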